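(* Let $K_\lambda G$ be an infinite twisted group algebra of a group $G$ over a field $K$, let $\Delta U$ be the $FC$-center of $U(K_\lambda G)$ and $t(\Delta U)$ the subgroup of all elements of finite order of $\Delta U$. Then $\Delta U$ is a solvable group of (derived) length at most $3$, and the subgroup $t(\Delta U)$ is nilpotent of class at most $2$.
   Context: Let $G$ be a group, $K$ a field, $U(K)=K\setminus\{0\}$, and $\lambda:G\times G\to U(K)$, $(g,h)\mapsto\lambda_{g,h}$, a $2$-cocycle with respect to the trivial action of $G$, i.e. $\lambda_{g,h}\lambda_{gh,k}=\lambda_{h,k}\lambda_{g,hk}$ for all $g,h,k\in G$. The twisted group algebra $K_\lambda G$ is the associative $K$-algebra with $K$-basis $\{u_g\mid g\in G\}$ and multiplication determined by $u_gu_h=\lambda_{g,h}u_{gh}$ and distributivity. $U(K_\lambda G)$ is its group of units. $\Delta U$, the $FC$-center of $U(K_\lambda G)$, is the subgroup of all elements of $U(K_\lambda G)$ having only finitely many conjugates in $U(K_\lambda G)$. The elements of finite order of $\Delta U$ form a normal subgroup $t(\Delta U)$ (B.H. Neumann). *)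

theory Defs
  imports "HOL-Algebra.Algebra"
begin

definition two_cocycle ::
  "('g, 'm) monoid_scheme \<Rightarrow> ('k, 'r) ring_scheme \<Rightarrow> ('g \<Rightarrow> 'g \<Rightarrow> 'k) \<Rightarrow> bool" where
  "two_cocycle G K lam \<longleftrightarrow>
     (\<forall>g\<in>carrier G. \<forall>h\<in>carrier G. lam g h \<in> carrier K - {\<zero>\<^bsub>K\<^esub>}) \<and>
     (\<forall>g\<in>carrier G. \<forall>h\<in>carrier G. \<forall>k\<in>carrier G.
        lam g h \<otimes>\<^bsub>K\<^esub> lam (g \<otimes>\<^bsub>G\<^esub> h) k = lam h k \<otimes>\<^bsub>K\<^esub> lam g (h \<otimes>\<^bsub>G\<^esub> k))"

definition coeff_support ::
  "('g, 'm) monoid_scheme \<Rightarrow> ('k, 'r) ring_scheme \<Rightarrow> ('g \<Rightarrow> 'k) \<Rightarrow> 'g set" where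
  "coeff_support G K a = {g \<in> carrier G. a g \<noteq> \<zero>\<^bsub>K\<^esub>}"

text \<open>The element \<open>\<Sum>\<^sub>g a\<^sub>g u\<^sub>g\<close> is encoded by its coefficient function \<open>a\<close>, extensional on
  \<open>carrier G\<close>. The product is the distributive extension of
  \<open>u\<^sub>g u\<^sub>h = \<lambda>\<^sub>g\<^sub>,\<^sub>h u\<^sub>g\<^sub>h\<close>. As the cocycle is not assumed to be normalized, the identity is
  \<open>\<lambda>\<^sub>1\<^sub>,\<^sub>1\<close> inverse times \<open>u\<^sub>1\<close>.\<close>

definition twisted_group_algebra ::
  "('g, 'm) monoid_scheme \<Rightarrow> ('k, 'r) ring_scheme \<Rightarrow> ('g \<Rightarrow> 'g \<Rightarrow> 'k) \<Rightarrow> ('k, 'g \<Rightarrow> 'k) module" where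
  "twisted_group_algebra G K lam =
     \<lparr>carrier = {a \<in> carrier G \<rightarrow>\<^sub>E carrier K. finite (coeff_support G K a)},
      Group.monoid.mult = (\<lambda>a b. \<lambda>x\<in>carrier G.
        finsum K (\<lambda>(g, h). (a g \<otimes>\<^bsub>K\<^esub> b h) \<otimes>\<^bsub>K\<^esub> lam g h)
          {(g, h) \<in> coeff_support G K a \<times> coeff_support G K b. g \<otimes>\<^bsub>G\<^esub> h = x}),
      Group.monoid.one = (\<lambda>x\<in>carrier G.
        if x = \<one>\<^bsub>G\<^esub> then inv\<^bsub>K\<^esub> (lam \<one>\<^bsub>G\<^esub> \<one>\<^bsub>G\<^esub>) else \<zero>\<^bsub>K\<^esub>),
      Ring.ring.zero = (\<lambda>x\<in>carrier G. \<zero>\<^bsub>K\<^esub>),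
      Ring.ring.add = (\<lambda>a b. \<lambda>x\<in>carrier G. a x \<oplus>\<^bsub>K\<^esub> b x),
      Module.module.smult = (\<lambda>s a. \<lambda>x\<in>carrier G. s \<otimes>\<^bsub>K\<^esub> a x)\<rparr>"

definition twisted_basis ::
  "('g, 'm) monoid_scheme \<Rightarrow> ('k, 'r) ring_scheme \<Rightarrow> 'g \<Rightarrow> ('g \<Rightarrow> 'k)" where
  "twisted_basis G K g = (\<lambda>x\<in>carrier G. if x = g then \<one>\<^bsub>K\<^esub> else \<zero>\<^bsub>K\<^esub>)"

lemma twisted_basis_mult:
  assumes "group G" "field K" "two_cocycle G K lam" "g \<in> carrier G" "h \<in> carrier G"
  shows "twisted_basis G K g \<otimes>\<^bsub>twisted_group_algebra G K lam\<^esub> twisted_basis G K h =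
    lam g h \<odot>\<^bsub>twisted_group_algebra G K lam\<^esub> twisted_basis G K (g \<otimes>\<^bsub>G\<^esub> h)"
proof -
  interpret G: group G by fact
  interpret K: field K by fact
  have l: "lam g h \<in> carrier K" using assms by (auto simp: two_cocycle_def)
  have s: "coeff_support G K (twisted_basis G K y) = {y}" if "y \<in> carrier G" for y
    using that by (auto simp: coeff_support_def twisted_basis_def)
  have p: "{(g', h') \<in> {g} \<times> {h}. g' \<otimes>\<^bsub>G\<^esub> h' = x} =
      (if x = g \<otimes>\<^bsub>G\<^esub> h then {(g, h)} else {})" for x
    by auto
  let ?A = "twisted_group_algebra G K lam"
  have "(twisted_basis G K g \<otimes>\<^bsub>?A\<^esub> twisted_basis G K h) x =
      (lam g h \<odot>\<^bsub>?A\<^esub> twisted_basis G K (g \<otimes>\<^bsub>G\<^esub> h)) x" for x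
    unfolding twisted_group_algebra_def monoid.simps ring.simps module.simps
      s[OF assms(4)] s[OF assms(5)] p
    using assms(4,5) l by (simp add: twisted_basis_def)
  then show ?thesis by (rule ext)
qed

definition fc_center :: "('a, 'b) monoid_scheme \<Rightarrow> 'a set" where
  "fc_center G =
     {x \<in> carrier G. finite ((\<lambda>g. g \<otimes>\<^bsub>G\<^esub> x \<otimes>\<^bsub>G\<^esub> inv\<^bsub>G\<^esub> g) ` carrier G)}"

definition torsion_elements :: "('a, 'b) monoid_scheme \<Rightarrow> 'a set \<Rightarrow> 'a set" where
  "torsion_elements G H = {x \<in> H. \<exists>n::nat. n > 0 \<and> x [^]\<^bsub>G\<^esub> n = \<one>\<^bsub>G\<^esub>}"

definition solvable_of_length_le :: "('a, 'b) monoid_scheme \<Rightarrow> nat \<Rightarrow> bool" where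
  "solvable_of_length_le G n \<longleftrightarrow>
     group G \<and> solvable G \<and> (derived G ^^ n) (carrier G) = {\<one>\<^bsub>G\<^esub>}"

text \<open>Indexed from zero: \<open>lower_central_series G n\<close> is the term usually written
  \<open>\<gamma>\<^sub>n\<^sub>+\<^sub>1(G)\<close>.\<close>

primrec lower_central_series :: "('a, 'b) monoid_scheme \<Rightarrow> nat \<Rightarrow> 'a set" where
  "lower_central_series G 0 = carrier G"
| "lower_central_series G (Suc n) = generate G
     (\<Union>x\<in>lower_central_series G n. \<Union>y\<in>carrier G.
        {x \<otimes>\<^bsub>G\<^esub> y \<otimes>\<^bsub>G\<^esub> inv\<^bsub>G\<^esub> x \<otimes>\<^bsub>G\<^esub> inv\<^bsub>G\<^esub> y})"

definition nilpotent_of_class_le :: "('a, 'b) monoid_scheme \<Rightarrow> nat \<Rightarrow> bool" where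
  "nilpotent_of_class_le G c \<longleftrightarrow> group G \<and> lower_central_series G c = {\<one>\<^bsub>G\<^esub>}"

end

theory Submission
  imports Defs
begin

text \<open>Let \<open>U\<close> be the unit group of the twisted group algebra, \<open>D\<close> its FC-center and \<open>T\<close> the set of
  elements of finite order of \<open>D\<close>. By Dietzmann's lemma \<open>T\<close> is a subgroup, and the transfer shows
  that the commutators of \<open>D\<close> lie in \<open>T\<close>. So it suffices that a commutator of two elements
  \<open>a\<close>, \<open>b\<close> of \<open>T\<close> commutes with every \<open>x\<close> in \<open>D\<close>.

  If \<open>K\<close> is infinite, infinitely many of the elements \<open>t - a\<close> with a scalar \<open>t\<close> are units, two of them
  conjugate \<open>x\<close> to the same element, and already \<open>a\<close> commutes with \<open>x\<close>.

  If \<open>K\<close> is finite, then \<open>G\<close> is infinite, and the conjugates of \<open>a\<close> and \<open>b\<close> generate a finite ring \<open>B\<close>.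
  A nilpotent \<open>y\<close> in \<open>B\<close> yields units \<open>1 + u\<^sub>g y\<close> for infinitely many \<open>g\<close>; as \<open>x\<close> has only finitely
  many conjugates, \<open>y\<close> commutes with \<open>x\<close>. In a finite ring whose nilpotent elements are central,
  every commutator \<open>ab - ba\<close> is nilpotent, by reduction to Wedderburn's little theorem. Hence
  \<open>a b a\<^sup>-\<^sup>1 b\<^sup>-\<^sup>1 - 1\<close> is nilpotent, and therefore commutes with \<open>x\<close>.\<close>

section \<open>FC-centers of groups\<close>

text \<open>The bounds 3 and 2 come from a single chain \<open>D\<close>, \<open>T\<close>,
  \<open>Z\<close>, 1, where \<open>Z\<close> is the part of \<open>T\<close> that is central in
  \<open>D\<close>: the quotients \<open>D/T\<close> and \<open>T/Z\<close> are abelian, and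
  \<open>Z\<close> commutes with everything in \<open>D\<close>. The obstacle is a finite field. It
  has too few scalars \<open>t\<close> to make \<open>t - a\<close> invertible, and the
  \<open>u_g\<close> that take over their role are not central. They are replaced by quotients
  \<open>v0^-1 v\<close> of elements that conjugate a given finite set in the same way. Such
  quotients do commute with that set, and still only finitely many of them can have the same product
  with a nonzero element. The units \<open>1 + v y\<close> require \<open>y\<close> to be nilpotent,
  so that the argument reaches commutators of \<open>T\<close> and not its elements; this is why the
  class is 2 and not 1. The ring \<open>B\<close> is finite but not commutative. Instead of invoking
  its structure theory, central idempotents are split off until every element is nilpotent or
  invertible. Wedderburn's theorem is obtained without class equation and cyclotomic polynomials: a
  minimal counterexample is handled like a cyclic algebra over its center.\<close>

context group
begin

lemma inv_mult_cancel [simp]: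
  assumes "g \<in> carrier G" "a \<in> carrier G"
  shows "inv g \<otimes> (g \<otimes> a) = a" "g \<otimes> (inv g \<otimes> a) = a"
  using assms by (simp_all add: m_assoc[symmetric])

lemma pow_of_finite_subgroup:
  assumes "subgroup H G" "finite H" "x \<in> H"
  shows "\<exists>n::nat. n > 0 \<and> x [^] n = \<one>"
proof -
  interpret H: group "G\<lparr>carrier := H\<rparr>" using assms(1) by (rule subgroup_imp_group)
  have "x [^]\<^bsub>G\<lparr>carrier := H\<rparr>\<^esub> order (G\<lparr>carrier := H\<rparr>) = \<one>"
    using H.pow_order_eq_1[of x] assms by simp
  moreover have "order (G\<lparr>carrier := H\<rparr>) > 0"
    using assms by (auto simp: order_def card_gt_0_iff)
  ultimately show ?thesis by (metis nat_pow_consistent)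
qed

section \<open>Words in a group and Dietzmann's lemma\<close>

definition list_prod :: "'a list \<Rightarrow> 'a" where
  "list_prod xs = foldr (\<otimes>) xs \<one>"

lemma list_prod_simps [simp]:
  "list_prod [] = \<one>" "list_prod (x # xs) = x \<otimes> list_prod xs"
  by (simp_all add: list_prod_def)

lemma list_prod_closed [simp]: "set xs \<subseteq> carrier G \<Longrightarrow> list_prod xs \<in> carrier G"
  by (induction xs) auto

lemma list_prod_append:
  "set xs \<subseteq> carrier G \<Longrightarrow> set ys \<subseteq> carrier G \<Longrightarrow>
    list_prod (xs @ ys) = list_prod xs \<otimes> list_prod ys"
  by (induction xs) (auto simp: m_assoc)

lemma list_prod_replicate: "x \<in> carrier G \<Longrightarrow> list_prod (replicate n x) = x [^] n"
proof (induction n)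
  case (Suc n)
  then show ?case using nat_pow_Suc2[of x n] by simp
qed simp

text \<open>Since \<open>y x = x (x^-1 y x)\<close>, a letter that is passed by a copy of
  \<open>x\<close> is replaced by a conjugate, which is again in \<open>S\<close>. Collecting all
  copies of \<open>x\<close> in front therefore changes the other letters but not their
  number.\<close>

lemma list_prod_pull:
  assumes S: "S \<subseteq> carrier G" "\<And>x y. x \<in> S \<Longrightarrow> y \<in> S \<Longrightarrow> inv x \<otimes> y \<otimes> x \<in> S"
    and x: "x \<in> S" and w: "set w \<subseteq> S"
  shows "\<exists>w'. set w' \<subseteq> S \<and> length w' + count_list w x = length w \<and>
    list_prod w = x [^] count_list w x \<otimes> list_prod w'"
  using w
proof (induction w)
  case (Cons y w)
  have xc: "x \<in> carrier G" using S x by blast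
  have move: "\<exists>z\<in>S. y \<otimes> x [^] (c::nat) = x [^] c \<otimes> z" if "y \<in> S" for y c
  proof (induction c)
    case 0 then show ?case using that S by force
  next
    case (Suc c)
    then obtain z where z: "z \<in> S" "y \<otimes> x [^] c = x [^] c \<otimes> z" by blast
    have c: "z \<in> carrier G" "y \<in> carrier G" using z S that by auto
    have "y \<otimes> x [^] Suc c = x [^] c \<otimes> (z \<otimes> x)"
      using z c xc by (simp add: m_assoc[symmetric])
    also have "z \<otimes> x = x \<otimes> (inv x \<otimes> z \<otimes> x)"
      using c xc by (simp add: m_assoc[symmetric])
    finally have "y \<otimes> x [^] Suc c = x [^] Suc c \<otimes> (inv x \<otimes> z \<otimes> x)"
      using c xc by (simp add: m_assoc)
    then show ?case using S(2)[OF x z(1)] by blast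
  qed
  obtain w' where w': "set w' \<subseteq> S" "length w' + count_list w x = length w"
    "list_prod w = x [^] count_list w x \<otimes> list_prod w'"
    using Cons by auto
  have c: "list_prod w' \<in> carrier G" using w' S by auto
  show ?case
  proof (cases "y = x")
    case True
    then show ?thesis using w' c xc
      by (intro exI[of _ w'])
        (simp add: m_assoc[symmetric] nat_pow_Suc2[symmetric] del: nat_pow_Suc)
  next
    case False
    have y: "y \<in> S" "y \<in> carrier G" using Cons S by auto
    obtain z where z: "z \<in> S" "y \<otimes> x [^] count_list w x = x [^] count_list w x \<otimes> z"
      using move y by blast
    have zc: "z \<in> carrier G" using z S by blast
    have "list_prod (y # w) = (y \<otimes> x [^] count_list w x) \<otimes> list_prod w'"
      using w' y c xc by (simp add: m_assoc)
    also have "\<dots> = x [^] count_list w x \<otimes> list_prod (z # w')"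
      using z zc c xc by (simp add: m_assoc)
    finally show ?thesis using False w' z
      by (intro exI[of _ "z # w'"]) auto
  qed
qed simp

text \<open>A word longer than the sum \<open>L\<close> of the exponents \<open>N x\<close> contains
  some letter \<open>x\<close> more than \<open>N x\<close> times. Once these copies are collected
  in front, \<open>N x\<close> of them multiply to the identity and can be deleted. So words of
  length at most \<open>L\<close> represent all elements.\<close>

theorem dietzmann:
  assumes fin: "finite S" and S: "S \<subseteq> carrier G"
    and conj: "\<And>x y. x \<in> S \<Longrightarrow> y \<in> S \<Longrightarrow> inv x \<otimes> y \<otimes> x \<in> S"
    and tors: "\<And>x. x \<in> S \<Longrightarrow> \<exists>n::nat. n > 0 \<and> x [^] n = \<one>"
  shows "finite (generate G S)"
proof -
  obtain N :: "'a \<Rightarrow> nat" where N: "\<And>x. x \<in> S \<Longrightarrow> N x > 0 \<and> x [^] N x = \<one>"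
    using tors by metis
  define L where "L = (\<Sum>x\<in>S. N x)"
  have short: "\<exists>w'. set w' \<subseteq> S \<and> length w' \<le> L \<and> list_prod w' = list_prod w" if "set w \<subseteq> S" for w
    using that
  proof (induction "length w" arbitrary: w rule: less_induct)
    case less
    show ?case
    proof (cases "length w \<le> L")
      case False
      have "(\<Sum>x\<in>S. N x) < (\<Sum>x\<in>S. count_list w x)"
        using False sum_count_set[of w S] less.prems fin by (simp add: L_def)
      then obtain x where x: "x \<in> S" "N x < count_list w x"
        by (meson not_less sum_mono)
      obtain w' where w': "set w' \<subseteq> S" "length w' + count_list w x = length w"
        "list_prod w = x [^] count_list w x \<otimes> list_prod w'"
        using list_prod_pull[OF S conj x(1) less.prems] by blast
      let ?v = "replicate (count_list w x - N x) x @ w'"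
      have xc: "x \<in> carrier G" "set w' \<subseteq> carrier G" using x S w' by auto
      have "x [^] count_list w x = x [^] N x \<otimes> x [^] (count_list w x - N x)"
        using x xc by (simp add: nat_pow_mult)
      then have "list_prod ?v = list_prod w"
        using w' xc N[OF x(1)] x(1) S
        by (subst list_prod_append) (auto simp: list_prod_replicate)
      moreover have "length ?v < length w" "set ?v \<subseteq> S"
        using w' x N[OF x(1)] by auto
      ultimately show ?thesis using less.hyps[of ?v] by auto
    qed (use less in blast)
  qed
  have lists: "\<exists>w. set w \<subseteq> S \<and> list_prod w = a" if "a \<in> generate G S" for a
    using that
  proof (induction rule: generate.induct)
    case one then show ?case by (intro exI[of _ "[]"]) simp
  next
    case (incl x) then show ?case using S by (intro exI[of _ "[x]"]) auto
  next
    \<comment> \<open>The inverse of a letter is a positive power of it, so words over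
      \<open>S\<close> reach the whole generated subgroup.\<close>
    case (inv x)
    then have x: "x \<in> carrier G" "x [^] N x = \<one>" "N x > 0" using S N by auto
    then have "x [^] (N x - 1) \<otimes> x = \<one>"
      by (metis Suc_pred' nat_pow_Suc)
    then have "inv x = x [^] (N x - 1)" using x by (intro inv_equality) auto
    then show ?case using inv x
      by (intro exI[of _ "replicate (N x - 1) x"]) (auto simp: list_prod_replicate)
  next
    case (eng a b)
    then obtain v w where "set v \<subseteq> S" "list_prod v = a" "set w \<subseteq> S" "list_prod w = b"
      by blast
    then show ?case using S list_prod_append[of v w] by (intro exI[of _ "v @ w"]) auto
  qed
  have "generate G S \<subseteq> list_prod ` {w. set w \<subseteq> S \<and> length w \<le> L}"
    using lists short by (force simp: image_iff)
  then show ?thesis using finite_lists_length_le[OF fin] by (meson finite_imageI finite_subset)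
qed

section \<open>FC-elements and their elements of finite order\<close>

lemma fc_centerD:
  assumes "x \<in> fc_center G"
  shows "x \<in> carrier G" "finite ((\<lambda>g. g \<otimes> x \<otimes> inv g) ` carrier G)"
  using assms by (auto simp: fc_center_def)

lemma subgroup_fc_center: "subgroup (fc_center G) G"
proof (rule subgroupI)
  show "fc_center G \<subseteq> carrier G" by (auto simp: fc_center_def)
  have "(\<lambda>g. g \<otimes> \<one> \<otimes> inv g) ` carrier G \<subseteq> {\<one>}" by auto
  then have "\<one> \<in> fc_center G" by (auto simp: fc_center_def dest: finite_subset)
  then show "fc_center G \<noteq> {}" by blast
next
  fix x assume "x \<in> fc_center G"
  note x = fc_centerD[OF this]
  have "(\<lambda>g. g \<otimes> inv x \<otimes> inv g) ` carrier G \<subseteq> m_inv G ` ((\<lambda>g. g \<otimes> x \<otimes> inv g) ` carrier G)"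
    using x by (auto simp: image_image inv_mult_group m_assoc)
  then show "inv x \<in> fc_center G" using x by (auto simp: fc_center_def dest: finite_subset)
next
  fix x y assume "x \<in> fc_center G" "y \<in> fc_center G"
  note x = fc_centerD[OF this(1)] and y = fc_centerD[OF this(2)]
  let ?c = "\<lambda>x. (\<lambda>g. g \<otimes> x \<otimes> inv g) ` carrier G"
  have "g \<otimes> (x \<otimes> y) \<otimes> inv g = (g \<otimes> x \<otimes> inv g) \<otimes> (g \<otimes> y \<otimes> inv g)" if "g \<in> carrier G" for g
    using x y that by (simp add: m_assoc)
  then have "?c (x \<otimes> y) \<subseteq> (\<lambda>(a, b). a \<otimes> b) ` (?c x \<times> ?c y)"
    by (force simp: image_iff)
  then have "finite (?c (x \<otimes> y))" using x y by (elim finite_subset) auto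
  then show "x \<otimes> y \<in> fc_center G" using x y by (auto simp: fc_center_def)
qed

lemma conj_conj:
  assumes "x \<in> carrier G" "g \<in> carrier G" "h \<in> carrier G"
  shows "g \<otimes> (h \<otimes> x \<otimes> inv h) \<otimes> inv g = (g \<otimes> h) \<otimes> x \<otimes> inv (g \<otimes> h)"
  using assms by (simp add: m_assoc inv_mult_group)

lemma conj_pow:
  assumes "x \<in> carrier G" "g \<in> carrier G"
  shows "(g \<otimes> x \<otimes> inv g) [^] (n::nat) = g \<otimes> x [^] n \<otimes> inv g"
proof (induction n)
  case (Suc n)
  then show ?case using assms by (simp add: m_assoc)
qed (use assms in simp)

lemma fc_center_conj:
  assumes "x \<in> fc_center G" "h \<in> carrier G"
  shows "h \<otimes> x \<otimes> inv h \<in> fc_center G"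
proof -
  note x = fc_centerD[OF assms(1)]
  have "(\<lambda>g. g \<otimes> (h \<otimes> x \<otimes> inv h) \<otimes> inv g) ` carrier G \<subseteq> (\<lambda>g. g \<otimes> x \<otimes> inv g) ` carrier G"
    using x assms by (auto simp: conj_conj)
  then show ?thesis using x assms by (auto simp: fc_center_def intro: finite_subset)
qed

text \<open>\<open>S\<close> is the union of the conjugacy classes of \<open>a\<close> and
  \<open>b\<close>. It is finite by the FC property, closed under conjugation, and consists of
  elements of finite order, so Dietzmann's lemma applies.\<close>

lemma finite_torsion_normal_closure:
  assumes "a \<in> torsion_elements G (fc_center G)" "b \<in> torsion_elements G (fc_center G)"
  obtains S where "finite S" "S \<subseteq> fc_center G" "a \<in> S" "b \<in> S" "finite (generate G S)"
proof -
  let ?c = "\<lambda>x. (\<lambda>g. g \<otimes> x \<otimes> inv g) ` carrier G"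
  have a: "a \<in> fc_center G" "b \<in> fc_center G" "a \<in> carrier G" "b \<in> carrier G"
    using assms by (auto simp: torsion_elements_def fc_center_def)
  have S: "?c a \<union> ?c b \<subseteq> fc_center G" using a fc_center_conj by auto
  have tors: "\<exists>n::nat. n > 0 \<and> x [^] n = \<one>" if "x \<in> ?c a \<union> ?c b" for x
    using that assms a by (force simp: torsion_elements_def conj_pow)
  have closed: "h \<otimes> y \<otimes> inv h \<in> ?c a \<union> ?c b"
    if "h \<in> carrier G" "y \<in> ?c a \<union> ?c b" for h y
  proof -
    from that(2) obtain g z where g: "g \<in> carrier G" "z = a \<or> z = b" "y = g \<otimes> z \<otimes> inv g"
      by blast
    then have "h \<otimes> y \<otimes> inv h = (h \<otimes> g) \<otimes> z \<otimes> inv (h \<otimes> g)"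
      using conj_conj a that(1) by blast
    then show ?thesis using g(1,2) that(1) by blast
  qed
  have gen: "finite (generate G (?c a \<union> ?c b))"
  proof (rule dietzmann)
    show "finite (?c a \<union> ?c b)" using a fc_centerD by blast
    show sub: "?c a \<union> ?c b \<subseteq> carrier G" using S fc_centerD by blast
    show "inv x \<otimes> y \<otimes> x \<in> ?c a \<union> ?c b" if "x \<in> ?c a \<union> ?c b" "y \<in> ?c a \<union> ?c b" for x y
    proof -
      have "x \<in> carrier G" using sub that(1) by blast
      then show ?thesis using closed[of "inv x" y] that(2) by simp
    qed
  qed (fact tors)
  have self: "x \<in> ?c x" if "x \<in> carrier G" for x
    using that by (intro image_eqI[of _ _ \<one>]) simp_all
  have "finite (?c a \<union> ?c b)" using a fc_centerD(2) by blast
  from that[OF this S _ _ gen] show ?thesis using self a(3,4) by blast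
qed

text \<open>Two elements of finite order lie in a common finite subgroup, which contains their
  product.\<close>

lemma subgroup_torsion_fc_center: "subgroup (torsion_elements G (fc_center G)) G"
proof (rule subgroupI)
  let ?t = "torsion_elements G (fc_center G)"
  note F = subgroup.one_closed[OF subgroup_fc_center] subgroup.m_closed[OF subgroup_fc_center]
    subgroup.m_inv_closed[OF subgroup_fc_center]
  show "?t \<subseteq> carrier G" by (auto simp: torsion_elements_def fc_center_def)
  have "\<one> \<in> ?t" using F(1) by (auto simp: torsion_elements_def intro!: exI[of _ "1::nat"])
  then show "?t \<noteq> {}" by blast
  show "inv x \<in> ?t" if "x \<in> ?t" for x
  proof -
    have x: "x \<in> carrier G" "x \<in> fc_center G" using that by (auto simp: torsion_elements_def fc_center_def)
    from that obtain n :: nat where "n > 0" "x [^] n = \<one>" by (auto simp: torsion_elements_def)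
    then have "inv x [^] n = \<one>" using x by (simp add: nat_pow_inv)
    then show ?thesis using x F(3) \<open>n > 0\<close> by (auto simp: torsion_elements_def)
  qed
  show "x \<otimes> y \<in> ?t" if "x \<in> ?t" "y \<in> ?t" for x y
  proof -
    from that obtain S where S: "S \<subseteq> fc_center G" "x \<in> S" "y \<in> S" "finite (generate G S)"
      by (rule finite_torsion_normal_closure)
    then have "x \<otimes> y \<in> generate G S" "subgroup (generate G S) G"
      using fc_centerD(1) by (auto intro: generate.intros generate_is_subgroup)
    then have "\<exists>n::nat. n > 0 \<and> (x \<otimes> y) [^] n = \<one>"
      using S pow_of_finite_subgroup by blast
    then show ?thesis using that F(2) by (auto simp: torsion_elements_def)
  qed
qed

text \<open>Transfer from the double centralizer \<open>H\<close> of \<open>{x, y}\<close> into its central subgroup \<open>Z\<close>, which has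
  finite index: the coset \<open>Z h\<close> is labelled by the pair \<open>ka h\<close>, on which \<open>H\<close> acts by conjugation.\<close>

lemma commutator_fc_center_torsion:
  assumes x: "x \<in> fc_center G" and y: "y \<in> fc_center G"
  shows "\<exists>n::nat. n > 0 \<and> (x \<otimes> y \<otimes> inv x \<otimes> inv y) [^] n = \<one>"
proof -
  \<comment> \<open>Elements of \<open>H\<close> commute with all of \<open>C\<close>, so
    \<open>Z\<close> is central in \<open>H\<close>. Both \<open>x\<close> and \<open>y\<close>
    belong to \<open>H\<close>, because \<open>C\<close> is their common centralizer.\<close>
  define C where "C = {g \<in> carrier G. g \<otimes> x = x \<otimes> g \<and> g \<otimes> y = y \<otimes> g}"
  define H where "H = {h \<in> carrier G. \<forall>g\<in>C. g \<otimes> h = h \<otimes> g}"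
  define Z where "Z = C \<inter> H"
  note xc = fc_centerD[OF x] and yc = fc_centerD[OF y]
  have comm_sub: "subgroup {h \<in> carrier G. \<forall>g\<in>D. g \<otimes> h = h \<otimes> g} G" (is "subgroup ?K G")
    if D: "D \<subseteq> carrier G" for D
  proof (rule subgroupI)
    have "\<one> \<in> ?K" using D by auto
    then show "?K \<noteq> {}" by blast
  next
    fix a assume "a \<in> ?K"
    then have a: "a \<in> carrier G" "\<And>g. g \<in> D \<Longrightarrow> g \<otimes> a = a \<otimes> g" by auto
    have "g \<otimes> inv a = inv a \<otimes> g" if "g \<in> D" for g
    proof -
      have g: "g \<in> carrier G" using D that by blast
      have "inv a \<otimes> (g \<otimes> a) \<otimes> inv a = inv a \<otimes> (a \<otimes> g) \<otimes> inv a" using a that by simp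
      then show ?thesis using a g by (simp add: m_assoc)
    qed
    then show "inv a \<in> ?K" using a by simp
  next
    fix a b assume "a \<in> ?K" "b \<in> ?K"
    then have ab: "a \<in> carrier G" "b \<in> carrier G" "\<And>g. g \<in> D \<Longrightarrow> g \<otimes> a = a \<otimes> g"
      "\<And>g. g \<in> D \<Longrightarrow> g \<otimes> b = b \<otimes> g" by auto
    have "g \<otimes> (a \<otimes> b) = a \<otimes> b \<otimes> g" if "g \<in> D" for g
    proof -
      have g: "g \<in> carrier G" using D that by blast
      have "g \<otimes> (a \<otimes> b) = (a \<otimes> g) \<otimes> b"
        using ab that g by (simp add: m_assoc[symmetric])
      then show ?thesis using ab that g by (simp add: m_assoc)
    qed
    then show "a \<otimes> b \<in> ?K" using ab by simp
  qed auto
  have CC: "C \<subseteq> carrier G" by (auto simp: C_def)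
  have subH: "subgroup H G" unfolding H_def using comm_sub[OF CC] .
  have "C = {h \<in> carrier G. \<forall>g\<in>{x, y}. g \<otimes> h = h \<otimes> g}" by (auto simp: C_def)
  then have subC: "subgroup C G" using comm_sub[of "{x, y}"] xc yc by simp
  have subZ: "subgroup Z G" unfolding Z_def using subgroups_Inter_pair[OF subC subH] .
  have ZC: "z \<in> carrier G" if "z \<in> Z" for z by (rule subgroup.mem_carrier[OF subZ that])
  have HC: "h \<in> carrier G" if "h \<in> H" for h using that by (simp add: H_def)
  have ZH: "z \<otimes> h = h \<otimes> z" if "z \<in> Z" "h \<in> H" for z h using that by (simp add: Z_def H_def)
  have xyH: "x \<in> H" "y \<in> H" using xc yc by (auto simp: H_def C_def)
  note Hcl = subgroup.one_closed[OF subH] subgroup.m_closed[OF subH] subgroup.m_inv_closed[OF subH]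
  define ka where "ka h = (inv h \<otimes> x \<otimes> h, inv h \<otimes> y \<otimes> h)" for h
  define act where "act i k = (inv k \<otimes> fst i \<otimes> k, inv k \<otimes> snd i \<otimes> k)" for i k
  define I where "I = ka ` H"
  define ta where "ta = inv_into H ka"
  have act: "act (ka h) k = ka (h \<otimes> k)" if "h \<in> H" "k \<in> H" for h k
    using HC[OF that(1)] HC[OF that(2)] xc yc
    by (simp add: act_def ka_def m_assoc inv_mult_group)
  have ta: "ta i \<in> H" "ka (ta i) = i" if "i \<in> I" for i
    using that by (auto simp: I_def ta_def inv_into_into f_inv_into_f)
  have finI: "finite I"
  proof -
    have "ka h \<in> (\<lambda>g. g \<otimes> x \<otimes> inv g) ` carrier G \<times> (\<lambda>g. g \<otimes> y \<otimes> inv g) ` carrier G"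
      if "h \<in> H" for h
      using HC[OF that] by (auto simp: ka_def intro!: image_eqI[of _ _ "inv h"])
    then show ?thesis unfolding I_def
      by (intro finite_subset[OF _ finite_cartesian_product[OF xc(2) yc(2)]]) blast
  qed
  \<comment> \<open>Equal labels mean that \<open>h k^-1\<close> centralizes \<open>x\<close> and
    \<open>y\<close>. Thus different cosets of \<open>Z\<close> in \<open>H\<close> have different
    labels, and finiteness of \<open>I\<close> gives the finite index.\<close>
  have label: "h \<otimes> inv k \<in> Z" if h: "h \<in> H" and k: "k \<in> H" and eq: "ka h = ka k" for h k
  proof -
    have c: "h \<in> carrier G" "k \<in> carrier G" using h k HC by auto
    have "(h \<otimes> inv k) \<otimes> z = z \<otimes> (h \<otimes> inv k)"
      if z: "z \<in> carrier G" and e: "inv h \<otimes> z \<otimes> h = inv k \<otimes> z \<otimes> k" for z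
    proof -
      have "h \<otimes> (inv h \<otimes> z \<otimes> h) \<otimes> inv k = h \<otimes> (inv k \<otimes> z \<otimes> k) \<otimes> inv k" using e by simp
      then show ?thesis using c z by (simp add: m_assoc)
    qed
    then have "h \<otimes> inv k \<in> C" using eq c xc yc by (auto simp: C_def ka_def)
    then show ?thesis using h k Hcl by (auto simp: Z_def)
  qed
  have actI: "act i k \<in> I" if "i \<in> I" "k \<in> H" for i k
    using that act Hcl by (auto simp: I_def)
  have bij: "(\<lambda>i. act i k) ` I = I" "inj_on (\<lambda>i. act i k) I" if k: "k \<in> H" for k
  proof -
    have 1: "act (act i k) (inv k) = i" if "i \<in> I" for i
      using that act k Hcl HC by (auto simp: I_def m_assoc)
    have 2: "act (act i (inv k)) k = i" if "i \<in> I" for i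
      using that act k Hcl HC by (auto simp: I_def m_assoc)
    show "inj_on (\<lambda>i. act i k) I" by (rule inj_on_inverseI[of _ "\<lambda>i. act i (inv k)"]) (rule 1)
    show "(\<lambda>i. act i k) ` I = I"
    proof
      show "I \<subseteq> (\<lambda>i. act i k) ` I" using 2 actI k Hcl by (metis image_eqI subsetI)
    qed (use actI k in auto)
  qed
  let ?Z = "G\<lparr>carrier := Z\<rparr>"
  have "group ?Z" by (rule subgroup_imp_group[OF subZ])
  then interpret Z: comm_group ?Z
  proof (rule group.group_comm_groupI)
    fix a b assume "a \<in> carrier ?Z" "b \<in> carrier ?Z"
    then show "a \<otimes>\<^bsub>?Z\<^esub> b = b \<otimes>\<^bsub>?Z\<^esub> a" using ZH[of a b] by (simp add: Z_def)
  qed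
  \<comment> \<open>The elements \<open>ta i\<close> form a transversal, and \<open>v k i\<close> is
    the factor from \<open>Z\<close> in \<open>ta i k = v k i (ta (act i k))\<close>. The transfer
    \<open>V k\<close> is the product of these factors.\<close>
  define v where "v k i = ta i \<otimes> k \<otimes> inv (ta (act i k))" for k i
  have vZ: "v k i \<in> Z" if "k \<in> H" "i \<in> I" for k i
  proof -
    have "act i k = ka (ta i \<otimes> k)" using act[of "ta i" k] ta that by simp
    moreover have "ta (act i k) \<in> H" "ka (ta (act i k)) = act i k" using ta actI that by blast+
    ultimately show ?thesis unfolding v_def using that ta(1) Hcl(2) by (intro label) (simp_all only:)
  qed
  define V where "V k = finprod ?Z (v k) I" for k
  have VZ: "V k \<in> Z" if "k \<in> H" for k
    using Z.finprod_closed[of "v k" I] vZ that by (auto simp: V_def)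
  \<comment> \<open>The factors satisfy a cocycle identity; acting by \<open>h\<close> permutes
    \<open>I\<close> and only reindexes the second product.\<close>
  have Vhom: "V (h \<otimes> k) = V h \<otimes> V k" if h: "h \<in> H" and k: "k \<in> H" for h k
  proof -
    have "v (h \<otimes> k) i = v h i \<otimes> v k (act i h)" if i: "i \<in> I" for i
    proof -
      have "act (act i h) k = act i (h \<otimes> k)"
        using i h k act Hcl HC by (auto simp: I_def m_assoc)
      moreover have "ta i \<in> carrier G" "ta (act i h) \<in> carrier G" "ta (act i (h \<otimes> k)) \<in> carrier G"
        using ta actI i h k Hcl HC by auto
      ultimately show ?thesis using HC[OF h] HC[OF k] by (simp add: v_def m_assoc)
    qed
    then have "V (h \<otimes> k) = finprod ?Z (\<lambda>i. v h i \<otimes> v k (act i h)) I"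
      unfolding V_def using vZ actI h k Hcl
      by (intro Z.finprod_cong' funcsetI) (simp_all add: subgroup.m_closed[OF subZ])
    also have "\<dots> = V h \<otimes> finprod ?Z (\<lambda>i. v k (act i h)) I"
      unfolding V_def using Z.finprod_multf[of "v h" I "\<lambda>i. v k (act i h)"] vZ actI h k by (simp add: Pi_iff)
    also have "finprod ?Z (\<lambda>i. v k (act i h)) I = finprod ?Z (v k) ((\<lambda>i. act i h) ` I)"
      using bij[OF h] vZ k by (intro Z.finprod_reindex[symmetric]) simp_all
    finally show ?thesis using bij[OF h] by (simp add: V_def)
  qed
  \<comment> \<open>An element of \<open>Z\<close> fixes every label, so each of its factors is the
    element itself.\<close>
  have Vcenter: "V z = z [^] card I" if z: "z \<in> Z" for z
  proof -
    have zH: "z \<in> H" "z \<in> C" using z by (auto simp: Z_def)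
    have "v z i = z" if i: "i \<in> I" for i
    proof -
      obtain g where g: "g \<in> H" "i = ka g" using i by (auto simp: I_def)
      have c: "g \<in> carrier G" "z \<in> carrier G" "ta i \<in> carrier G" using g zH HC ta i by auto
      have "u \<otimes> (z \<otimes> g) = z \<otimes> (u \<otimes> g)" if "u = x \<or> u = y" for u
      proof -
        have "u \<in> carrier G" "u \<otimes> z = z \<otimes> u" using zH(2) that xc yc by (auto simp: C_def)
        then show ?thesis using c by (simp add: m_assoc[symmetric])
      qed
      then have "ka (z \<otimes> g) = ka g"
        using c xc yc by (simp add: ka_def inv_mult_group m_assoc)
      then have "act i z = ka g" using act[OF g(1) zH(1)] ZH[OF z g(1)] g by simp
      then have "act i z = i" using g by simp
      then show ?thesis using ZH[OF z ta(1)[OF i], symmetric] c by (simp add: v_def m_assoc)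
    qed
    then have "V z = finprod ?Z (\<lambda>_. z) I"
      unfolding V_def using z by (intro Z.finprod_cong') auto
    also have "\<dots> = z [^]\<^bsub>?Z\<^esub> card I" using Z.finprod_const[of z I] z by simp
    finally show ?thesis by (simp add: nat_pow_consistent[symmetric])
  qed
  define c where "c = x \<otimes> y \<otimes> inv x \<otimes> inv y"
  have cH: "c \<in> H" using xyH Hcl by (simp add: c_def)
  have powH: "c [^] n \<in> H" for n :: nat by (induction n) (use cH Hcl in auto)
  \<comment> \<open>The values of \<open>V\<close> lie in an abelian group, which forces
    \<open>V c\<close> to be trivial. Writing \<open>x y\<close> as \<open>c (y x)\<close> keeps
    inverses out of the computation.\<close>
  have "V (c \<otimes> (y \<otimes> x)) = V (y \<otimes> x)"
  proof -
    have "c \<otimes> (y \<otimes> x) = x \<otimes> y" using xc yc by (simp add: c_def m_assoc)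
    then show ?thesis using Vhom xyH ZH[OF VZ[of x]] VZ by (auto simp: Z_def)
  qed
  then have "V c \<otimes> V (y \<otimes> x) = V (y \<otimes> x)" using Vhom cH xyH Hcl by simp
  then have Vc: "V c = \<one>" using ZC[OF VZ] cH xyH Hcl by (metis r_cancel_one)
  have V1: "V \<one> = \<one>" using Vcenter subgroup.one_closed[OF subZ] by simp
  have Vpow: "V (c [^] n) = \<one>" for n :: nat
    by (induction n) (use V1 Vc Vhom cH powH in auto)
  \<comment> \<open>Two powers of \<open>c\<close> share a label, so some positive power of
    \<open>c\<close> lies in \<open>Z\<close>. There the transfer raises to the power
    \<open>card I\<close>, yet it is trivial on powers of \<open>c\<close>.\<close>
  have "\<not> inj (\<lambda>n::nat. ka (c [^] n))"
  proof
    assume "inj (\<lambda>n::nat. ka (c [^] n))"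
    moreover have "range (\<lambda>n::nat. ka (c [^] n)) \<subseteq> I" using powH by (auto simp: I_def)
    ultimately show False using finI finite_subset finite_imageD[of "\<lambda>n::nat. ka (c [^] n)" UNIV]
      by (metis infinite_UNIV_nat)
  qed
  then obtain i j :: nat where ij: "i < j" "ka (c [^] j) = ka (c [^] i)"
    by (metis injI nat_neq_iff)
  have "c [^] (j - i) \<otimes> c [^] i = c [^] j" using ij(1) HC[OF cH] by (simp add: nat_pow_mult)
  then have "c [^] (j - i) = c [^] j \<otimes> inv (c [^] i)"
    using HC[OF powH] inv_solve_right by metis
  then have "c [^] (j - i) \<in> Z" using label[OF powH powH ij(2)] by simp
  then have "(c [^] (j - i)) [^] card I = \<one>" using Vcenter[of "c [^] (j - i)"] Vpow[of "j - i"] by simp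
  then have "c [^] ((j - i) * card I) = \<one>" using HC[OF cH] by (simp add: nat_pow_pow)
  moreover have "I \<noteq> {}" using Hcl(1) unfolding I_def by blast
  then have "(j - i) * card I > 0" using ij(1) finI by (simp add: card_gt_0_iff)
  ultimately show ?thesis unfolding c_def[symmetric] by blast
qed

end

section \<open>Finite rings\<close>

context monoid
begin

lemma commutes_pow:
  assumes "a \<in> carrier G" "b \<in> carrier G" "a \<otimes> b = b \<otimes> a"
  shows "a [^] (n::nat) \<otimes> b = b \<otimes> a [^] n"
proof (induction n)
  case (Suc n)
  have "a [^] Suc n \<otimes> b = a [^] n \<otimes> (b \<otimes> a)" using assms by (simp add: m_assoc)
  also have "\<dots> = (b \<otimes> a [^] n) \<otimes> a" using assms Suc by (simp add: m_assoc[symmetric])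
  finally show ?case using assms by (simp add: m_assoc)
qed (use assms in simp)

lemma commutes_mult:
  assumes "a \<in> carrier G" "b \<in> carrier G" "c \<in> carrier G" "a \<otimes> c = c \<otimes> a" "b \<otimes> c = c \<otimes> b"
  shows "(a \<otimes> b) \<otimes> c = c \<otimes> (a \<otimes> b)"
proof -
  have "(a \<otimes> b) \<otimes> c = (a \<otimes> c) \<otimes> b" using assms(1-3,5) by (simp add: m_assoc)
  then show ?thesis using assms by (simp add: m_assoc)
qed

lemma pow_cong_commutes:
  assumes "a \<in> carrier G" "b \<in> carrier G" "a \<otimes> b = b \<otimes> a"
  shows "a [^] (m::nat) \<otimes> b [^] (n::nat) = b [^] n \<otimes> a [^] m"
  using commutes_pow[OF assms(1) _ commutes_pow[OF assms(2,1), symmetric]] assms by simp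

end

section \<open>Centralizers and Vandermonde systems in noncommutative rings\<close>

context ring
begin

definition centralizer :: "'a \<Rightarrow> 'a set" where
  "centralizer a = {z \<in> carrier R. z \<otimes> a = a \<otimes> z}"

lemma centralizerD:
  assumes "z \<in> centralizer a"
  shows "z \<in> carrier R" "z \<otimes> a = a \<otimes> z"
  using assms by (auto simp: centralizer_def)

lemma subring_centralizer:
  assumes "a \<in> carrier R" shows "subring (centralizer a) R"
  using assms commutes_mult
  by (intro subringI) (auto simp: centralizer_def l_distr r_distr l_minus r_minus)

text \<open>A sum over a full period is invariant under the shift. This is what makes the averaged
  sums in the proof of Wedderburn's theorem fixed points.\<close>

lemma finsum_lessThan_Suc_shift:
  assumes "\<And>i. f i \<in> carrier R" "f r = f (0::nat)"
  shows "(\<Oplus>i\<in>{..<r}. f (Suc i)) = (\<Oplus>i\<in>{..<r}. f i)"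
proof (cases r)
  case (Suc k)
  have "(\<Oplus>i\<in>{..<r}. f (Suc i)) = f r \<oplus> (\<Oplus>i\<in>{..<k}. f (Suc i))"
    using assms(1) by (simp add: Suc lessThan_Suc Pi_def)
  also have "\<dots> = (\<Oplus>i\<in>{..<k}. f (Suc i)) \<oplus> f 0"
    using assms by (simp add: a_comm Pi_def)
  also have "\<dots> = (\<Oplus>i\<in>{..k}. f i)"
  proof (cases k)
    case (Suc l)
    then show ?thesis using finsum_Suc2[of f l] assms(1) by (simp add: lessThan_Suc_atMost Pi_def)
  qed (use assms in \<open>simp add: Pi_def\<close>)
  finally show ?thesis by (simp add: Suc lessThan_Suc_atMost)
qed simp

text \<open>Subtracting the last node times the relation for \<open>k\<close> from the relation for
  \<open>k + 1\<close> removes the last term and multiplies each remaining \<open>c i\<close> from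
  the left by a nonzero difference of nodes. Only the nodes have to commute with each other; the
  coefficients stay on the right.\<close>

lemma vandermonde:
  fixes l :: "nat \<Rightarrow> 'a" and r :: nat
  assumes nzd: "\<And>a b. a \<in> carrier R \<Longrightarrow> b \<in> carrier R \<Longrightarrow> a \<otimes> b = \<zero> \<Longrightarrow> a = \<zero> \<or> b = \<zero>"
    and la: "\<And>i. l i \<in> carrier R" "\<And>i j. i < r \<Longrightarrow> j < r \<Longrightarrow> l i \<otimes> l j = l j \<otimes> l i" "inj_on l {..<r}"
    and "\<And>i. c i \<in> carrier R"
    and "\<And>k::nat. (\<Oplus>i\<in>{..<r}. l i [^] k \<otimes> c i) = \<zero>"
    and "i < r"
  shows "c i = \<zero>"
  using assms(2-)
proof (induction r arbitrary: c i)
  case (Suc r)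
  note cl = Suc.prems(1,4)
  define c' where "c' i = (l i \<ominus> l r) \<otimes> c i" for i
  have trm: "l i [^] k \<otimes> c' i = l i [^] Suc k \<otimes> c i \<ominus> l r \<otimes> (l i [^] k \<otimes> c i)"
    if "i \<le> r" for i k
  proof -
    have "l i [^] k \<otimes> l r = l r \<otimes> l i [^] k" using that cl Suc.prems(2) by (intro commutes_pow) auto
    then show ?thesis using cl
      by (simp add: c'_def a_minus_def l_distr r_distr l_minus r_minus m_assoc[symmetric])
  qed
  have full: "(\<Oplus>i\<in>{..<Suc r}. l i [^] k \<otimes> c' i) = \<zero>" for k :: nat
  proof -
    have "(\<Oplus>i\<in>{..<Suc r}. l i [^] k \<otimes> c' i) =
        (\<Oplus>i\<in>{..<Suc r}. l i [^] Suc k \<otimes> c i \<oplus> (\<ominus> l r) \<otimes> (l i [^] k \<otimes> c i))"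
      using cl trm by (intro finsum_cong') (auto simp: a_minus_def l_minus)
    also have "\<dots> = (\<Oplus>i\<in>{..<Suc r}. l i [^] Suc k \<otimes> c i) \<oplus>
        (\<Oplus>i\<in>{..<Suc r}. (\<ominus> l r) \<otimes> (l i [^] k \<otimes> c i))"
      using cl by (intro finsum_addf) auto
    also have "(\<Oplus>i\<in>{..<Suc r}. (\<ominus> l r) \<otimes> (l i [^] k \<otimes> c i)) =
        (\<ominus> l r) \<otimes> (\<Oplus>i\<in>{..<Suc r}. l i [^] k \<otimes> c i)"
      using cl by (intro finsum_rdistr[symmetric]) auto
    finally show ?thesis using Suc.prems(5)[of k] Suc.prems(5)[of "Suc k"] cl by simp
  qed
  have c'r: "c' r = \<zero>" using cl by (simp add: c'_def a_minus_def r_neg)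
  have c'c: "c' i \<in> carrier R" for i using cl by (simp add: c'_def)
  have "(\<Oplus>i\<in>{..<r}. l i [^] k \<otimes> c' i) = \<zero>" for k :: nat
    using full[of k] cl c'r c'c by (simp add: lessThan_Suc Pi_def)
  then have c'0: "c' i = \<zero>" if "i < r" for i
    using Suc.IH[of c' i] c'c cl Suc.prems(2,3) that by (auto simp: lessThan_Suc)
  have c0: "c i = \<zero>" if "i < r" for i
  proof -
    have "l i \<ominus> l r \<noteq> \<zero>" using Suc.prems(3) that cl by (auto simp: inj_on_def)
    then show ?thesis using c'0[OF that] nzd[of "l i \<ominus> l r" "c i"] cl by (auto simp: c'_def)
  qed
  have "(\<Oplus>i\<in>{..<r}. l i [^] (0::nat) \<otimes> c i) = (\<Oplus>i\<in>{..<r}. \<zero>)"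
    using c0 cl by (intro finsum_cong') auto
  then have "c r = \<zero>" using Suc.prems(5)[of 0] cl by (simp add: lessThan_Suc Pi_def)
  then show ?case using c0 Suc.prems(6) less_SucE by blast
qed simp

lemma periodic_inverse:
  assumes "a \<in> carrier R" "a [^] (n::nat) = \<one>" "n > 0"
  shows "a [^] (n - 1) \<otimes> a = \<one>" "a \<otimes> a [^] (n - 1) = \<one>"
  using assms by (metis Suc_pred' nat_pow_Suc, metis Suc_pred' nat_pow_Suc2)

lemma finsum_in_subring:
  assumes "subring T R" "\<And>i. f i \<in> T"
  shows "(\<Oplus>i\<in>{..<r::nat}. f i) \<in> T"
proof (induction r)
  case (Suc r)
  then show ?case using assms subringE[OF assms(1)]
    by (simp add: lessThan_Suc Pi_def subset_iff)
qed (simp add: subringE(2)[OF assms(1)])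

text \<open>In a minimal noncommutative finite division ring the centralizer \<open>M\<close> of a noncentral \<open>s\<close> is
  commutative. If \<open>n\<close> is the order of \<open>s\<close> and \<open>y\<close> does not commute with \<open>s\<close>, then one of the Fourier
  coefficients \<open>x = (\<Sum>i<n. s\<^sup>i\<^sup>j y s\<^sup>i)\<close> does not commute with \<open>s\<close> either, and \<open>s\<^sup>j x s = x\<close>. Conjugation
  by \<open>x\<close> is then an automorphism of \<open>M\<close>; let \<open>r\<close> be minimal such that \<open>x\<^sup>r\<close> commutes with \<open>s\<close>. By Hilbert 90
  and counting, \<open>c \<mapsto> (cx)\<^sup>r\<close> maps the nonzero elements of \<open>M\<close> onto those of the center, so that
  \<open>w\<^sup>r = 1\<close> for some \<open>w = cx\<close>. But then \<open>(\<Sum>i<r. w\<^sup>i) = 0\<close>, which contradicts the linear independence of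
  the \<open>w\<^sup>i\<close> over \<open>M\<close>.\<close>

lemma wedderburn_minimal:
  assumes fin: "finite (carrier R)"
    and per: "\<And>a. a \<in> carrier R \<Longrightarrow> a \<noteq> \<zero> \<Longrightarrow> \<exists>n::nat. n > 0 \<and> a [^] n = \<one>"
    and proper: "\<And>T a b. subring T R \<Longrightarrow> T \<noteq> carrier R \<Longrightarrow> a \<in> T \<Longrightarrow> b \<in> T \<Longrightarrow> a \<otimes> b = b \<otimes> a"
    and s: "s \<in> carrier R" and y: "y \<in> carrier R"
  shows "s \<otimes> y = y \<otimes> s"
proof (rule ccontr)
  assume nc: "s \<otimes> y \<noteq> y \<otimes> s"
  have unit: "a \<in> Units R" if "a \<in> carrier R" "a \<noteq> \<zero>" for a
  proof -
    from per[OF that] obtain n :: nat where "n > 0" "a [^] n = \<one>" by blast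
    then show ?thesis using periodic_inverse[OF that(1)] that(1) unfolding Units_def by blast
  qed
  note inv = Units_inv_closed[OF unit] Units_l_inv[OF unit] Units_r_inv[OF unit]
  have nzd: "a = \<zero> \<or> b = \<zero>" if "a \<in> carrier R" "b \<in> carrier R" "a \<otimes> b = \<zero>" for a b
  proof (cases "a = \<zero>")
    case a: False
    have "b = inv a \<otimes> a \<otimes> b" using inv[OF that(1) a] that by simp
    also have "\<dots> = inv a \<otimes> (a \<otimes> b)" using inv(1)[OF that(1) a] that by (intro m_assoc)
    also have "\<dots> = \<zero>" using inv(1)[OF that(1) a] that by simp
    finally show ?thesis by simp
  qed simp
  have one0: "\<one> \<noteq> \<zero>"
    using nc s y by (metis l_null l_one r_null)
  \<comment> \<open>The centralizer of \<open>z\<close> contains two elements that do not commute,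
    so by minimality it is the whole ring.\<close>
  have central: "z \<otimes> t = t \<otimes> z"
    if ab: "a \<in> carrier R" "b \<in> carrier R" "a \<otimes> b \<noteq> b \<otimes> a"
      and z: "z \<in> carrier R" "z \<otimes> a = a \<otimes> z" "z \<otimes> b = b \<otimes> z" and t: "t \<in> carrier R" for a b z t
  proof -
    have "a \<in> centralizer z" "b \<in> centralizer z" using ab z by (auto simp: centralizer_def)
    then have "centralizer z = carrier R"
      using proper[OF subring_centralizer[OF z(1)]] ab(3) by blast
    then have "t \<in> centralizer z" using t by simp
    then show ?thesis by (rule centralizerD(2)[symmetric])
  qed
  have s0: "s \<noteq> \<zero>" using nc y by auto

  obtain x j where x: "x \<in> carrier R" "x \<otimes> s \<noteq> s \<otimes> x" and xj: "s [^] (j::nat) \<otimes> x \<otimes> s = x"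
  proof -
    define n where "n = (LEAST n::nat. n > 0 \<and> s [^] n = \<one>)"
    have n: "n > 0" "s [^] n = \<one>"
      using LeastI_ex[OF per[OF s s0]] by (auto simp: n_def)
    have pow_ne: "s [^] i \<noteq> s [^] k" if "i < k" "k < n" for i k
    proof
      assume eq: "s [^] i = s [^] k"
      have "s [^] i \<otimes> s [^] (k - i) = s [^] k"
        using s that by (simp add: nat_pow_mult)
      then have "s [^] (k - i) = \<one>"
        using Units_l_cancel[OF Units_pow_closed[OF unit[OF s s0]], of "s [^] (k - i)" \<one> i] eq s
        by simp
      then have "n \<le> k - i" unfolding n_def using that by (intro Least_le) auto
      then show False using that n by simp
    qed
    have inj: "inj_on (\<lambda>i. s [^] i) {..<n}"
      by (rule inj_onI) (metis lessThan_iff linorder_neq_iff pow_ne)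
    define f where "f k i = (s [^] i) [^] k \<otimes> y \<otimes> s [^] i" for k i :: nat
    have fc: "f k i \<in> carrier R" for k i using s y by (simp add: f_def)
    define E where "E k = (\<Oplus>i\<in>{..<n}. f k i)" for k
    have Ec: "E k \<in> carrier R" for k using fc by (simp add: E_def)
    have sE: "s [^] k \<otimes> E k \<otimes> s = E k" for k
    proof -
      have "(s [^] Suc i) [^] k = s [^] k \<otimes> (s [^] i) [^] k" for i
      proof -
        have "(s [^] Suc i) [^] k = s [^] (Suc i * k)" using s by (rule nat_pow_pow)
        also have "\<dots> = s [^] k \<otimes> (s [^] i) [^] k" using s by (simp add: nat_pow_pow nat_pow_mult)
        finally show ?thesis .
      qed
      then have "s [^] k \<otimes> f k i \<otimes> s = f k (Suc i)" for i
        using s y by (simp add: f_def m_assoc)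
      then have "s [^] k \<otimes> E k \<otimes> s = (\<Oplus>i\<in>{..<n}. f k (Suc i))"
        using s fc by (simp add: E_def finsum_rdistr finsum_ldistr)
      also have "\<dots> = E k" unfolding E_def
        using fc n s by (intro finsum_lessThan_Suc_shift) (auto simp: f_def)
      finally show ?thesis .
    qed
    \<comment> \<open>If every \<open>E k\<close> commuted with \<open>s\<close>, the differences
      \<open>E k s - s E k\<close> would give a Vandermonde system whose nodes \<open>s^i\<close>
      are distinct for \<open>i < n\<close>. Its coefficient at \<open>i = 0\<close> is
      \<open>y s - s y\<close>, which would vanish.\<close>
    have "\<exists>k. E k \<otimes> s \<noteq> s \<otimes> E k"
    proof (rule ccontr)
      assume "\<not> ?thesis"
      then have comm: "E k \<otimes> s = s \<otimes> E k" for k by blast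
      have "(\<Oplus>i\<in>{..<n}. (s [^] i) [^] k \<otimes> ((y \<otimes> s \<ominus> s \<otimes> y) \<otimes> s [^] i)) = \<zero>" for k :: nat
      proof -
        have "(s [^] i) [^] k \<otimes> ((y \<otimes> s \<ominus> s \<otimes> y) \<otimes> s [^] i) = f k i \<otimes> s \<oplus> (\<ominus> s) \<otimes> f k i" for i
        proof -
          let ?P = "(s [^] i) [^] k" and ?Q = "s [^] i"
          have c: "?P \<in> carrier R" "?Q \<in> carrier R" using s by auto
          have P: "?P \<otimes> s = s \<otimes> ?P" and Q: "?Q \<otimes> s = s \<otimes> ?Q"
            using commutes_pow[OF s s refl] commutes_pow[OF c(2) s] by auto
          have "s \<otimes> (?P \<otimes> y \<otimes> ?Q) = ?P \<otimes> s \<otimes> y \<otimes> ?Q"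
            using P c s y by (simp add: m_assoc[symmetric])
          moreover have "(?P \<otimes> y \<otimes> ?Q) \<otimes> s = ?P \<otimes> y \<otimes> s \<otimes> ?Q"
            using Q c s y by (simp add: m_assoc)
          ultimately show ?thesis using c s y
            by (simp add: f_def a_minus_def l_distr r_distr l_minus r_minus m_assoc)
        qed
        then have "(\<Oplus>i\<in>{..<n}. (s [^] i) [^] k \<otimes> ((y \<otimes> s \<ominus> s \<otimes> y) \<otimes> s [^] i)) =
            (\<Oplus>i\<in>{..<n}. f k i \<otimes> s \<oplus> (\<ominus> s) \<otimes> f k i)" by simp
        also have "\<dots> = (\<Oplus>i\<in>{..<n}. f k i \<otimes> s) \<oplus> (\<Oplus>i\<in>{..<n}. (\<ominus> s) \<otimes> f k i)"
          using fc s by (intro finsum_addf) auto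
        also have "\<dots> = E k \<otimes> s \<oplus> (\<ominus> s) \<otimes> E k"
          using fc s by (simp add: E_def finsum_rdistr finsum_ldistr)
        also have "\<dots> = \<zero>" using comm[of k] Ec[of k] s by (simp add: l_minus r_neg)
        finally show ?thesis .
      qed
      then have "(y \<otimes> s \<ominus> s \<otimes> y) \<otimes> s [^] (0::nat) = \<zero>"
        using nzd inj n s y pow_cong_commutes[OF s s refl]
        by (intro vandermonde[where l = "\<lambda>i. s [^] i" and r = n and i = 0
              and c = "\<lambda>i. (y \<otimes> s \<ominus> s \<otimes> y) \<otimes> s [^] i"]) auto
      then show False using nc s y by simp
    qed
    then show thesis using that Ec sE by blast
  qed
  have x0: "x \<noteq> \<zero>" using x s by auto
  define u where "u = inv x"
  have u: "u \<in> carrier R" "u \<otimes> x = \<one>" "x \<otimes> u = \<one>" using inv[OF x(1) x0] by (auto simp: u_def)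
  have ux: "u \<otimes> (x \<otimes> a) = a" "x \<otimes> (u \<otimes> a) = a" if "a \<in> carrier R" for a
    using u x(1) that by (simp_all add: m_assoc[symmetric])
  define p where "p = x \<otimes> s \<otimes> u"
  have p: "p \<in> carrier R" "p \<otimes> x = x \<otimes> s"
    using x u s by (auto simp: p_def m_assoc)
  have ps: "p \<noteq> s" using p x by auto
  define M where "M = centralizer s"
  have subM: "subring M R" unfolding M_def by (rule subring_centralizer[OF s])
  note M1 = subringE[OF subM]
  have MC: "a \<in> carrier R" if "a \<in> M" for a using M1(1) that by blast
  have sM: "s \<in> M" using s by (simp add: M_def centralizer_def)
  have Mcomm: "a \<otimes> b = b \<otimes> a" if "a \<in> M" "b \<in> M" for a b
  proof -
    have "y \<notin> M" using nc by (auto simp: M_def centralizer_def)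
    then show ?thesis using proper[OF subM _ that] y by blast
  qed
  \<comment> \<open>The relation \<open>s^j x s = x\<close> says that \<open>p = x s x^-1\<close> is
    the inverse of \<open>s^j\<close>.\<close>
  have sp: "s \<otimes> p = p \<otimes> s"
  proof -
    have c: "s [^] j \<in> carrier R" using s by simp
    have "s [^] j \<otimes> p = (s [^] j \<otimes> x \<otimes> s) \<otimes> u" using c x u s by (simp add: p_def m_assoc)
    also have "\<dots> = \<one>" using xj u by simp
    finally have 1: "s [^] j \<otimes> p = \<one>" .
    have 2: "s [^] j \<otimes> s = s \<otimes> s [^] j" using commutes_pow[OF s s refl] .
    have "s [^] j \<otimes> (s \<otimes> p) = s [^] j \<otimes> (p \<otimes> s)"
      using 1 2 c s p by (simp add: m_assoc[symmetric]) (simp add: m_assoc)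
    then show ?thesis
      using Units_l_cancel[OF Units_pow_closed[OF unit[OF s s0]]] s p by simp
  qed
  \<comment> \<open>The conjugate of \<open>a\<close> commutes with \<open>p\<close>, the conjugate
    of \<open>s\<close>. The centralizer of \<open>p\<close> also contains \<open>s\<close> but not
    \<open>x\<close>, so it is proper and hence commutative. In this way conjugation by
    \<open>x\<close> preserves \<open>M\<close>.\<close>
  have sg: "x \<otimes> a \<otimes> u \<in> M" if "a \<in> M" for a
  proof -
    have a: "a \<in> carrier R" "a \<otimes> s = s \<otimes> a" using that centralizerD by (auto simp: M_def)
    have as: "a \<otimes> (s \<otimes> u) = s \<otimes> (a \<otimes> u)" using a s u by (simp add: m_assoc[symmetric])
    have "(x \<otimes> a \<otimes> u) \<otimes> p = x \<otimes> (a \<otimes> s) \<otimes> u" using a(1) x u s by (simp add: p_def m_assoc ux)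
    also have "\<dots> = p \<otimes> (x \<otimes> a \<otimes> u)" using a(1) as x u s by (simp add: p_def m_assoc ux)
    finally have 1: "x \<otimes> a \<otimes> u \<in> centralizer p" using a x u by (simp add: centralizer_def)
    have "x \<notin> centralizer p"
    proof
      assume "x \<in> centralizer p"
      then have "x \<otimes> p = x \<otimes> s" using p by (simp add: centralizer_def)
      then show False using p ps x s Units_l_cancel[OF unit[OF x(1) x0]] by simp
    qed
    moreover have "s \<in> centralizer p" using sp s by (simp add: centralizer_def)
    ultimately have "(x \<otimes> a \<otimes> u) \<otimes> s = s \<otimes> (x \<otimes> a \<otimes> u)"
      using proper[OF subring_centralizer[OF p(1)] _ 1] x(1) by blast
    then show ?thesis using a x u by (simp add: M_def centralizer_def)
  qed
  have ex_r: "\<exists>k::nat. k > 0 \<and> x [^] k \<otimes> s = s \<otimes> x [^] k"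
    using per[OF x(1) x0] s by force
  define r where "r = (LEAST k::nat. k > 0 \<and> x [^] k \<otimes> s = s \<otimes> x [^] k)"
  have r: "r > 0" "x [^] r \<otimes> s = s \<otimes> x [^] r" using LeastI_ex[OF ex_r] by (auto simp: r_def)
  have r_min: "x [^] k \<otimes> s \<noteq> s \<otimes> x [^] k" if "k > 0" "k < r" for k :: nat
    using that not_less_Least unfolding r_def by blast
  \<comment> \<open>\<open>x^r\<close> commutes with \<open>x\<close> and with \<open>s\<close>,
    which do not commute with each other.\<close>
  have xr: "x [^] r \<otimes> t = t \<otimes> x [^] r" if "t \<in> carrier R" for t
    using central[OF x(1) s x(2) _ commutes_pow[OF x(1) x(1) refl] r(2) that] x by simp
  \<comment> \<open>These are the images of \<open>s\<close> under the iterates of conjugation by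
    \<open>x\<close>. The minimality of \<open>r\<close> makes the first \<open>r\<close> of them
    distinct, so they can serve as Vandermonde nodes in the commutative ring
    \<open>M\<close>.\<close>
  define la where "la i = x [^] i \<otimes> s \<otimes> u [^] i" for i :: nat
  have la_Suc: "la (Suc i) = x \<otimes> la i \<otimes> u" for i
    using nat_pow_Suc2[OF x(1)] x u s by (simp add: la_def m_assoc del: nat_pow_Suc)
  have laM: "la i \<in> M" for i
  proof (induction i)
    case 0 then show ?case using sM s by (simp add: la_def)
  next
    case (Suc i) then show ?case using sg by (simp add: la_Suc)
  qed
  have upow: "u [^] i \<otimes> x [^] i = \<one>" "x [^] i \<otimes> u [^] i = \<one>" for i :: nat
  proof -
    have c: "u \<otimes> x = x \<otimes> u" using u by simp
    have 1: "(u \<otimes> x) [^] i = u [^] i \<otimes> x [^] i" using c u(1) x(1) by (rule pow_mult_distrib)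
    have 2: "(x \<otimes> u) [^] i = x [^] i \<otimes> u [^] i" using c[symmetric] x(1) u(1) by (rule pow_mult_distrib)
    show "u [^] i \<otimes> x [^] i = \<one>" "x [^] i \<otimes> u [^] i = \<one>"
      unfolding 1[symmetric] 2[symmetric] u by simp_all
  qed
  have la_ne: "la i \<noteq> la k" if "i < k" "k < r" for i k
  proof
    assume eq: "la i = la k"
    let ?d = "k - i"
    have xk: "x [^] k = x [^] i \<otimes> x [^] ?d" and uk: "u [^] k = u [^] ?d \<otimes> u [^] i"
      using that x u by (simp_all add: nat_pow_mult)
    have 1: "u [^] i \<otimes> la i \<otimes> x [^] i = s" for i
    proof -
      have "u [^] i \<otimes> la i \<otimes> x [^] i = (u [^] i \<otimes> x [^] i) \<otimes> s \<otimes> (u [^] i \<otimes> x [^] i)"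
        using x u s by (simp add: la_def m_assoc)
      then show ?thesis using upow s by simp
    qed
    have "u [^] i \<otimes> la k \<otimes> x [^] i = (u [^] i \<otimes> x [^] i) \<otimes> x [^] ?d \<otimes> s \<otimes> u [^] ?d \<otimes> (u [^] i \<otimes> x [^] i)"
      using x u s by (simp add: la_def m_assoc xk uk)
    then have "s = x [^] ?d \<otimes> s \<otimes> u [^] ?d" using 1[of i] eq upow x u s by simp
    then have "s \<otimes> x [^] ?d = (x [^] ?d \<otimes> s \<otimes> u [^] ?d) \<otimes> x [^] ?d" by simp
    also have "\<dots> = x [^] ?d \<otimes> s" using upow x u s by (simp add: m_assoc)
    finally have "s \<otimes> x [^] ?d = x [^] ?d \<otimes> s" .
    moreover have "?d > 0" "?d < r" using that by auto
    ultimately show False using r_min by metis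
  qed
  have la_inj: "inj_on la {..<r}"
    by (rule inj_onI) (metis lessThan_iff linorder_neq_iff la_ne)
  note lac = MC[OF laM]
  \<comment> \<open>This plays the role of the independence of characters: a family of coefficients
    with value 1 at index 0 cannot be annihilated by all powers of the nodes.\<close>
  have sep: "\<exists>k::nat. (\<Oplus>i\<in>{..<r}. la i [^] k \<otimes> c i) \<noteq> \<zero>"
    if c: "\<And>i. c i \<in> carrier R" "c 0 = \<one>" for c
  proof (rule ccontr)
    assume "\<not> ?thesis"
    then have "c 0 = \<zero>"
      using nzd Mcomm[OF laM laM]
      by (intro vandermonde[where l = la and r = r and c = c, OF _ lac _ la_inj c(1) _ r(1)]) auto
    then show False using c(2) one0 by simp
  qed
  have xla: "x \<otimes> la i = la (Suc i) \<otimes> x" for i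
    using x u lac[of i] by (simp add: la_Suc m_assoc)
  have ne: "a \<otimes> b \<noteq> \<zero>" if "a \<in> carrier R" "b \<in> carrier R" "a \<noteq> \<zero>" "b \<noteq> \<zero>" for a b
    using nzd that by blast
  \<comment> \<open>Up to the central factor \<open>x^r\<close>, this is the norm of
    \<open>c\<close> with respect to conjugation by \<open>x\<close>.\<close>
  define psi where "psi c = (c \<otimes> x) [^] r" for c
  have w_s: "(c \<otimes> x) [^] i \<otimes> s [^] k = la i [^] k \<otimes> (c \<otimes> x) [^] i" if c: "c \<in> M" for c and i k :: nat
  proof -
    have cc: "c \<in> carrier R" "c \<otimes> x \<in> carrier R" using MC[OF c] x by auto
    have 1: "(c \<otimes> x) [^] i \<otimes> s = la i \<otimes> (c \<otimes> x) [^] i" for i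
    proof (induction i)
      case 0 then show ?case using s by (simp add: la_def)
    next
      case (Suc i)
      let ?w = "(c \<otimes> x) [^] i"
      have wc: "?w \<in> carrier R" using cc by simp
      have "(c \<otimes> x) [^] Suc i \<otimes> s = c \<otimes> x \<otimes> (?w \<otimes> s)"
        using nat_pow_Suc2[OF cc(2)] cc wc s by (simp add: m_assoc del: nat_pow_Suc)
      also have "\<dots> = c \<otimes> (x \<otimes> la i) \<otimes> ?w" using Suc cc x lac[of i] wc by (simp add: m_assoc)
      also have "\<dots> = (c \<otimes> la (Suc i)) \<otimes> x \<otimes> ?w"
        using xla[of i] cc x lac[of "Suc i"] wc by (simp add: m_assoc)
      also have "\<dots> = la (Suc i) \<otimes> (c \<otimes> x \<otimes> ?w)"
        using Mcomm[OF c laM[of "Suc i"]] cc(1) x lac[of "Suc i"] wc by (simp add: m_assoc)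
      also have "c \<otimes> x \<otimes> ?w = (c \<otimes> x) [^] Suc i" using nat_pow_Suc2[OF cc(2)] by simp
      finally show ?case .
    qed
    show ?thesis
    proof (induction k)
      case 0 then show ?case using cc by simp
    next
      case (Suc k)
      let ?w = "(c \<otimes> x) [^] i"
      have wc: "?w \<in> carrier R" using cc by simp
      have "?w \<otimes> s [^] Suc k = (?w \<otimes> s [^] k) \<otimes> s" using wc s by (simp add: m_assoc)
      also have "\<dots> = la i [^] k \<otimes> (?w \<otimes> s)" using Suc wc s lac[of i] by (simp add: m_assoc)
      also have "\<dots> = la i [^] Suc k \<otimes> ?w" using 1[of i] wc lac[of i] by (simp add: m_assoc)
      finally show ?case .
    qed
  qed
  have w_not_s: "c \<otimes> x \<otimes> s \<noteq> s \<otimes> (c \<otimes> x)" if c: "c \<in> M" "c \<noteq> \<zero>" for c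
  proof
    assume "c \<otimes> x \<otimes> s = s \<otimes> (c \<otimes> x)"
    then have "c \<otimes> (x \<otimes> s) = c \<otimes> (s \<otimes> x)"
      using Mcomm[OF c(1) sM] MC[OF c(1)] x(1) s by (simp add: m_assoc[symmetric])
    then show False using Units_l_cancel[OF unit[OF MC[OF c(1)] c(2)]] x s by simp
  qed
  have w_form: "\<exists>m\<in>M. (c \<otimes> x) [^] i = m \<otimes> x [^] i" if c: "c \<in> M" for c and i :: nat
  proof (induction i)
    case 0 then show ?case using M1(3) by force
  next
    case (Suc i)
    then obtain m where m: "m \<in> M" "(c \<otimes> x) [^] i = m \<otimes> x [^] i" by blast
    have cc: "c \<in> carrier R" "m \<in> carrier R" using MC c m by auto
    have "(c \<otimes> x) [^] Suc i = c \<otimes> x \<otimes> (c \<otimes> x) [^] i" using cc x by (intro nat_pow_Suc2) simp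
    also have "\<dots> = c \<otimes> x \<otimes> (m \<otimes> x [^] i)" by (simp only: m(2))
    also have "\<dots> = c \<otimes> (x \<otimes> m \<otimes> u) \<otimes> (x \<otimes> x [^] i)"
      using cc x u by (simp add: m_assoc ux)
    also have "\<dots> = c \<otimes> (x \<otimes> m \<otimes> u) \<otimes> x [^] Suc i" using nat_pow_Suc2[OF x(1)] by simp
    finally show ?case using M1(6)[OF c sg[OF m(1)]] by blast
  qed
  define Z where "Z = {z \<in> carrier R. (\<forall>t\<in>carrier R. z \<otimes> t = t \<otimes> z) \<and> z \<noteq> \<zero>}"
  \<comment> \<open>\<open>psi c\<close> is an element of \<open>M\<close> times \<open>x^r\<close>
    and so commutes with \<open>s\<close>; as a power of \<open>c x\<close> it also commutes with
    \<open>c x\<close>. These two elements do not commute, so \<open>psi c\<close> is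
    central.\<close>
  have psiZ: "psi c \<in> Z" if c: "c \<in> M" "c \<noteq> \<zero>" for c
  proof -
    have cc: "c \<in> carrier R" using MC c by auto
    obtain m where m: "m \<in> M" "psi c = m \<otimes> x [^] r" using w_form[OF c(1), of r] unfolding psi_def by blast
    have mc: "m \<in> carrier R" "m \<otimes> s = s \<otimes> m" using m(1) centralizerD by (auto simp: M_def)
    have "psi c \<otimes> s = s \<otimes> psi c"
      unfolding m(2) using mc x s r(2) by (intro commutes_mult) auto
    moreover have "psi c \<otimes> (c \<otimes> x) = c \<otimes> x \<otimes> psi c"
      unfolding psi_def using cc x by (intro commutes_pow) auto
    ultimately have "psi c \<otimes> t = t \<otimes> psi c" if "t \<in> carrier R" for t
      using central[OF _ s w_not_s[OF c], of "psi c" t] cc x that by (simp add: psi_def)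
    moreover have "(c \<otimes> x) [^] i \<noteq> \<zero>" for i :: nat
      by (induction i) (use one0 ne c cc x x0 in auto)
    ultimately show ?thesis using cc x by (auto simp: Z_def psi_def)
  qed
  \<comment> \<open>Hilbert 90 for conjugation by \<open>x\<close>\<close>
  have conj: "\<exists>d\<in>M. d \<noteq> \<zero> \<and> c \<otimes> x \<otimes> d = d \<otimes> (b \<otimes> x)"
    if c: "c \<in> M" "c \<noteq> \<zero>" and b: "b \<in> M" "b \<noteq> \<zero>" and eq: "psi c = psi b" for b c
  proof -
    have cc: "c \<in> carrier R" "b \<in> carrier R" using MC c b by auto
    define w where "w = c \<otimes> x"
    define ib where "ib = inv b"
    define v where "v = u \<otimes> ib"
    have ib: "ib \<in> carrier R" "ib \<otimes> b = \<one>" "b \<otimes> ib = \<one>" using inv[OF cc(2) b(2)] by (auto simp: ib_def)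
    have ibM: "ib \<in> M"
    proof -
      have "b \<otimes> (ib \<otimes> s) = b \<otimes> (s \<otimes> ib)"
        using Mcomm[OF b(1) sM] ib cc s by (simp add: m_assoc[symmetric]) (simp add: m_assoc)
      then have "ib \<otimes> s = s \<otimes> ib"
        using Units_l_cancel[OF unit[OF cc(2) b(2)]] ib s by simp
      then show ?thesis using ib by (simp add: M_def centralizer_def)
    qed
    have wv: "w \<in> carrier R" "v \<in> carrier R" using cc x u ib by (auto simp: w_def v_def)
    have vbx: "v \<otimes> (b \<otimes> x) = \<one>" "b \<otimes> x \<otimes> v = \<one>"
    proof -
      have "v \<otimes> (b \<otimes> x) = u \<otimes> (ib \<otimes> b) \<otimes> x" "b \<otimes> x \<otimes> v = b \<otimes> (x \<otimes> u) \<otimes> ib"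
        using ib(1) u(1) cc x by (simp_all add: v_def m_assoc)
      then show "v \<otimes> (b \<otimes> x) = \<one>" "b \<otimes> x \<otimes> v = \<one>" using ib u cc by simp_all
    qed
    \<comment> \<open>Here \<open>v\<close> is the inverse of \<open>b x\<close>. In
      \<open>ga i\<close>, which compares the powers of \<open>c x\<close> and \<open>b x\<close>,
      the powers of \<open>x\<close> cancel, so \<open>ga i\<close> lies in
      \<open>M\<close>.\<close>
    define ga where "ga i = w [^] i \<otimes> v [^] i" for i :: nat
    have gaS: "ga (Suc i) = w \<otimes> ga i \<otimes> v" for i
      unfolding ga_def nat_pow_Suc2[OF wv(1)] using wv by (simp add: m_assoc)
    have gaM: "ga i \<in> M" for i
    proof (induction i)
      case 0 then show ?case using M1(3) by (simp add: ga_def)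
    next
      case (Suc i)
      have "ga (Suc i) = c \<otimes> (x \<otimes> ga i \<otimes> u) \<otimes> ib"
        unfolding gaS using MC[OF Suc] cc x u ib by (simp add: w_def v_def m_assoc)
      then show ?case using M1(6) c(1) ibM sg[OF Suc] by simp
    qed
    obtain k :: nat where k: "(\<Oplus>i\<in>{..<r}. la i [^] k \<otimes> ga i) \<noteq> \<zero>"
      using sep[of ga] MC[OF gaM] by (auto simp: ga_def)
    \<comment> \<open>The resolvent of Hilbert 90: the average of \<open>w^i s^k v^i\<close> over
      one period, with \<open>k\<close> chosen so that the sum does not vanish.\<close>
    define d where "d = (\<Oplus>i\<in>{..<r}. la i [^] k \<otimes> ga i)"
    have "la i [^] k \<in> M" for i by (induction k) (use M1 laM in auto)
    then have dM: "d \<in> M" unfolding d_def using M1(6) gaM by (intro finsum_in_subring[OF subM]) auto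
    define f where "f i = w [^] i \<otimes> s [^] k \<otimes> v [^] i" for i :: nat
    have fc: "f i \<in> carrier R" for i using wv s by (simp add: f_def)
    have "la i [^] k \<otimes> ga i = f i" for i
      using w_s[OF c(1), of i k] wv s lac[of i] by (simp add: f_def ga_def w_def[symmetric] m_assoc[symmetric])
    then have df: "d = (\<Oplus>i\<in>{..<r}. f i)" by (simp add: d_def)
    \<comment> \<open>The sum closes up because \<open>w^r = (b x)^r\<close>, by equality of the
      norms, and this element is central.\<close>
    have fr: "f r = f 0"
    proof -
      have wr: "w [^] r = (b \<otimes> x) [^] r" using eq by (simp add: psi_def w_def)
      have "w [^] r \<otimes> s [^] k = s [^] k \<otimes> w [^] r"
        using psiZ[OF c] s by (simp add: Z_def psi_def w_def)
      then have "f r = s [^] k \<otimes> ((b \<otimes> x) [^] r \<otimes> v [^] r)"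
        using wv s cc x by (simp add: f_def m_assoc wr)
      also have "(b \<otimes> x) [^] r \<otimes> v [^] r = (b \<otimes> x \<otimes> v) [^] r"
        using vbx cc x wv by (intro pow_mult_distrib[symmetric]) auto
      finally show ?thesis using vbx s by (simp add: f_def)
    qed
    have "w \<otimes> f i \<otimes> v = f (Suc i)" for i
      unfolding f_def nat_pow_Suc2[OF wv(1)] using wv s by (simp add: m_assoc)
    then have "w \<otimes> d \<otimes> v = (\<Oplus>i\<in>{..<r}. f (Suc i))"
      unfolding df using wv fc by (simp add: finsum_rdistr finsum_ldistr)
    also have "\<dots> = d" unfolding df using fc fr by (rule finsum_lessThan_Suc_shift)
    finally have "w \<otimes> d \<otimes> v = d" .
    have "w \<otimes> d = d \<otimes> (b \<otimes> x)"
    proof -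
      have "w \<otimes> d = w \<otimes> d \<otimes> (v \<otimes> (b \<otimes> x))" using vbx wv MC[OF dM] by simp
      also have "\<dots> = w \<otimes> d \<otimes> v \<otimes> (b \<otimes> x)" using wv MC[OF dM] cc x by (simp add: m_assoc)
      finally show ?thesis using \<open>w \<otimes> d \<otimes> v = d\<close> by simp
    qed
    then show ?thesis using dM k unfolding w_def d_def by blast
  qed
  define Ms where "Ms = M - {\<zero>}"
  have finM: "finite Ms" using fin MC by (auto simp: Ms_def intro: finite_subset)
  have finZ: "finite Z" using fin by (auto simp: Z_def)
  have oneMs: "\<one> \<in> Ms" using one0 M1(3) by (simp add: Ms_def)
  define P where "P b = {(c, d). c \<in> inv_into Ms psi ` psi ` Ms \<and> d \<in> Ms \<and> c \<otimes> x \<otimes> d = d \<otimes> (b \<otimes> x)}" for b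
  let ?A = "inv_into Ms psi ` psi ` Ms"
  have repM: "inv_into Ms psi (psi b) \<in> Ms" "psi (inv_into Ms psi (psi b)) = psi b" if "b \<in> Ms" for b
    using that by (auto intro: inv_into_into f_inv_into_f)
  have finP: "finite (P b)" for b
    using finM by (auto simp: P_def intro: finite_subset[OF _ finite_cartesian_product[of ?A Ms]])
  have cardP: "card Z \<le> card (P b)" if b: "b \<in> Ms" for b
  proof -
    let ?c = "inv_into Ms psi (psi b)"
    obtain d where d: "d \<in> Ms" "?c \<otimes> x \<otimes> d = d \<otimes> (b \<otimes> x)"
      using conj[of ?c b] repM[OF b] b by (auto simp: Ms_def)
    have cc: "?c \<in> carrier R" "b \<in> carrier R" "d \<in> carrier R" "d \<noteq> \<zero>"
      using MC repM[OF b] b d by (auto simp: Ms_def)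
    have "(?c, z \<otimes> d) \<in> P b" if z: "z \<in> Z" for z
    proof -
      have zc: "z \<in> carrier R" "\<And>t. t \<in> carrier R \<Longrightarrow> z \<otimes> t = t \<otimes> z" "z \<noteq> \<zero>" using z by (auto simp: Z_def)
      have "z \<in> M" using zc(1) zc(2)[OF s] by (simp add: M_def centralizer_def)
      then have 1: "z \<otimes> d \<in> Ms" using d M1(6) ne zc cc by (auto simp: Ms_def)
      have "?c \<otimes> x \<otimes> (z \<otimes> d) = z \<otimes> (?c \<otimes> x \<otimes> d)"
        using zc(1) zc(2)[of "?c \<otimes> x"] cc x by (simp add: m_assoc[symmetric])
      also have "\<dots> = z \<otimes> d \<otimes> (b \<otimes> x)" using d zc(1) cc x by (simp add: m_assoc)
      finally show ?thesis using 1 b by (auto simp: P_def)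
    qed
    then have "(\<lambda>z. (?c, z \<otimes> d)) ` Z \<subseteq> P b" by blast
    moreover have "inj_on (\<lambda>z. (?c, z \<otimes> d)) Z"
    proof (rule inj_onI)
      fix z z' assume z: "z \<in> Z" "z' \<in> Z" and "(?c, z \<otimes> d) = (?c, z' \<otimes> d)"
      then have "d \<otimes> z = d \<otimes> z'" using cc by (auto simp: Z_def)
      then show "z = z'" using Units_l_cancel[OF unit[OF cc(3,4)]] z by (auto simp: Z_def)
    qed
    ultimately show ?thesis using finP by (metis card_image card_mono)
  qed
  have disj: "b = b'" if "b \<in> Ms" "b' \<in> Ms" "cd \<in> P b" "cd \<in> P b'" for b b' cd
  proof -
    from that(3,4) obtain d where d: "d \<in> Ms" "d \<otimes> (b \<otimes> x) = d \<otimes> (b' \<otimes> x)" by (auto simp: P_def)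
    have cc: "b \<in> carrier R" "b' \<in> carrier R" "d \<in> carrier R" "d \<noteq> \<zero>" using MC that d by (auto simp: Ms_def)
    have "b \<otimes> x = b' \<otimes> x" using d(2) Units_l_cancel[OF unit[OF cc(3,4)]] cc x by simp
    then have "(b \<otimes> x) \<otimes> u = (b' \<otimes> x) \<otimes> u" by simp
    then show ?thesis using cc x u by (simp add: m_assoc)
  qed
  have "card Ms * card Z \<le> (\<Sum>b\<in>Ms. card (P b))"
    using sum_bounded_below[of Ms "card Z" "\<lambda>b. card (P b)"] cardP by simp
  also have "\<dots> = card (\<Union>b\<in>Ms. P b)"
    by (rule card_UN_disjoint[symmetric, OF finM]) (blast intro: finP dest: disj)+
  also have "\<dots> \<le> card (?A \<times> Ms)"
    using finM by (intro card_mono) (auto simp: P_def)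
  also have "\<dots> \<le> card (psi ` Ms) * card Ms"
    using finM by (simp add: card_cartesian_product card_image_le)
  finally have "card Z \<le> card (psi ` Ms)"
    using finM oneMs by (auto simp: card_gt_0_iff mult.commute)
  then have "psi ` Ms = Z"
    using psiZ finZ by (intro card_seteq) (auto simp: Ms_def)
  moreover have "\<one> \<in> Z" using one0 by (simp add: Z_def)
  ultimately have "\<one> \<in> psi ` Ms" by simp
  then obtain c where "c \<in> Ms" "\<one> = psi c" by blast
  then have c: "c \<in> M" "c \<noteq> \<zero>" "psi c = \<one>" by (auto simp: Ms_def)
  define w where "w = c \<otimes> x"
  have w: "w \<in> carrier R" "w [^] r = \<one>" "w \<otimes> s \<noteq> s \<otimes> w"
    using MC[OF c(1)] x c w_not_s[OF c(1,2)] by (auto simp: w_def psi_def)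
  \<comment> \<open>\<open>w\<close> differs from 1 because it does not commute with
    \<open>s\<close>, so \<open>(w - 1) e = 0\<close> forces \<open>e = 0\<close>. Moving
    \<open>s^k\<close> to the left through the powers of \<open>w\<close> then turns
    \<open>e s^k = 0\<close> into a relation that \<open>sep\<close> excludes.\<close>
  define e where "e = (\<Oplus>i\<in>{..<r}. w [^] i)"
  have ec: "e \<in> carrier R" using w by (simp add: e_def)
  have "w \<otimes> e = (\<Oplus>i\<in>{..<r}. w [^] Suc i)"
    using w nat_pow_Suc2[OF w(1)] by (simp add: e_def finsum_rdistr del: nat_pow_Suc)
  also have "\<dots> = e" unfolding e_def using w by (intro finsum_lessThan_Suc_shift) auto
  finally have "(w \<ominus> \<one>) \<otimes> e = \<zero>" using w ec by (simp add: a_minus_def l_distr l_minus r_neg)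
  moreover have "w \<ominus> \<one> \<noteq> \<zero>" using w s by auto
  ultimately have "e = \<zero>" using nzd[of "w \<ominus> \<one>" e] w ec by auto
  obtain k :: nat where k: "(\<Oplus>i\<in>{..<r}. la i [^] k \<otimes> w [^] i) \<noteq> \<zero>"
    using sep[of "\<lambda>i. w [^] i"] w by auto
  have "(\<Oplus>i\<in>{..<r}. la i [^] k \<otimes> w [^] i) = (\<Oplus>i\<in>{..<r}. w [^] i \<otimes> s [^] k)"
    using w_s[OF c(1)] by (simp add: w_def)
  also have "\<dots> = e \<otimes> s [^] k" using w s by (simp add: e_def finsum_ldistr)
  finally show False using k \<open>e = \<zero>\<close> s by simp
qed

end

text \<open>Instead of inverses, the hypothesis speaks of finite multiplicative orders, a property
  that passes to subrings at once. So induction on the cardinality leads to the minimal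
  case.\<close>

theorem wedderburn_little:
  fixes R :: "('a, 'b) ring_scheme"
  assumes "ring R" "finite (carrier R)"
    and "\<And>a. a \<in> carrier R \<Longrightarrow> a \<noteq> \<zero>\<^bsub>R\<^esub> \<Longrightarrow> \<exists>n::nat. n > 0 \<and> a [^]\<^bsub>R\<^esub> n = \<one>\<^bsub>R\<^esub>"
    and "a \<in> carrier R" "b \<in> carrier R"
  shows "a \<otimes>\<^bsub>R\<^esub> b = b \<otimes>\<^bsub>R\<^esub> a"
  using assms
proof (induction "card (carrier R)" arbitrary: R a b rule: less_induct)
  case less
  interpret ring R by (rule less.prems(1))
  show ?case
  proof (rule wedderburn_minimal[OF less.prems(2,3) _ less.prems(4,5)])
    fix T a b assume T: "subring T R" "T \<noteq> carrier R" and ab: "a \<in> T" "b \<in> T"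
    let ?T = "R\<lparr>carrier := T\<rparr>"
    note T1 = subringE[OF T(1)]
    have "card T < card (carrier R)" using T T1(1) less.prems(2) by (simp add: psubset_card_mono psubsetI)
    moreover have "\<exists>n::nat. n > 0 \<and> a [^]\<^bsub>?T\<^esub> n = \<one>\<^bsub>?T\<^esub>" if "a \<in> T" "a \<noteq> \<zero>\<^bsub>R\<^esub>" for a
      using less.prems(3)[of a] that T1(1) by (auto simp: nat_pow_consistent[symmetric])
    ultimately show "a \<otimes>\<^bsub>R\<^esub> b = b \<otimes>\<^bsub>R\<^esub> a"
      using less.hyps[of ?T a b] subring_is_ring[OF T(1)] ab T1(1) less.prems(2)
      by (simp add: finite_subset)
  qed
qed

section \<open>Idempotents and nilpotent elements in finite rings\<close>

lemma (in monoid) finite_pow_idempotent: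
  assumes "finite (carrier G)" "x \<in> carrier G"
  shows "\<exists>m::nat. m > 0 \<and> x [^] m \<otimes> x [^] m = x [^] m"
proof -
  have "\<not> inj (\<lambda>i::nat. x [^] i)"
    using assms finite_subset[of "range (\<lambda>i::nat. x [^] i)"] finite_imageD[of "\<lambda>i::nat. x [^] i" UNIV]
    by auto
  then obtain i j :: nat where ij: "i < j" "x [^] i = x [^] j" by (metis injI nat_neq_iff)
  define p where "p = j - i"
  have step: "x [^] (k + p) = x [^] k" if "k \<ge> i" for k
  proof -
    have "x [^] (k + p) = x [^] (k - i) \<otimes> x [^] j" "x [^] k = x [^] (k - i) \<otimes> x [^] i"
      using that ij(1) assms by (simp_all add: nat_pow_mult p_def)
    then show ?thesis using ij(2) by simp
  qed
  have steps: "x [^] (k + t * p) = x [^] k" if "k \<ge> i" for k t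
  proof (induction t)
    case (Suc t)
    have eq: "k + Suc t * p = (k + t * p) + p" by simp
    show ?case unfolding eq using step[of "k + t * p"] that Suc by simp
  qed simp
  have "p > 0" using ij by (simp add: p_def)
  \<comment> \<open>The exponent has to be a multiple of the period \<open>p\<close> that lies
    beyond the preperiod \<open>i\<close>. The factor \<open>Suc i\<close> in place of
    \<open>i\<close> keeps it positive when \<open>i = 0\<close>.\<close>
  then have m: "Suc i * p \<ge> i" "Suc i * p > 0" by (auto simp: Suc_le_eq intro: le_SucI order_trans[of i "i * p"])
  have "x [^] (Suc i * p) \<otimes> x [^] (Suc i * p) = x [^] (Suc i * p)"
    using steps[OF m(1), of "Suc i"] assms nat_pow_mult by simp
  then show ?thesis using m(2) by blast
qed

context ring
begin

text \<open>The elements \<open>f z (1 - f)\<close> and \<open>(1 - f) z f\<close> have square zero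
  and so commute with \<open>f\<close>. Since \<open>f\<close> fixes each of them on one side and
  kills it on the other, both vanish.\<close>

lemma idempotent_central:
  assumes nil: "\<And>y z. y \<in> carrier R \<Longrightarrow> y \<otimes> y = \<zero> \<Longrightarrow> z \<in> carrier R \<Longrightarrow> y \<otimes> z = z \<otimes> y"
    and f: "f \<in> carrier R" "f \<otimes> f = f" and z: "z \<in> carrier R"
  shows "f \<otimes> z = z \<otimes> f"
proof -
  have ff: "f \<otimes> (f \<otimes> a) = f \<otimes> a" if "a \<in> carrier R" for a using f that by (simp add: m_assoc[symmetric])
  define y where "y = f \<otimes> z \<ominus> f \<otimes> z \<otimes> f"
  have y: "y \<in> carrier R" "f \<otimes> y = y" "y \<otimes> f = \<zero>"
    using f z ff by (simp_all add: y_def a_minus_def l_distr r_distr l_minus r_minus m_assoc r_neg)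
  have "y \<otimes> y = y \<otimes> (f \<otimes> y)" using y(2) by simp
  also have "\<dots> = (y \<otimes> f) \<otimes> y" using y(1) f(1) by (simp add: m_assoc)
  finally have "y \<otimes> y = \<zero>" using y(1,3) by simp
  then have "y = \<zero>" using nil[of y f] y f by simp
  define x where "x = z \<otimes> f \<ominus> f \<otimes> z \<otimes> f"
  have x: "x \<in> carrier R" "x \<otimes> f = x" "f \<otimes> x = \<zero>"
    using f z ff by (simp_all add: x_def a_minus_def l_distr r_distr l_minus r_minus m_assoc r_neg)
  have "x \<otimes> x = (x \<otimes> f) \<otimes> x" using x(2) by simp
  also have "\<dots> = x \<otimes> (f \<otimes> x)" using x(1) f(1) by (simp add: m_assoc)
  finally have "x \<otimes> x = \<zero>" using x(1,3) by simp
  then have "x = \<zero>" using nil[of x f] x f by simp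
  then show ?thesis using \<open>y = \<zero>\<close> f z by (simp add: x_def y_def)
qed

text \<open>The Peirce corner \<open>f R\<close>, which for central idempotent \<open>f\<close>
  equals \<open>f R f\<close>. The operations are those of the ring; only the carrier and the
  identity change.\<close>

definition corner :: "'a \<Rightarrow> ('a, 'b) ring_scheme" where
  "corner f = R\<lparr>carrier := {x \<in> carrier R. f \<otimes> x = x}, one := f\<rparr>"

lemma corner_simps [simp]:
  "carrier (corner f) = {x \<in> carrier R. f \<otimes> x = x}"
  "x \<otimes>\<^bsub>corner f\<^esub> y = x \<otimes> y" "\<one>\<^bsub>corner f\<^esub> = f"
  "x \<oplus>\<^bsub>corner f\<^esub> y = x \<oplus> y" "\<zero>\<^bsub>corner f\<^esub> = \<zero>"
  by (simp_all add: corner_def)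

context
  fixes f
  assumes f: "f \<in> carrier R" "f \<otimes> f = f" and cent: "\<And>z. z \<in> carrier R \<Longrightarrow> f \<otimes> z = z \<otimes> f"
begin

lemma ring_corner: "ring (corner f)"
proof (rule ringI)
  show "abelian_group (corner f)"
  proof (rule abelian_groupI)
    fix x assume "x \<in> carrier (corner f)"
    then show "\<exists>y\<in>carrier (corner f). y \<oplus>\<^bsub>corner f\<^esub> x = \<zero>\<^bsub>corner f\<^esub>"
      using f by (intro bexI[of _ "\<ominus> x"]) (simp_all add: r_minus l_neg)
  qed (use f in \<open>auto simp: a_assoc r_distr a_comm a_lcomm\<close>)
  show "monoid (corner f)"
  proof (rule monoidI)
    fix x assume "x \<in> carrier (corner f)"
    then show "x \<otimes>\<^bsub>corner f\<^esub> \<one>\<^bsub>corner f\<^esub> = x" using cent[of x] by simp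
  qed (use f in \<open>auto simp: m_assoc[symmetric]\<close>)
qed (auto simp: l_distr r_distr)

text \<open>The factor \<open>f\<close> is there for the exponent 0, where the power in the corner
  is its identity \<open>f\<close>.\<close>

lemma corner_pow:
  assumes "x \<in> carrier R" "f \<otimes> x = x"
  shows "x [^]\<^bsub>corner f\<^esub> (n::nat) = f \<otimes> x [^] n"
proof (induction n)
  case (Suc n)
  interpret C: ring "corner f" by (rule ring_corner)
  show ?case using Suc assms f by (simp add: m_assoc)
qed (use f in simp)

lemma corner_nilpotent_iff:
  assumes x: "x \<in> carrier R" "f \<otimes> x = x"
  shows "(\<exists>n::nat. x [^]\<^bsub>corner f\<^esub> n = \<zero>) \<longleftrightarrow> (\<exists>n::nat. x [^] n = \<zero>)"
proof
  assume "\<exists>n::nat. x [^]\<^bsub>corner f\<^esub> n = \<zero>"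
  then obtain n :: nat where n: "f \<otimes> x [^] n = \<zero>" using corner_pow[OF x] by auto
  have "x [^] Suc n = x [^] n \<otimes> (f \<otimes> x)" using x by simp
  also have "\<dots> = (f \<otimes> x [^] n) \<otimes> x" using x(1) f cent[of "x [^] n"] by (simp add: m_assoc[symmetric])
  finally have "x [^] Suc n = \<zero>" using n x(1) by simp
  then show "\<exists>n::nat. x [^] n = \<zero>" ..
next
  assume "\<exists>n::nat. x [^] n = \<zero>"
  then obtain n :: nat where "x [^] n = \<zero>" ..
  then have "x [^]\<^bsub>corner f\<^esub> n = \<zero>" using corner_pow[OF x] f by simp
  then show "\<exists>n::nat. x [^]\<^bsub>corner f\<^esub> n = \<zero>" ..
qed

lemma pow_mult_idempotent:
  assumes "x \<in> carrier R"
  shows "(f \<otimes> x) [^] Suc n = f \<otimes> x [^] Suc n"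
proof (induction n)
  case (Suc n)
  have "(f \<otimes> x) [^] Suc (Suc n) = (f \<otimes> x [^] Suc n) \<otimes> (f \<otimes> x)" using Suc by simp
  also have "\<dots> = f \<otimes> (x [^] Suc n \<otimes> f) \<otimes> x" using assms f by (simp add: m_assoc)
  also have "\<dots> = (f \<otimes> f) \<otimes> x [^] Suc n \<otimes> x"
    using assms f(1) cent[of "x [^] Suc n"] by (simp add: m_assoc)
  finally show ?case using assms f by (simp add: m_assoc)
qed (use assms f in simp)

end

end

text \<open>A nontrivial idempotent is central and splits the ring into two smaller corners. Without
  one, every element is nilpotent or invertible; a non-nilpotent commutator then excludes nonzero
  nilpotents, and Wedderburn's theorem makes the ring commutative. The equation
  \<open>c + b a = a b\<close> avoids the additive inverse, which depends on the carrier, so that it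
  restricts to corners and subrings unchanged.\<close>

theorem finite_ring_commutator_nilpotent:
  fixes R :: "('a, 'b) ring_scheme"
  assumes "ring R" "finite (carrier R)"
    and "\<And>y z. y \<in> carrier R \<Longrightarrow> \<exists>n::nat. y [^]\<^bsub>R\<^esub> n = \<zero>\<^bsub>R\<^esub> \<Longrightarrow> z \<in> carrier R \<Longrightarrow>
      y \<otimes>\<^bsub>R\<^esub> z = z \<otimes>\<^bsub>R\<^esub> y"
    and "a \<in> carrier R" "b \<in> carrier R" "c \<in> carrier R" "c \<oplus>\<^bsub>R\<^esub> b \<otimes>\<^bsub>R\<^esub> a = a \<otimes>\<^bsub>R\<^esub> b"
  shows "\<exists>n::nat. c [^]\<^bsub>R\<^esub> n = \<zero>\<^bsub>R\<^esub>"
  using assms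
proof (induction "card (carrier R)" arbitrary: R a b c rule: less_induct)
  case less
  interpret ring R by (rule less.prems(1))
  note fin = less.prems(2) and nil = less.prems(3) and abc = less.prems(4-6)
  have cent: "f \<otimes>\<^bsub>R\<^esub> z = z \<otimes>\<^bsub>R\<^esub> f" if "f \<in> carrier R" "f \<otimes>\<^bsub>R\<^esub> f = f" "z \<in> carrier R" for f z
  proof (rule idempotent_central[OF _ that])
    fix y z assume "y \<in> carrier R" "y \<otimes>\<^bsub>R\<^esub> y = \<zero>\<^bsub>R\<^esub>" "z \<in> carrier R"
    then show "y \<otimes>\<^bsub>R\<^esub> z = z \<otimes>\<^bsub>R\<^esub> y"
      by (intro nil) (auto intro!: exI[of _ "2::nat"] simp: numeral_2_eq_2)
  qed
  show ?case
  proof (cases "\<exists>f\<in>carrier R. f \<otimes>\<^bsub>R\<^esub> f = f \<and> f \<noteq> \<zero>\<^bsub>R\<^esub> \<and> f \<noteq> \<one>\<^bsub>R\<^esub>")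
    case True
    \<comment> \<open>The condition that \<open>f\<close> is not 1 makes the corner strictly
      smaller. It is used for a nontrivial \<open>f\<close> and for \<open>1 - f\<close>, which add
      up to 1.\<close>
    have part: "\<exists>n::nat. f \<otimes>\<^bsub>R\<^esub> c [^]\<^bsub>R\<^esub> Suc n = \<zero>\<^bsub>R\<^esub>"
      if f: "f \<in> carrier R" "f \<otimes>\<^bsub>R\<^esub> f = f" "f \<noteq> \<one>\<^bsub>R\<^esub>" for f
    proof -
      note fc = f(1,2) cent[OF f(1,2)]
      let ?C = "corner f"
      have ff: "f \<otimes>\<^bsub>R\<^esub> (f \<otimes>\<^bsub>R\<^esub> x) = f \<otimes>\<^bsub>R\<^esub> x" if "x \<in> carrier R" for x
        using f that by (simp add: m_assoc[symmetric])
      have fxy: "(f \<otimes>\<^bsub>R\<^esub> x) \<otimes>\<^bsub>R\<^esub> (f \<otimes>\<^bsub>R\<^esub> y) = f \<otimes>\<^bsub>R\<^esub> (x \<otimes>\<^bsub>R\<^esub> y)"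
        if "x \<in> carrier R" "y \<in> carrier R" for x y
      proof -
        have "(f \<otimes>\<^bsub>R\<^esub> x) \<otimes>\<^bsub>R\<^esub> (f \<otimes>\<^bsub>R\<^esub> y) = f \<otimes>\<^bsub>R\<^esub> (x \<otimes>\<^bsub>R\<^esub> f) \<otimes>\<^bsub>R\<^esub> y"
          using that f by (simp add: m_assoc)
        also have "\<dots> = f \<otimes>\<^bsub>R\<^esub> (f \<otimes>\<^bsub>R\<^esub> x) \<otimes>\<^bsub>R\<^esub> y" by (simp only: fc(3)[OF that(1)])
        also have "\<dots> = f \<otimes>\<^bsub>R\<^esub> (f \<otimes>\<^bsub>R\<^esub> (x \<otimes>\<^bsub>R\<^esub> y))" using that f(1) by (simp add: m_assoc)
        finally show ?thesis using ff that by simp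
      qed
      have "\<one>\<^bsub>R\<^esub> \<notin> carrier ?C" using f by simp
      moreover have "carrier ?C \<subseteq> carrier R" by auto
      ultimately have smaller: "card (carrier ?C) < card (carrier R)"
        using fin by (metis one_closed psubset_card_mono psubsetI)
      have eq: "f \<otimes>\<^bsub>R\<^esub> c \<oplus>\<^bsub>R\<^esub> (f \<otimes>\<^bsub>R\<^esub> b) \<otimes>\<^bsub>R\<^esub> (f \<otimes>\<^bsub>R\<^esub> a) = (f \<otimes>\<^bsub>R\<^esub> a) \<otimes>\<^bsub>R\<^esub> (f \<otimes>\<^bsub>R\<^esub> b)"
        using fxy abc f(1) less.prems(7) by (simp add: r_distr[symmetric])
      have nilC: "y \<otimes>\<^bsub>R\<^esub> z = z \<otimes>\<^bsub>R\<^esub> y"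
        if "y \<in> carrier ?C" "\<exists>n::nat. y [^]\<^bsub>?C\<^esub> n = \<zero>\<^bsub>R\<^esub>" "z \<in> carrier ?C" for y z
        using that nil[of y z] corner_nilpotent_iff[OF fc, of y] by simp
      have "\<exists>n::nat. (f \<otimes>\<^bsub>R\<^esub> c) [^]\<^bsub>?C\<^esub> n = \<zero>\<^bsub>?C\<^esub>"
      proof (rule less.hyps[OF smaller ring_corner[OF fc]])
        fix y z assume "y \<in> carrier ?C" "\<exists>n::nat. y [^]\<^bsub>?C\<^esub> n = \<zero>\<^bsub>?C\<^esub>" "z \<in> carrier ?C"
        then show "y \<otimes>\<^bsub>?C\<^esub> z = z \<otimes>\<^bsub>?C\<^esub> y" using nilC[of y z] unfolding corner_simps by blast
      next
        show "f \<otimes>\<^bsub>R\<^esub> c \<oplus>\<^bsub>?C\<^esub> (f \<otimes>\<^bsub>R\<^esub> b) \<otimes>\<^bsub>?C\<^esub> (f \<otimes>\<^bsub>R\<^esub> a) = (f \<otimes>\<^bsub>R\<^esub> a) \<otimes>\<^bsub>?C\<^esub> (f \<otimes>\<^bsub>R\<^esub> b)"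
          using eq by simp
      qed (use fin f(1) abc ff in simp_all)
      then obtain n :: nat where "(f \<otimes>\<^bsub>R\<^esub> c) [^]\<^bsub>R\<^esub> n = \<zero>\<^bsub>R\<^esub>"
        using corner_nilpotent_iff[OF fc, of "f \<otimes>\<^bsub>R\<^esub> c"] ff f(1) abc by auto
      then have "(f \<otimes>\<^bsub>R\<^esub> c) [^]\<^bsub>R\<^esub> Suc n = \<zero>\<^bsub>R\<^esub>" using f(1) abc by simp
      then show ?thesis using pow_mult_idempotent[OF fc abc(3)] by metis
    qed
    from True obtain f where f: "f \<in> carrier R" "f \<otimes>\<^bsub>R\<^esub> f = f" "f \<noteq> \<zero>\<^bsub>R\<^esub>" "f \<noteq> \<one>\<^bsub>R\<^esub>" by blast
    define g where "g = \<one>\<^bsub>R\<^esub> \<ominus>\<^bsub>R\<^esub> f"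
    have g: "g \<in> carrier R" "g \<otimes>\<^bsub>R\<^esub> g = g" "g \<noteq> \<one>\<^bsub>R\<^esub>" "f \<oplus>\<^bsub>R\<^esub> g = \<one>\<^bsub>R\<^esub>"
    proof -
      show gc: "g \<in> carrier R" using f by (simp add: g_def)
      have "f \<otimes>\<^bsub>R\<^esub> g = \<zero>\<^bsub>R\<^esub>" using f by (simp add: g_def a_minus_def r_distr r_minus r_neg)
      then show "g \<otimes>\<^bsub>R\<^esub> g = g" using f gc
        by (subst (1) g_def) (simp add: a_minus_def l_distr l_minus)
      show fg: "f \<oplus>\<^bsub>R\<^esub> g = \<one>\<^bsub>R\<^esub>" 
        using f a_lcomm[of f "\<one>\<^bsub>R\<^esub>" "\<ominus>\<^bsub>R\<^esub> f"] by (simp add: g_def a_minus_def r_neg)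
      show "g \<noteq> \<one>\<^bsub>R\<^esub>" using \<open>f \<otimes>\<^bsub>R\<^esub> g = \<zero>\<^bsub>R\<^esub>\<close> f by auto
    qed
    obtain m n :: nat where mn: "f \<otimes>\<^bsub>R\<^esub> c [^]\<^bsub>R\<^esub> Suc m = \<zero>\<^bsub>R\<^esub>" "g \<otimes>\<^bsub>R\<^esub> c [^]\<^bsub>R\<^esub> Suc n = \<zero>\<^bsub>R\<^esub>"
      using part f g by metis
    define P where "P = c [^]\<^bsub>R\<^esub> (Suc m + Suc n)"
    have P: "P \<in> carrier R" "P = c [^]\<^bsub>R\<^esub> Suc m \<otimes>\<^bsub>R\<^esub> c [^]\<^bsub>R\<^esub> Suc n"
      "P = c [^]\<^bsub>R\<^esub> Suc n \<otimes>\<^bsub>R\<^esub> c [^]\<^bsub>R\<^esub> Suc m"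
      using abc by (simp_all only: P_def nat_pow_mult nat_pow_closed add.commute)
    have pc: "c [^]\<^bsub>R\<^esub> k \<in> carrier R" for k :: nat using abc by simp
    have "f \<otimes>\<^bsub>R\<^esub> P = (f \<otimes>\<^bsub>R\<^esub> c [^]\<^bsub>R\<^esub> Suc m) \<otimes>\<^bsub>R\<^esub> c [^]\<^bsub>R\<^esub> Suc n"
      unfolding P(2) by (rule m_assoc[symmetric]) (fact f pc)+
    moreover have "g \<otimes>\<^bsub>R\<^esub> P = (g \<otimes>\<^bsub>R\<^esub> c [^]\<^bsub>R\<^esub> Suc n) \<otimes>\<^bsub>R\<^esub> c [^]\<^bsub>R\<^esub> Suc m"
      unfolding P(3) by (rule m_assoc[symmetric]) (fact g pc)+
    ultimately have "(f \<oplus>\<^bsub>R\<^esub> g) \<otimes>\<^bsub>R\<^esub> P = \<zero>\<^bsub>R\<^esub>"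
      unfolding l_distr[OF f(1) g(1) P(1)] mn l_null[OF pc] by (metis l_zero zero_closed)
    then have "c [^]\<^bsub>R\<^esub> (Suc m + Suc n) = \<zero>\<^bsub>R\<^esub>" using g(4) P(1) by (simp add: P_def)
    then show ?thesis ..
  next
    case False
    show ?thesis
    proof (rule ccontr)
      assume nn: "\<nexists>n::nat. c [^]\<^bsub>R\<^esub> n = \<zero>\<^bsub>R\<^esub>"
      \<comment> \<open>Some power is idempotent, and only 0 and 1 are available.\<close>
      have dich: "\<exists>m::nat. m > 0 \<and> (x [^]\<^bsub>R\<^esub> m = \<zero>\<^bsub>R\<^esub> \<or> x [^]\<^bsub>R\<^esub> m = \<one>\<^bsub>R\<^esub>)" if "x \<in> carrier R" for x
        using finite_pow_idempotent[OF fin that] False that by blast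
      obtain k :: nat where k: "k > 0" "c [^]\<^bsub>R\<^esub> k = \<one>\<^bsub>R\<^esub>" using dich[OF abc(3)] nn by blast
      \<comment> \<open>A nilpotent \<open>y\<close> is central, so \<open>y a\<close> is nilpotent
        and central as well. Hence \<open>y a b = b y a = y b a\<close>, that is
        \<open>y c = 0\<close>, and \<open>c\<close> is invertible.\<close>
      have reduced: "y = \<zero>\<^bsub>R\<^esub>" if y: "y \<in> carrier R" "\<exists>n::nat. y [^]\<^bsub>R\<^esub> n = \<zero>\<^bsub>R\<^esub>" for y
      proof -
        have cy: "y \<otimes>\<^bsub>R\<^esub> z = z \<otimes>\<^bsub>R\<^esub> y" if "z \<in> carrier R" for z using nil[OF y that] .
        obtain n :: nat where "y [^]\<^bsub>R\<^esub> n = \<zero>\<^bsub>R\<^esub>" using y by blast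
        then have "(y \<otimes>\<^bsub>R\<^esub> a) [^]\<^bsub>R\<^esub> n = \<zero>\<^bsub>R\<^esub>"
          using pow_mult_distrib[OF cy[OF abc(1)] y(1) abc(1)] abc by simp
        then have ya: "(y \<otimes>\<^bsub>R\<^esub> a) \<otimes>\<^bsub>R\<^esub> b = b \<otimes>\<^bsub>R\<^esub> (y \<otimes>\<^bsub>R\<^esub> a)"
          using nil[of "y \<otimes>\<^bsub>R\<^esub> a" b] abc y by blast
        have "y \<otimes>\<^bsub>R\<^esub> c \<oplus>\<^bsub>R\<^esub> y \<otimes>\<^bsub>R\<^esub> (b \<otimes>\<^bsub>R\<^esub> a) = y \<otimes>\<^bsub>R\<^esub> (a \<otimes>\<^bsub>R\<^esub> b)"
          using abc y less.prems(7) by (simp add: r_distr[symmetric])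
        also have "\<dots> = (b \<otimes>\<^bsub>R\<^esub> y) \<otimes>\<^bsub>R\<^esub> a" using ya abc y by (simp add: m_assoc)
        also have "\<dots> = y \<otimes>\<^bsub>R\<^esub> (b \<otimes>\<^bsub>R\<^esub> a)" using cy[of b] abc y by (simp add: m_assoc[symmetric])
        finally have "y \<otimes>\<^bsub>R\<^esub> c = \<zero>\<^bsub>R\<^esub>"
          using abc y add.r_cancel_one[of "y \<otimes>\<^bsub>R\<^esub> (b \<otimes>\<^bsub>R\<^esub> a)" "y \<otimes>\<^bsub>R\<^esub> c"] by simp
        then have "(y \<otimes>\<^bsub>R\<^esub> c) \<otimes>\<^bsub>R\<^esub> c [^]\<^bsub>R\<^esub> (k - 1) = \<zero>\<^bsub>R\<^esub>" using abc by simp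
        then show ?thesis using periodic_inverse(2)[OF abc(3) k(2,1)] abc y by (simp add: m_assoc)
      qed
      have "\<exists>n::nat. n > 0 \<and> x [^]\<^bsub>R\<^esub> n = \<one>\<^bsub>R\<^esub>" if "x \<in> carrier R" "x \<noteq> \<zero>\<^bsub>R\<^esub>" for x
        using dich[OF that(1)] reduced[OF that(1)] that(2) by blast
      then have "a \<otimes>\<^bsub>R\<^esub> b = b \<otimes>\<^bsub>R\<^esub> a"
        using wedderburn_little[OF less.prems(1) fin _ abc(1,2)] by blast
      then have "c = \<zero>\<^bsub>R\<^esub>" using less.prems(7) abc add.r_cancel_one[of "b \<otimes>\<^bsub>R\<^esub> a" c] by simp
      then show False using nn by (metis nat_pow_Suc nat_pow_0 l_one zero_closed)
    qed
  qed
qed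

section \<open>FC-centers of unit groups\<close>

text \<open>The cofactor is the geometric sum, built by the recursion \<open>e' = t e + p^n\<close>.
  It works on both sides because \<open>t\<close> and \<open>p\<close> commute.\<close>

lemma (in ring) pow_diff_factor:
  assumes "t \<in> carrier R" "p \<in> carrier R" "t \<otimes> p = p \<otimes> t"
  shows "\<exists>e\<in>carrier R. (t \<ominus> p) \<otimes> e = t [^] (n::nat) \<ominus> p [^] n \<and> e \<otimes> (t \<ominus> p) = t [^] n \<ominus> p [^] n"
proof (induction n)
  case 0
  show ?case using assms by (intro bexI[of _ \<zero>]) (simp_all add: a_minus_def r_neg)
next
  case (Suc n)
  then obtain e where e: "e \<in> carrier R" "(t \<ominus> p) \<otimes> e = t [^] n \<ominus> p [^] n"
    "e \<otimes> (t \<ominus> p) = t [^] n \<ominus> p [^] n" by blast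
  define T where "T = t [^] n"
  define P where "P = p [^] n"
  have TP: "T \<in> carrier R" "P \<in> carrier R" using assms by (simp_all add: T_def P_def)
  have c: "P \<otimes> t = t \<otimes> P" "P \<otimes> p = p \<otimes> P" "T \<otimes> t = t \<otimes> T"
    using assms by (auto simp: P_def T_def intro: commutes_pow)
  have tp: "(t \<ominus> p) \<otimes> t = t \<otimes> (t \<ominus> p)" using assms by (simp add: a_minus_def l_distr r_distr l_minus r_minus)
  have tele: "t \<otimes> (T \<ominus> P) \<oplus> (t \<otimes> P \<ominus> p \<otimes> P) = t \<otimes> T \<ominus> p \<otimes> P"
  proof -
    have "t \<otimes> (T \<ominus> P) \<oplus> (t \<otimes> P \<ominus> p \<otimes> P) = t \<otimes> T \<oplus> (\<ominus> (t \<otimes> P) \<oplus> (t \<otimes> P \<oplus> \<ominus> (p \<otimes> P)))"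
      using assms TP by (simp add: a_minus_def r_distr r_minus a_assoc)
    then show ?thesis using assms TP by (simp add: a_minus_def r_neg1)
  qed
  have "(t \<ominus> p) \<otimes> (t \<otimes> e \<oplus> P) = (t \<ominus> p) \<otimes> t \<otimes> e \<oplus> (t \<ominus> p) \<otimes> P"
    using assms e TP by (simp add: r_distr m_assoc)
  also have "\<dots> = t \<otimes> ((t \<ominus> p) \<otimes> e) \<oplus> (t \<ominus> p) \<otimes> P" unfolding tp using assms e TP by (simp add: m_assoc)
  also have "\<dots> = t \<otimes> (T \<ominus> P) \<oplus> (t \<otimes> P \<ominus> p \<otimes> P)"
    unfolding e(2) using assms TP by (simp add: T_def[symmetric] P_def[symmetric] a_minus_def l_distr l_minus)
  finally have 1: "(t \<ominus> p) \<otimes> (t \<otimes> e \<oplus> P) = t [^] Suc n \<ominus> p [^] Suc n"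
    using tele c by (simp add: T_def P_def)
  have "(t \<otimes> e \<oplus> P) \<otimes> (t \<ominus> p) = t \<otimes> (e \<otimes> (t \<ominus> p)) \<oplus> (P \<otimes> t \<ominus> P \<otimes> p)"
    using assms e TP by (simp add: l_distr m_assoc) (simp add: a_minus_def r_distr r_minus)
  then have 2: "(t \<otimes> e \<oplus> P) \<otimes> (t \<ominus> p) = t [^] Suc n \<ominus> p [^] Suc n"
    unfolding e(3) c using tele c by (simp add: T_def P_def)
  show ?case using 1 2 assms e TP by (intro bexI[of _ "t \<otimes> e \<oplus> P"]) auto
qed

lemma (in monoid) Units_of_product_Units:
  assumes "a \<in> carrier G" "e \<in> carrier G" "a \<otimes> e \<in> Units G" "e \<otimes> a \<in> Units G"
  shows "a \<in> Units G"
proof -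
  define l where "l = inv (e \<otimes> a) \<otimes> e"
  define r where "r = e \<otimes> inv (a \<otimes> e)"
  have i: "inv (e \<otimes> a) \<in> carrier G" "inv (a \<otimes> e) \<in> carrier G" using assms(3,4) by simp_all
  have lr: "l \<in> carrier G" "r \<in> carrier G" using assms(2) i by (simp_all add: l_def r_def)
  have "l \<otimes> a = inv (e \<otimes> a) \<otimes> (e \<otimes> a)" using assms(1,2) i by (simp add: l_def m_assoc)
  then have l: "l \<otimes> a = \<one>" using assms(4) by simp
  have "a \<otimes> r = (a \<otimes> e) \<otimes> inv (a \<otimes> e)" using assms(1,2) i by (simp add: r_def m_assoc)
  then have r: "a \<otimes> r = \<one>" using assms(3) by simp
  have "l = l \<otimes> (a \<otimes> r)" using r lr by simp
  also have "\<dots> = (l \<otimes> a) \<otimes> r" using lr assms(1) by (simp add: m_assoc)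
  finally have "l = r" using l lr by simp
  then show ?thesis using l r lr assms(1) unfolding Units_def by blast
qed

text \<open>\<open>1 - (-q)\<close> divides \<open>1 - (-q)^n\<close>, which is 1.\<close>

lemma (in ring) one_plus_nilpotent_Units:
  assumes "q \<in> carrier R" "q [^] (n::nat) = \<zero>"
  shows "\<one> \<oplus> q \<in> Units R"
proof -
  have "(\<ominus> q) [^] k = q [^] k \<or> (\<ominus> q) [^] k = \<ominus> (q [^] k)" for k :: nat
    by (induction k) (use assms in \<open>auto simp: l_minus r_minus\<close>)
  from this[of n] have "(\<ominus> q) [^] n = \<zero>" using assms by auto
  then obtain e where "e \<in> carrier R" "(\<one> \<ominus> (\<ominus> q)) \<otimes> e = \<one>" "e \<otimes> (\<one> \<ominus> (\<ominus> q)) = \<one>"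
    using pow_diff_factor[of \<one> "\<ominus> q" n] assms by (auto simp: a_minus_def)
  then show ?thesis using assms unfolding Units_def by (auto simp: a_minus_def)
qed

lemma (in monoid) fc_center_units_iff:
  "x \<in> fc_center (units_of G) \<longleftrightarrow> x \<in> Units G \<and> finite ((\<lambda>g. g \<otimes> x \<otimes> inv g) ` Units G)"
proof -
  have "(\<lambda>g. g \<otimes> x \<otimes> inv\<^bsub>units_of G\<^esub> g) ` Units G = (\<lambda>g. g \<otimes> x \<otimes> inv g) ` Units G"
    by (intro image_cong) (auto simp: units_of_inv)
  then show ?thesis by (simp add: fc_center_def units_of_carrier units_of_mult)
qed

lemma (in monoid) fc_center_units_closed: "x \<in> fc_center (units_of G) \<Longrightarrow> x \<in> carrier G"
  by (auto simp: fc_center_units_iff)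

context ring
begin

text \<open>Two units \<open>t - a\<close> and \<open>t' - a\<close> that conjugate \<open>x\<close> to the same element \<open>x'\<close> satisfy
  \<open>(t - t')x = x'(t - t')\<close>, so that \<open>x' = x\<close> and \<open>a\<close> commutes with \<open>x\<close>.\<close>

lemma periodic_commutes_fc_center:
  assumes x: "x \<in> fc_center (units_of R)" and a: "a \<in> carrier R" "a [^] (n::nat) = \<one>"
    and T: "infinite T" "T \<subseteq> carrier R"
    and cent: "\<And>t z. t \<in> T \<Longrightarrow> z \<in> carrier R \<Longrightarrow> t \<otimes> z = z \<otimes> t"
    and diff: "\<And>t t'. t \<in> T \<Longrightarrow> t' \<in> T \<Longrightarrow> t \<noteq> t' \<Longrightarrow> t \<ominus> t' \<in> Units R"
    and pow: "\<And>t. t \<in> T \<Longrightarrow> t [^] n \<ominus> \<one> \<in> Units R"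
  shows "a \<otimes> x = x \<otimes> a"
proof -
  have xU: "x \<in> Units R" "finite ((\<lambda>g. g \<otimes> x \<otimes> inv g) ` Units R)"
    using x by (auto simp: fc_center_units_iff)
  have xc: "x \<in> carrier R" using xU by blast
  \<comment> \<open>\<open>t - a\<close> divides \<open>t^n - a^n = t^n - 1\<close> from both
    sides.\<close>
  have U: "t \<ominus> a \<in> Units R" if "t \<in> T" for t
  proof -
    have tc: "t \<in> carrier R" using T that by blast
    have "\<exists>e\<in>carrier R. (t \<ominus> a) \<otimes> e = t [^] n \<ominus> \<one> \<and> e \<otimes> (t \<ominus> a) = t [^] n \<ominus> \<one>"
      using pow_diff_factor[OF tc a(1) cent[OF that a(1)], of n] a(2) by simp
    then obtain e where e: "e \<in> carrier R" "(t \<ominus> a) \<otimes> e = t [^] n \<ominus> \<one>" "e \<otimes> (t \<ominus> a) = t [^] n \<ominus> \<one>"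
      by blast
    show ?thesis
      by (rule Units_of_product_Units[OF _ e(1)]) (use tc a e pow[OF that] in simp_all)
  qed
  let ?f = "\<lambda>t. (t \<ominus> a) \<otimes> x \<otimes> inv (t \<ominus> a)"
  have "finite (?f ` T)" 
  proof (rule finite_subset[OF _ xU(2)])
    show "?f ` T \<subseteq> (\<lambda>g. g \<otimes> x \<otimes> inv g) ` Units R" using U by (intro image_subsetI imageI)
  qed
  then have "\<not> inj_on ?f T" using T(1) finite_imageD[of ?f T] by blast
  then obtain t t' where t: "t \<in> T" "t' \<in> T" "t \<noteq> t'" "?f t = ?f t'" unfolding inj_on_def by blast
  define x' where "x' = ?f t"
  have tc: "t \<in> carrier R" "t' \<in> carrier R" using t T by auto
  have "inv (t \<ominus> a) \<in> carrier R" using U[OF t(1)] by (rule Units_inv_closed)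
  then have x'c: "x' \<in> carrier R" using tc(1) a(1) xc by (simp add: x'_def)
  have rel: "(u \<ominus> a) \<otimes> x = x' \<otimes> (u \<ominus> a)" if "u = t \<or> u = t'" for u
  proof -
    have u: "u \<ominus> a \<in> Units R" "x' = ?f u" using U t that by (auto simp: x'_def)
    then show ?thesis using xc Units_closed[OF u(1)] Units_inv_closed[OF u(1)] by (simp add: m_assoc)
  qed
  define d where "d = t \<ominus> t'"
  have d: "d \<in> Units R" "d \<in> carrier R" using diff[OF t(1-3)] by (auto simp: d_def)
  have dx: "d = (t \<ominus> a) \<ominus> (t' \<ominus> a)"
  proof -
    have "(t \<ominus> a) \<ominus> (t' \<ominus> a) = t \<oplus> (\<ominus> a \<oplus> (a \<oplus> \<ominus> t'))"
      using tc a by (simp add: a_minus_def minus_add a_assoc a_comm[of "\<ominus> t'" a])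
    then show ?thesis using tc a by (simp add: d_def a_minus_def r_neg1)
  qed
  define p where "p = t \<ominus> a"
  define q where "q = t' \<ominus> a"
  have pq: "p \<in> carrier R" "q \<in> carrier R" "d = p \<ominus> q" "p \<otimes> x = x' \<otimes> p" "q \<otimes> x = x' \<otimes> q"
    using tc a dx rel by (auto simp: p_def q_def)
  have "d \<otimes> x = p \<otimes> x \<ominus> q \<otimes> x"
    using pq(1-3) xc by (simp add: a_minus_def l_distr l_minus)
  also have "\<dots> = x' \<otimes> d"
    using pq x'c by (simp add: a_minus_def r_distr r_minus)
  also have "\<dots> = d \<otimes> x'"
    using cent[OF t(1) x'c] cent[OF t(2) x'c] tc x'c
    by (simp add: d_def a_minus_def l_distr r_distr l_minus r_minus)
  finally have "x = x'" using Units_l_cancel[OF d(1)] xc x'c by simp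
  then have "(t \<ominus> a) \<otimes> x = x \<otimes> (t \<ominus> a)" using rel by simp
  then have "t \<otimes> x \<ominus> a \<otimes> x = t \<otimes> x \<ominus> x \<otimes> a"
    using cent[OF t(1) xc] tc a xc by (simp add: a_minus_def l_distr r_distr l_minus r_minus)
  then have "\<ominus> (a \<otimes> x) = \<ominus> (x \<otimes> a)" using tc a xc by (simp add: a_minus_def)
  then show ?thesis using a xc by (metis m_closed minus_minus)
qed

text \<open>Conjugating the finite set \<open>S\<close> by elements of \<open>V\<close> produces
  only finitely many tuples, so infinitely many \<open>v\<close> act like one \<open>v0\<close>. The
  quotients \<open>v0^-1 v\<close> centralize \<open>S\<close>; multiplication by the unit
  \<open>v0^-1\<close> preserves the finiteness condition.\<close>

lemma infinite_commuting_units: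
  assumes S: "finite S" "S \<subseteq> fc_center (units_of R)"
    and V: "infinite V" "V \<subseteq> Units R"
    and sep: "\<And>z v. z \<in> carrier R \<Longrightarrow> z \<noteq> \<zero> \<Longrightarrow> v \<in> V \<Longrightarrow> finite {w \<in> V. w \<otimes> z = v \<otimes> z}"
  shows "\<exists>W. infinite W \<and> W \<subseteq> Units R \<and> (\<forall>w\<in>W. \<forall>s\<in>S. w \<otimes> s = s \<otimes> w) \<and>
    (\<forall>z\<in>carrier R. \<forall>v\<in>W. z \<noteq> \<zero> \<longrightarrow> finite {w \<in> W. w \<otimes> z = v \<otimes> z})"
proof -
  let ?c = "\<lambda>s. (\<lambda>g. g \<otimes> s \<otimes> inv g) ` Units R"
  let ?f = "\<lambda>v. \<lambda>s\<in>S. v \<otimes> s \<otimes> inv v"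
  have Sc: "s \<in> carrier R" if "s \<in> S" for s using S that fc_center_units_closed by blast
  have "finite (PiE S ?c)" using S by (intro finite_PiE) (auto simp: fc_center_units_iff)
  moreover have "?f ` V \<subseteq> PiE S ?c" using V by auto
  ultimately have "finite (?f ` V)" by (rule finite_subset[rotated])
  then obtain v0 where v0: "v0 \<in> V" and inf: "infinite {v \<in> V. ?f v = ?f v0}"
    using pigeonhole_infinite[OF V(1)] by blast
  define V1 where "V1 = {v \<in> V. ?f v = ?f v0}"
  define i0 where "i0 = inv v0"
  have v0U: "v0 \<in> Units R" using v0 V by blast
  have i0: "i0 \<in> Units R" "i0 \<in> carrier R" "v0 \<otimes> i0 = \<one>" "i0 \<otimes> v0 = \<one>" "v0 \<in> carrier R"
    using v0U by (auto simp: i0_def)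
  have V1U: "v \<in> Units R" "v \<in> carrier R" if "v \<in> V1" for v using V that by (auto simp: V1_def)
  show ?thesis
  proof (intro exI[of _ "(\<lambda>v. i0 \<otimes> v) ` V1"] conjI ballI impI)
    have inj: "inj_on (\<lambda>v. i0 \<otimes> v) V1"
      by (rule inj_onI) (use Units_l_cancel[OF i0(1)] V1U(2) in auto)
    then show "infinite ((\<lambda>v. i0 \<otimes> v) ` V1)" using inf finite_imageD by (auto simp: V1_def)
    show "(\<lambda>v. i0 \<otimes> v) ` V1 \<subseteq> Units R" using V1U i0 by auto
  next
    fix w s assume "w \<in> (\<lambda>v. i0 \<otimes> v) ` V1" and s: "s \<in> S"
    then obtain v where v: "v \<in> V1" "w = i0 \<otimes> v" by blast
    have sc: "s \<in> carrier R" using Sc s .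
    have "?f v s = ?f v0 s" using v by (simp add: V1_def)
    then have "v \<otimes> s \<otimes> inv v = v0 \<otimes> s \<otimes> i0" using s by (simp add: i0_def)
    then have "i0 \<otimes> (v \<otimes> s \<otimes> inv v) \<otimes> v = i0 \<otimes> (v0 \<otimes> s \<otimes> i0) \<otimes> v" by simp
    moreover have "i0 \<otimes> (v \<otimes> s \<otimes> inv v) \<otimes> v = w \<otimes> s"
      using V1U[OF v(1)] i0 sc by (simp add: v(2) m_assoc)
    moreover have "i0 \<otimes> (v0 \<otimes> s \<otimes> i0) \<otimes> v = (i0 \<otimes> v0) \<otimes> s \<otimes> w"
      using V1U[OF v(1)] i0(2,5) sc by (simp add: v(2) m_assoc)
    ultimately show "w \<otimes> s = s \<otimes> w" using i0 sc by simp
  next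
    fix z v assume z: "z \<in> carrier R" and "v \<in> (\<lambda>v. i0 \<otimes> v) ` V1" and z0: "z \<noteq> \<zero>"
    then obtain u where u: "u \<in> V1" "v = i0 \<otimes> u" by blast
    have "w \<otimes> z = u \<otimes> z" if "w \<in> V1" "(i0 \<otimes> w) \<otimes> z = v \<otimes> z" for w
      using that u V1U i0 z Units_l_cancel[OF i0(1), of "w \<otimes> z" "u \<otimes> z"] by (simp add: m_assoc)
    then have "{w \<in> (\<lambda>v. i0 \<otimes> v) ` V1. w \<otimes> z = v \<otimes> z} \<subseteq> (\<lambda>v. i0 \<otimes> v) ` {w \<in> V. w \<otimes> z = u \<otimes> z}"
      by (auto simp: V1_def)
    moreover have "finite {w \<in> V. w \<otimes> z = u \<otimes> z}" using sep[OF z z0] u by (auto simp: V1_def)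
    ultimately show "finite {w \<in> (\<lambda>v. i0 \<otimes> v) ` V1. w \<otimes> z = v \<otimes> z}" by (meson finite_imageI finite_subset)
  qed
qed

text \<open>For units \<open>v\<close>, \<open>w\<close> that commute with \<open>x\<close> and \<open>y\<close>, and such that \<open>1 + vy\<close> and \<open>1 + wy\<close>
  conjugate \<open>x\<close> to the same element, \<open>x\<close> commutes with \<open>(1 - vy)(1 + wy)\<close>, hence with
  \<open>(w - v)y\<close>. The quadratic terms are harmless by induction on the nilpotency index.\<close>

lemma nilpotent_commutes_fc_center:
  assumes x: "x \<in> fc_center (units_of R)"
    and S: "finite S" "S \<subseteq> fc_center (units_of R)"
    and V: "infinite V" "V \<subseteq> Units R"
    and sep: "\<And>z v. z \<in> carrier R \<Longrightarrow> z \<noteq> \<zero> \<Longrightarrow> v \<in> V \<Longrightarrow> finite {w \<in> V. w \<otimes> z = v \<otimes> z}"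
    and y: "y \<in> carrier R" "y [^] (n::nat) = \<zero>"
    and CC: "\<And>t. t \<in> carrier R \<Longrightarrow> (\<And>s. s \<in> S \<Longrightarrow> t \<otimes> s = s \<otimes> t) \<Longrightarrow> t \<otimes> y = y \<otimes> t"
  shows "y \<otimes> x = x \<otimes> y"
proof -
  have xU: "x \<in> Units R" "finite ((\<lambda>g. g \<otimes> x \<otimes> inv g) ` Units R)"
    using x by (auto simp: fc_center_units_iff)
  have xc: "x \<in> carrier R" using xU by blast
  have S': "finite (insert x S)" "insert x S \<subseteq> fc_center (units_of R)" using S x by auto
  have "\<exists>W. infinite W \<and> W \<subseteq> Units R \<and> (\<forall>w\<in>W. \<forall>s\<in>insert x S. w \<otimes> s = s \<otimes> w) \<and>
      (\<forall>z\<in>carrier R. \<forall>v\<in>W. z \<noteq> \<zero> \<longrightarrow> finite {w \<in> W. w \<otimes> z = v \<otimes> z})"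
    by (rule infinite_commuting_units[OF S' V]) (rule sep)
  then obtain W where W: "infinite W" "W \<subseteq> Units R" "\<And>w s. w \<in> W \<Longrightarrow> s \<in> insert x S \<Longrightarrow> w \<otimes> s = s \<otimes> w"
    "\<And>z v. z \<in> carrier R \<Longrightarrow> z \<noteq> \<zero> \<Longrightarrow> v \<in> W \<Longrightarrow> finite {w \<in> W. w \<otimes> z = v \<otimes> z}"
    by blast
  have Wc: "w \<in> carrier R" if "w \<in> W" for w using W(2) that by blast
  show ?thesis using y CC
  proof (induction n arbitrary: y rule: less_induct)
    case (less n)
    note y = less.prems(1,2) and CCy = less.prems(3)
    \<comment> \<open>The members of \<open>W\<close> centralize \<open>S\<close>, and whatever
      centralizes \<open>S\<close> commutes with \<open>y\<close>.\<close>
    have Wy: "w \<otimes> y = y \<otimes> w" if "w \<in> W" for w using CCy[OF Wc[OF that]] W(3)[OF that] by simp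
    show ?case
    proof (cases "n \<le> 1")
      case True
      have "y = \<zero>"
      proof (cases n)
        case 0
        then have "y \<otimes> \<one> = y \<otimes> \<zero>" using y by simp
        then show ?thesis using y by simp
      next
        case (Suc m)
        then show ?thesis using True y by simp
      qed
      then show ?thesis using xc by simp
    next
      case False
      \<comment> \<open>The square vanishes at exponent \<open>n / 2\<close> rounded up, which is
        below \<open>n\<close> once \<open>n \<ge> 2\<close>. It also commutes with everything that
        centralizes \<open>S\<close>, so the induction hypothesis applies to it.\<close>
      define yy where "yy = y \<otimes> y"
      have yyc: "yy \<in> carrier R" using y by (simp add: yy_def)
      have yyx: "yy \<otimes> x = x \<otimes> yy"
      proof (rule less.IH)
        show "(n + 1) div 2 < n" using False by auto
        have "yy [^] ((n + 1) div 2) = y [^] (2 * ((n + 1) div 2))"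
          using y nat_pow_pow[of y 2 "(n + 1) div 2"] by (simp add: yy_def numeral_2_eq_2)
        also have "\<dots> = y [^] n \<otimes> y [^] (2 * ((n + 1) div 2) - n)"
          using y(1) by (subst nat_pow_mult) auto
        finally show "yy [^] ((n + 1) div 2) = \<zero>" using y by simp
        show "yy \<in> carrier R" by (rule yyc)
        fix t assume t: "t \<in> carrier R" "\<And>s. s \<in> S \<Longrightarrow> t \<otimes> s = s \<otimes> t"
        show "t \<otimes> yy = yy \<otimes> t" unfolding yy_def
          using CCy[OF t] t(1) y(1) by (intro commutes_mult[symmetric]) auto
      qed
      define C where "C = centralizer x"
      have C: "subring C R" unfolding C_def by (rule subring_centralizer[OF xc])
      have CI: "z \<in> C" if "z \<in> carrier R" "z \<otimes> x = x \<otimes> z" for z using that by (simp add: C_def centralizer_def)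
      have wC: "w \<in> C" if "w \<in> W" for w using CI[OF Wc[OF that]] W(3)[OF that, of x] by simp
      have U: "\<one> \<oplus> w \<otimes> y \<in> Units R" if "w \<in> W" for w
      proof -
        have "(w \<otimes> y) [^] n = \<zero>" using pow_mult_distrib[OF Wy[OF that] Wc[OF that] y(1)] Wc[OF that] y by simp
        then show ?thesis using one_plus_nilpotent_Units Wc[OF that] y by blast
      qed
      let ?f = "\<lambda>w. (\<one> \<oplus> w \<otimes> y) \<otimes> x \<otimes> inv (\<one> \<oplus> w \<otimes> y)"
      have "finite (?f ` W)" 
      proof (rule finite_subset[OF _ xU(2)])
        show "?f ` W \<subseteq> (\<lambda>g. g \<otimes> x \<otimes> inv g) ` Units R" using U by (intro image_subsetI imageI)
      qed
      then obtain w where w: "w \<in> W" and inf: "infinite {v \<in> W. ?f v = ?f w}"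
        using pigeonhole_infinite[OF W(1)] by blast
      define z where "z = y \<otimes> x \<ominus> x \<otimes> y"
      have zc: "z \<in> carrier R" using y xc by (simp add: z_def)
      have "v \<otimes> z = w \<otimes> z" if v: "v \<in> W" and eq: "?f v = ?f w" for v
      proof -
        have vw: "v \<in> carrier R" "w \<in> carrier R" using Wc v w by auto
        define b where "b = \<one> \<oplus> v \<otimes> y"
        define a where "a = \<one> \<oplus> w \<otimes> y"
        \<comment> \<open>\<open>m\<close> replaces the inverse of \<open>b\<close>: the product
          \<open>m b = 1 - v^2 y^2\<close> already centralizes \<open>x\<close>. So does
          \<open>q\<close>, because \<open>a\<close> and \<open>b\<close> conjugate \<open>x\<close>
          to the same element. Therefore \<open>m a = (m b) q\<close> centralizes \<open>x\<close>,
          and its only term not yet known to do so is \<open>(w - v) y\<close>.\<close>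
        define m where "m = \<one> \<ominus> v \<otimes> y"
        define q where "q = inv b \<otimes> a"
        have bU: "b \<in> Units R" "a \<in> Units R" using U v w by (auto simp: a_def b_def)
        have abm: "a \<in> carrier R" "b \<in> carrier R" "m \<in> carrier R" "inv b \<in> carrier R" "inv a \<in> carrier R"
          using bU vw y by (auto simp: m_def)
        have qc: "q \<in> carrier R" using abm by (simp add: q_def)
        have "q \<otimes> x = inv b \<otimes> (a \<otimes> x \<otimes> inv a) \<otimes> a"
          using abm bU xc by (simp add: q_def m_assoc)
        also have "a \<otimes> x \<otimes> inv a = b \<otimes> x \<otimes> inv b" using eq by (simp add: a_def b_def)
        also have "inv b \<otimes> (b \<otimes> x \<otimes> inv b) \<otimes> a = (inv b \<otimes> b) \<otimes> x \<otimes> q"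
          using abm xc by (simp add: q_def m_assoc)
        finally have qC: "q \<in> C" using qc bU xc by (intro CI) simp_all
        have vyvy: "(v \<otimes> y) \<otimes> (v' \<otimes> y) = v \<otimes> v' \<otimes> yy" if "v' \<in> W" for v'
        proof -
          have "(v \<otimes> y) \<otimes> (v' \<otimes> y) = v \<otimes> (y \<otimes> v') \<otimes> y" using vw y(1) Wc[OF that] by (simp add: m_assoc)
          then show ?thesis unfolding Wy[OF that, symmetric] using vw y(1) Wc[OF that] by (simp add: yy_def m_assoc)
        qed
        have prodC: "v \<otimes> v' \<otimes> yy \<in> C" if "v' \<in> W" for v'
          using subringE(6)[OF C] wC v that CI[OF yyc yyx] by blast
        have mb: "m \<otimes> b = \<one> \<ominus> v \<otimes> v \<otimes> yy"
        proof -
          have "m \<otimes> b = (\<one> \<oplus> v \<otimes> y) \<oplus> \<ominus> (v \<otimes> y \<oplus> (v \<otimes> y) \<otimes> (v \<otimes> y))"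
            unfolding m_def b_def using vw y(1) by (simp add: a_minus_def l_distr r_distr l_minus minus_add a_ac)
          also have "\<dots> = \<one> \<ominus> (v \<otimes> y) \<otimes> (v \<otimes> y)"
            using vw y(1) by (simp add: a_minus_def minus_add a_assoc r_neg1 r_neg2)
          finally show ?thesis using vyvy[OF v] by simp
        qed
        have "m \<otimes> a = (m \<otimes> b) \<otimes> q" using abm bU by (simp add: q_def m_assoc) (simp add: m_assoc[symmetric])
        moreover have "m \<otimes> b \<in> C"
          unfolding mb a_minus_def using subringE(3,5,7)[OF C] prodC[OF v] by blast
        ultimately have maC: "m \<otimes> a \<in> C" using subringE(6)[OF C] qC by simp
        define d where "d = w \<otimes> y \<ominus> v \<otimes> y"
        have dc: "d \<in> carrier R" using vw y by (simp add: d_def)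
        have ma: "m \<otimes> a = \<one> \<oplus> d \<ominus> v \<otimes> w \<otimes> yy"
        proof -
          have "m \<otimes> a = (\<one> \<oplus> w \<otimes> y) \<oplus> \<ominus> (v \<otimes> y \<oplus> (v \<otimes> y) \<otimes> (w \<otimes> y))"
            unfolding m_def a_def using vw y(1) by (simp add: a_minus_def l_distr r_distr l_minus minus_add a_ac)
          also have "\<dots> = \<one> \<oplus> d \<ominus> (v \<otimes> y) \<otimes> (w \<otimes> y)"
            using vw y(1) by (simp add: d_def a_minus_def minus_add a_assoc)
          finally show ?thesis using vyvy[OF w] by simp
        qed
        have "d = (\<ominus> \<one>) \<oplus> (m \<otimes> a \<oplus> v \<otimes> w \<otimes> yy)"
          unfolding ma using vw yyc dc by (simp add: a_minus_def a_assoc l_neg r_neg1)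
        then have "d \<in> C" using subringE(3,5,7)[OF C] maC prodC[OF w] by simp
        then have "d \<otimes> x = x \<otimes> d" unfolding C_def by (rule centralizerD)
        then have "w \<otimes> (y \<otimes> x) \<ominus> v \<otimes> (y \<otimes> x) = x \<otimes> w \<otimes> y \<ominus> x \<otimes> v \<otimes> y"
          using vw y(1) xc by (simp add: d_def a_minus_def l_distr r_distr l_minus r_minus m_assoc)
        also have "\<dots> = w \<otimes> (x \<otimes> y) \<ominus> v \<otimes> (x \<otimes> y)"
          using W(3)[OF v, of x] W(3)[OF w, of x] vw y(1) xc by (simp add: m_assoc[symmetric])
        finally have e: "w \<otimes> (y \<otimes> x) \<ominus> v \<otimes> (y \<otimes> x) = w \<otimes> (x \<otimes> y) \<ominus> v \<otimes> (x \<otimes> y)" .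
        have comb: "v \<otimes> (y \<otimes> x) \<ominus> v \<otimes> (x \<otimes> y) = w \<otimes> (y \<otimes> x) \<ominus> w \<otimes> (x \<otimes> y)"
        proof -
          define p1 where "p1 = w \<otimes> (y \<otimes> x)"
          define p2 where "p2 = v \<otimes> (y \<otimes> x)"
          define p3 where "p3 = w \<otimes> (x \<otimes> y)"
          define p4 where "p4 = v \<otimes> (x \<otimes> y)"
          have pc: "p1 \<in> carrier R" "p2 \<in> carrier R" "p3 \<in> carrier R" "p4 \<in> carrier R"
            using vw y(1) xc by (simp_all add: p1_def p2_def p3_def p4_def)
          have "p1 \<ominus> p2 = p3 \<ominus> p4" using e by (simp add: p1_def p2_def p3_def p4_def)
          then have "(p1 \<ominus> p2) \<oplus> (p2 \<ominus> p3) = (p3 \<ominus> p4) \<oplus> (p2 \<ominus> p3)" by simp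
          moreover have "(p1 \<ominus> p2) \<oplus> (p2 \<ominus> p3) = p1 \<ominus> p3" using pc by (simp add: a_minus_def a_assoc r_neg1)
          moreover have "(p3 \<ominus> p4) \<oplus> (p2 \<ominus> p3) = p2 \<ominus> p4" using pc
            by (simp add: a_minus_def a_assoc a_lcomm a_comm r_neg2 r_neg1 r_neg)
          ultimately show ?thesis by (simp add: p1_def p2_def p3_def p4_def)
        qed
        then show ?thesis using vw y(1) xc by (simp add: z_def a_minus_def r_distr r_minus)
      qed
      \<comment> \<open>Infinitely many \<open>v\<close> have the same product with
        \<open>z\<close>, which is possible only for \<open>z = 0\<close>.\<close>
      then have "{v \<in> W. ?f v = ?f w} \<subseteq> {v \<in> W. v \<otimes> z = w \<otimes> z}" by blast
      then have "infinite {v \<in> W. v \<otimes> z = w \<otimes> z}" using inf finite_subset by blast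
      then have "z = \<zero>" using W(4)[OF zc _ w] by blast
      then show ?thesis using y xc by (simp add: z_def)
    qed
  qed
qed

text \<open>Closure under products takes two passes, each an additive induction in one factor:
  \<open>left\<close> lets an element of \<open>H\<close> act on the span, and \<open>right\<close>
  then treats an arbitrary right factor from the span.\<close>

lemma generate_add_mult_closed:
  assumes H: "H \<subseteq> carrier R" "\<And>g h. g \<in> H \<Longrightarrow> h \<in> H \<Longrightarrow> g \<otimes> h \<in> H" "\<one> \<in> H"
  shows "subring (generate (add_monoid R) H) R"
proof -
  define B where "B = generate (add_monoid R) H"
  have sub: "subgroup B (add_monoid R)" unfolding B_def using H(1) by (intro group.generate_is_subgroup[OF a_group]) simp
  have BC: "B \<subseteq> carrier R" using subgroup.subset[OF sub] by simp
  have HB: "H \<subseteq> B" unfolding B_def by (auto intro: generate.incl)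
  have add: "x \<oplus> y \<in> B" if "x \<in> B" "y \<in> B" for x y
    using subgroup.m_closed[OF sub that] by simp
  have minus: "\<ominus> x \<in> B" if "x \<in> B" for x
    using subgroup.m_inv_closed[OF sub that] by (simp add: a_inv_def)
  have zero: "\<zero> \<in> B" using subgroup.one_closed[OF sub] by simp
  have left: "B \<subseteq> {b \<in> carrier R. h \<otimes> b \<in> B}" if h: "h \<in> H" for h
    unfolding B_def
  proof (rule group.generate_subgroup_incl[OF a_group])
    have hc: "h \<in> carrier R" using h H by blast
    show "H \<subseteq> {b \<in> carrier R. h \<otimes> b \<in> generate (add_monoid R) H}"
      using H HB h unfolding B_def by blast
    show "subgroup {b \<in> carrier R. h \<otimes> b \<in> generate (add_monoid R) H} (add_monoid R)"
      unfolding B_def[symmetric]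
      by (rule add.subgroupI) (use hc add minus zero in \<open>auto simp: r_distr r_minus intro!: exI[of _ \<zero>]\<close>)
  qed
  have right: "B \<subseteq> {b \<in> carrier R. b \<otimes> c \<in> B}" if c: "c \<in> B" for c
  proof -
    have cc: "c \<in> carrier R" using c BC by blast
    have "H \<subseteq> {b \<in> carrier R. b \<otimes> c \<in> B}" using left c H(1) by blast
    moreover have "subgroup {b \<in> carrier R. b \<otimes> c \<in> B} (add_monoid R)"
      by (rule add.subgroupI) (use cc add minus zero in \<open>auto simp: l_distr l_minus intro!: exI[of _ \<zero>]\<close>)
    ultimately show ?thesis unfolding B_def by (rule group.generate_subgroup_incl[OF a_group])
  qed
  show ?thesis unfolding B_def[symmetric]
    by (rule subringI) (use BC HB H(3) add minus right in blast)+
qed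

text \<open>Dietzmann's lemma for the additive group, where conjugation is trivial and every element
  is annihilated by \<open>k\<close>.\<close>

lemma finite_generate_add:
  assumes H: "finite H" "H \<subseteq> carrier R" and k: "k > 0" "add_pow R (k::nat) \<one> = \<zero>"
  shows "finite (generate (add_monoid R) H)"
proof -
  show ?thesis
  proof (rule group.dietzmann[OF a_group])
    show "finite H" "H \<subseteq> carrier (add_monoid R)" using H by auto
  next
    fix x y assume "x \<in> H" "y \<in> H"
    moreover from this have "x \<in> carrier R" "y \<in> carrier R" using H(2) by auto
    then have "\<ominus> x \<oplus> y \<oplus> x = y" by (simp add: a_assoc a_comm[of y x] r_neg2)
    ultimately show "inv\<^bsub>add_monoid R\<^esub> x \<otimes>\<^bsub>add_monoid R\<^esub> y \<otimes>\<^bsub>add_monoid R\<^esub> x \<in> H"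
      by (simp add: a_inv_def)
  next
    fix x assume "x \<in> H"
    then have "x \<in> carrier R" using H by blast
    then have "add_pow R k x = \<zero>" using add_pow_ldistr[of \<one> x k] k by simp
    then show "\<exists>n::nat. n > 0 \<and> x [^]\<^bsub>add_monoid R\<^esub> n = \<one>\<^bsub>add_monoid R\<^esub>"
      using k by (auto simp: add_pow_def)
  qed
qed

text \<open>The set \<open>V\<close> abstracts from the basis elements \<open>u_g\<close>: all that
  matters is that they are infinitely many units of which only finitely many agree on a nonzero
  element.\<close>

lemma torsion_commutator_commutes:
  assumes k: "k > 0" "add_pow R (k::nat) \<one> = \<zero>"
    and V: "infinite V" "V \<subseteq> Units R"
    and sep: "\<And>z v. z \<in> carrier R \<Longrightarrow> z \<noteq> \<zero> \<Longrightarrow> v \<in> V \<Longrightarrow> finite {w \<in> V. w \<otimes> z = v \<otimes> z}"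
    and a: "a \<in> torsion_elements (units_of R) (fc_center (units_of R))"
    and b: "b \<in> torsion_elements (units_of R) (fc_center (units_of R))"
    and x: "x \<in> fc_center (units_of R)"
  shows "(a \<otimes> b \<otimes> inv a \<otimes> inv b) \<otimes> x = x \<otimes> (a \<otimes> b \<otimes> inv a \<otimes> inv b)"
proof -
  let ?U = "units_of R"
  interpret U: group ?U by (rule units_group)
  obtain S where S: "finite S" "S \<subseteq> fc_center ?U" "a \<in> S" "b \<in> S" "finite (generate ?U S)"
    by (rule U.finite_torsion_normal_closure[OF a b])
  have SU: "S \<subseteq> Units R" using S(2) by (auto simp: fc_center_units_iff)
  define H where "H = generate ?U S"
  have subH: "subgroup H ?U" unfolding H_def
    using SU by (intro U.generate_is_subgroup) (simp add: units_of_carrier)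
  have HU: "H \<subseteq> Units R" using subgroup.subset[OF subH] by (simp add: units_of_carrier)
  have HC: "H \<subseteq> carrier R" using HU Units_closed by blast
  have H: "g \<otimes> h \<in> H" "inv g \<in> H" if "g \<in> H" "h \<in> H" for g h
    using subgroup.m_closed[OF subH that] subgroup.m_inv_closed[OF subH that(1)] HU that
    by (auto simp: units_of_mult units_of_inv)
  have H1: "\<one> \<in> H" using subgroup.one_closed[OF subH] by (simp add: units_of_one)
  have abH: "a \<in> H" "b \<in> H" using S by (auto simp: H_def intro: generate.incl)
  define B where "B = generate (add_monoid R) H"
  have subB: "subring B R" unfolding B_def using HC H H1 by (intro generate_add_mult_closed)
  note B = subringE[OF subB]
  have finB: "finite B" unfolding B_def using S(5) HC k by (intro finite_generate_add) (simp_all add: H_def)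
  have HB: "H \<subseteq> B" unfolding B_def by (auto intro: generate.incl)
  \<comment> \<open>Centralizing \<open>S\<close> means centralizing the group \<open>H\<close> that
    it generates, and then the additive span \<open>B\<close> of \<open>H\<close>.\<close>
  have CC: "t \<otimes> z = z \<otimes> t" if t: "t \<in> carrier R" "\<And>s. s \<in> S \<Longrightarrow> t \<otimes> s = s \<otimes> t" and z: "z \<in> B" for t z
  proof -
    have Sc: "s \<in> centralizer t" if "s \<in> S" for s
      using t(2)[OF that] SU that by (auto simp: centralizer_def)
    have "h \<in> centralizer t" if "h \<in> generate ?U S" for h
      using that
    proof (induction rule: generate.induct)
      case one then show ?case using t by (simp add: centralizer_def units_of_one)
    next
      case (incl s) then show ?case by (rule Sc)
    next
      case (inv s)
      then have s: "s \<in> Units R" "s \<otimes> t = t \<otimes> s" using SU Sc centralizerD by blast+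
      then have i: "inv s \<in> carrier R" "s \<in> carrier R" by auto
      have "inv s \<otimes> (s \<otimes> t) \<otimes> inv s = inv s \<otimes> (t \<otimes> s) \<otimes> inv s" using s by simp
      moreover have "inv s \<otimes> (s \<otimes> t) \<otimes> inv s = t \<otimes> inv s"
        using s(1) i t(1) by (simp add: m_assoc[symmetric])
      moreover have "inv s \<otimes> (t \<otimes> s) \<otimes> inv s = inv s \<otimes> t"
        using s(1) i t(1) by (simp add: m_assoc)
      ultimately show ?case using i s(1) by (simp add: centralizer_def units_of_inv)
    next
      case (eng g h)
      then show ?case using subringE(6)[OF subring_centralizer[OF t(1)]] by (simp add: units_of_mult)
    qed
    then have "H \<subseteq> centralizer t" by (auto simp: H_def)
    moreover have "subgroup (centralizer t) (add_monoid R)"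
      using subring_centralizer[OF t(1)] by (simp add: subring_def)
    ultimately have "B \<subseteq> centralizer t"
      unfolding B_def by (intro group.generate_subgroup_incl[OF a_group])
    then show ?thesis using z centralizerD(2)[of z t] by auto
  qed
  have nilFC: "y \<otimes> x' = x' \<otimes> y" if "y \<in> B" "y [^] (n::nat) = \<zero>" "x' \<in> fc_center ?U" for y n x'
  proof (rule nilpotent_commutes_fc_center[OF that(3) S(1,2) V])
    show "y \<in> carrier R" "y [^] n = \<zero>" using that B(1) by auto
  qed (use sep CC that(1) in blast)+
  \<comment> \<open>A nilpotent \<open>y\<close> of \<open>B\<close> commutes with the FC-elements
    in \<open>S\<close>, so \<open>CC\<close> with \<open>t = y\<close> makes it central in
    \<open>B\<close>.\<close>
  have nilB: "y \<otimes> z = z \<otimes> y" if y: "y \<in> B" "y [^] (n::nat) = \<zero>" and z: "z \<in> B" for y z n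
    using CC[of y z] nilFC[OF y] S(2) y(1) z B(1) by blast
  let ?B = "R\<lparr>carrier := B\<rparr>"
  have pow: "y [^]\<^bsub>?B\<^esub> n = y [^] n" for y and n :: nat by (rule nat_pow_consistent[symmetric])
  have aB: "a \<in> B" "b \<in> B" using abH HB by auto
  have abc: "a \<in> carrier R" "b \<in> carrier R" using aB B(1) by auto
  define c where "c = a \<otimes> b \<ominus> b \<otimes> a"
  have cB: "c \<in> B" unfolding c_def a_minus_def using aB B(5-7) by blast
  have "c \<oplus> b \<otimes> a = a \<otimes> b" using abc by (simp add: c_def a_minus_def a_assoc l_neg)
  then have "\<exists>m::nat. c [^]\<^bsub>?B\<^esub> m = \<zero>\<^bsub>?B\<^esub>"
    using subring_is_ring[OF subB] finB aB cB nilB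
    by (intro finite_ring_commutator_nilpotent[of ?B a b c]) (auto simp: pow)
  then obtain m :: nat where m: "c [^] m = \<zero>" by (auto simp: pow)
  \<comment> \<open>Chosen so that \<open>c d\<close> is the group commutator of \<open>a\<close>
    and \<open>b\<close> minus 1. It is nilpotent because \<open>c\<close> is nilpotent and
    therefore commutes with \<open>d\<close>.\<close>
  define d where "d = inv a \<otimes> inv b"
  have ab: "a \<in> Units R" "b \<in> Units R" using abH HU by auto
  have dB: "d \<in> B" using H abH HB by (auto simp: d_def)
  have cd: "c \<in> carrier R" "d \<in> carrier R" using cB dB B(1) by auto
  have "(c \<otimes> d) [^] m = \<zero>"
    using pow_mult_distrib[OF nilB[OF cB m dB] cd] m cd by simp
  then have comm: "(c \<otimes> d) \<otimes> x = x \<otimes> (c \<otimes> d)" using nilFC[OF _ _ x] B(6)[OF cB dB] by blast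
  have xc: "x \<in> carrier R" using x by (rule fc_center_units_closed)
  have "(b \<otimes> a) \<otimes> d = \<one>"
  proof -
    have "(b \<otimes> a) \<otimes> d = b \<otimes> (a \<otimes> inv a) \<otimes> inv b" using ab abc by (simp add: d_def m_assoc del: Units_r_inv)
    then show ?thesis using ab abc by simp
  qed
  moreover have "c \<otimes> d = a \<otimes> b \<otimes> d \<ominus> (b \<otimes> a) \<otimes> d"
    using abc cd by (simp add: c_def a_minus_def l_distr l_minus)
  moreover have "a \<otimes> b \<otimes> d = a \<otimes> b \<otimes> inv a \<otimes> inv b" using ab abc by (simp add: d_def m_assoc)
  ultimately have "a \<otimes> b \<otimes> inv a \<otimes> inv b = c \<otimes> d \<oplus> \<one>"
    using ab abc by (simp add: a_minus_def a_assoc l_neg)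
  then show ?thesis using comm cd xc by (simp add: l_distr r_distr)
qed

end

section \<open>Twisted group algebras\<close>

lemma (in abelian_monoid) finsum_swap:
  assumes "finite A" "finite B" "\<And>a b. a \<in> A \<Longrightarrow> b \<in> B \<Longrightarrow> f a b \<in> carrier G"
  shows "(\<Oplus>a\<in>A. \<Oplus>b\<in>B. f a b) = (\<Oplus>b\<in>B. \<Oplus>a\<in>A. f a b)"
  using assms(1,3)
proof (induction A rule: finite_induct)
  case (insert a A)
  have "(\<Oplus>b\<in>B. \<Oplus>a\<in>insert a A. f a b) = (\<Oplus>b\<in>B. f a b \<oplus> (\<Oplus>a\<in>A. f a b))"
    using insert by (intro finsum_cong') (auto simp: Pi_def)
  also have "\<dots> = (\<Oplus>b\<in>B. f a b) \<oplus> (\<Oplus>b\<in>B. \<Oplus>a\<in>A. f a b)"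
    using insert.prems by (intro finsum_addf) (auto intro!: finsum_closed)
  finally show ?case using insert by (simp add: Pi_def)
qed simp

section \<open>The twisted convolution product and its associativity\<close>

locale twisted_algebra = G: group G + K: field K
  for G :: "('g, 'm) monoid_scheme" and K :: "('k, 'r) ring_scheme" +
  fixes lam :: "'g \<Rightarrow> 'g \<Rightarrow> 'k"
  assumes cocycle: "two_cocycle G K lam"
begin

abbreviation "A \<equiv> twisted_group_algebra G K lam"
abbreviation "supp \<equiv> coeff_support G K"
abbreviation "basis \<equiv> twisted_basis G K"

lemma lam:
  assumes "g \<in> carrier G" "h \<in> carrier G"
  shows "lam g h \<in> carrier K" "lam g h \<noteq> \<zero>\<^bsub>K\<^esub>"
  using assms cocycle by (auto simp: two_cocycle_def)

lemma lam_assoc: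
  assumes "g \<in> carrier G" "h \<in> carrier G" "k \<in> carrier G"
  shows "lam g h \<otimes>\<^bsub>K\<^esub> lam (g \<otimes>\<^bsub>G\<^esub> h) k = lam h k \<otimes>\<^bsub>K\<^esub> lam g (h \<otimes>\<^bsub>G\<^esub> k)"
  using assms cocycle by (auto simp: two_cocycle_def)

text \<open>The cocycle identity at \<open>(1, 1, g)\<close> and \<open>(g, 1, 1)\<close>, after
  cancellation. Hence one correction by the inverse of \<open>lam 1 1\<close> normalizes all
  products with the identity.\<close>

lemma lam_one:
  assumes g: "g \<in> carrier G"
  shows "lam \<one>\<^bsub>G\<^esub> g = lam \<one>\<^bsub>G\<^esub> \<one>\<^bsub>G\<^esub>" "lam g \<one>\<^bsub>G\<^esub> = lam \<one>\<^bsub>G\<^esub> \<one>\<^bsub>G\<^esub>"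
proof -
  have "lam \<one>\<^bsub>G\<^esub> \<one>\<^bsub>G\<^esub> \<otimes>\<^bsub>K\<^esub> lam \<one>\<^bsub>G\<^esub> g = lam \<one>\<^bsub>G\<^esub> g \<otimes>\<^bsub>K\<^esub> lam \<one>\<^bsub>G\<^esub> g"
    using lam_assoc[of "\<one>\<^bsub>G\<^esub>" "\<one>\<^bsub>G\<^esub>" g] g by simp
  then show "lam \<one>\<^bsub>G\<^esub> g = lam \<one>\<^bsub>G\<^esub> \<one>\<^bsub>G\<^esub>"
    using K.m_rcancel[of "lam \<one>\<^bsub>G\<^esub> g"] lam g by simp
  have "lam g \<one>\<^bsub>G\<^esub> \<otimes>\<^bsub>K\<^esub> lam g \<one>\<^bsub>G\<^esub> = lam \<one>\<^bsub>G\<^esub> \<one>\<^bsub>G\<^esub> \<otimes>\<^bsub>K\<^esub> lam g \<one>\<^bsub>G\<^esub>"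
    using lam_assoc[of g "\<one>\<^bsub>G\<^esub>" "\<one>\<^bsub>G\<^esub>"] g by simp
  then show "lam g \<one>\<^bsub>G\<^esub> = lam \<one>\<^bsub>G\<^esub> \<one>\<^bsub>G\<^esub>"
    using K.m_rcancel[of "lam g \<one>\<^bsub>G\<^esub>"] lam g by simp
qed

lemma carrier_A_iff: "a \<in> carrier A \<longleftrightarrow> a \<in> carrier G \<rightarrow>\<^sub>E carrier K \<and> finite (supp a)"
  by (simp add: twisted_group_algebra_def)

lemma coeff_closed [simp]: "a \<in> carrier A \<Longrightarrow> x \<in> carrier G \<Longrightarrow> a x \<in> carrier K"
  by (auto simp: carrier_A_iff)

lemma finite_supp: "a \<in> carrier A \<Longrightarrow> finite (supp a)"
  by (simp add: carrier_A_iff)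

lemma supp_subset: "supp a \<subseteq> carrier G"
  by (auto simp: coeff_support_def)

lemma A_ext:
  assumes "a \<in> carrier A" "b \<in> carrier A" "\<And>x. x \<in> carrier G \<Longrightarrow> a x = b x"
  shows "a = b"
  using assms by (auto simp: carrier_A_iff intro: PiE_ext)

lemma restrict_in_A:
  assumes "\<And>x. x \<in> carrier G \<Longrightarrow> f x \<in> carrier K" "finite F"
    "\<And>x. x \<in> carrier G \<Longrightarrow> x \<notin> F \<Longrightarrow> f x = \<zero>\<^bsub>K\<^esub>"
  shows "(\<lambda>x\<in>carrier G. f x) \<in> carrier A"
proof -
  have "supp (\<lambda>x\<in>carrier G. f x) \<subseteq> F" using assms(3) by (auto simp: coeff_support_def)
  then show ?thesis using assms finite_subset by (auto simp: carrier_A_iff)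
qed

lemma add_apply: "x \<in> carrier G \<Longrightarrow> (a \<oplus>\<^bsub>A\<^esub> b) x = a x \<oplus>\<^bsub>K\<^esub> b x"
  by (simp add: twisted_group_algebra_def)

lemma add_closed_A:
  assumes "a \<in> carrier A" "b \<in> carrier A" shows "a \<oplus>\<^bsub>A\<^esub> b \<in> carrier A"
proof -
  have "(\<lambda>x\<in>carrier G. a x \<oplus>\<^bsub>K\<^esub> b x) \<in> carrier A"
  proof (rule restrict_in_A)
    show "finite (supp a \<union> supp b)" using assms finite_supp by simp
  qed (use assms in \<open>auto simp: coeff_support_def\<close>)
  then show ?thesis by (simp add: twisted_group_algebra_def)
qed

lemma zero_apply: "x \<in> carrier G \<Longrightarrow> \<zero>\<^bsub>A\<^esub> x = \<zero>\<^bsub>K\<^esub>"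
  by (simp add: twisted_group_algebra_def)

lemma zero_closed_A: "\<zero>\<^bsub>A\<^esub> \<in> carrier A"
  using restrict_in_A[of "\<lambda>_. \<zero>\<^bsub>K\<^esub>" "{}"] by (simp add: twisted_group_algebra_def)

text \<open>The multiple \<open>t\<close> of the identity of the algebra; the extra factor corrects
  for a cocycle that is not normalized.\<close>

definition scalar :: "'k \<Rightarrow> 'g \<Rightarrow> 'k" where
  "scalar t = (\<lambda>x\<in>carrier G. if x = \<one>\<^bsub>G\<^esub> then t \<otimes>\<^bsub>K\<^esub> inv\<^bsub>K\<^esub> (lam \<one>\<^bsub>G\<^esub> \<one>\<^bsub>G\<^esub>) else \<zero>\<^bsub>K\<^esub>)"

lemma lam11: "inv\<^bsub>K\<^esub> (lam \<one>\<^bsub>G\<^esub> \<one>\<^bsub>G\<^esub>) \<in> carrier K" "inv\<^bsub>K\<^esub> (lam \<one>\<^bsub>G\<^esub> \<one>\<^bsub>G\<^esub>) \<noteq> \<zero>\<^bsub>K\<^esub>"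
  "inv\<^bsub>K\<^esub> (lam \<one>\<^bsub>G\<^esub> \<one>\<^bsub>G\<^esub>) \<otimes>\<^bsub>K\<^esub> lam \<one>\<^bsub>G\<^esub> \<one>\<^bsub>G\<^esub> = \<one>\<^bsub>K\<^esub>"
proof -
  have u: "lam \<one>\<^bsub>G\<^esub> \<one>\<^bsub>G\<^esub> \<in> Units K" using lam[of "\<one>\<^bsub>G\<^esub>" "\<one>\<^bsub>G\<^esub>"] K.field_Units by simp
  show "inv\<^bsub>K\<^esub> (lam \<one>\<^bsub>G\<^esub> \<one>\<^bsub>G\<^esub>) \<in> carrier K" "inv\<^bsub>K\<^esub> (lam \<one>\<^bsub>G\<^esub> \<one>\<^bsub>G\<^esub>) \<otimes>\<^bsub>K\<^esub> lam \<one>\<^bsub>G\<^esub> \<one>\<^bsub>G\<^esub> = \<one>\<^bsub>K\<^esub>"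
    using u by auto
  show "inv\<^bsub>K\<^esub> (lam \<one>\<^bsub>G\<^esub> \<one>\<^bsub>G\<^esub>) \<noteq> \<zero>\<^bsub>K\<^esub>" using K.Units_inv_Units[OF u] K.field_Units by auto
qed

lemma scalar_closed: "t \<in> carrier K \<Longrightarrow> scalar t \<in> carrier A"
  unfolding scalar_def using lam11 by (intro restrict_in_A[of _ "{\<one>\<^bsub>G\<^esub>}"]) auto

lemma one_A: "\<one>\<^bsub>A\<^esub> = scalar \<one>\<^bsub>K\<^esub>"
  unfolding scalar_def K.l_one[OF lam11(1)] by (simp add: twisted_group_algebra_def)

lemma supp_scalar: "supp (scalar t) \<subseteq> {\<one>\<^bsub>G\<^esub>}"
  by (auto simp: coeff_support_def scalar_def)

lemma mult_apply:
  "x \<in> carrier G \<Longrightarrow> (a \<otimes>\<^bsub>A\<^esub> b) x = finsum K (\<lambda>(g, h). (a g \<otimes>\<^bsub>K\<^esub> b h) \<otimes>\<^bsub>K\<^esub> lam g h)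
          {(g, h) \<in> supp a \<times> supp b. g \<otimes>\<^bsub>G\<^esub> h = x}"
  by (simp add: twisted_group_algebra_def)

text \<open>In the convolution the left index determines the right one, so a single sum remains.
  Allowing any finite \<open>F\<close> around the support lets sparse elements be evaluated on a
  singleton, even where their coefficient is zero.\<close>

lemma mult_left:
  assumes a: "a \<in> carrier A" and b: "b \<in> carrier A" and x: "x \<in> carrier G"
    and F: "finite F" "supp a \<subseteq> F" "F \<subseteq> carrier G"
  shows "(a \<otimes>\<^bsub>A\<^esub> b) x =
    finsum K (\<lambda>g. a g \<otimes>\<^bsub>K\<^esub> b (inv\<^bsub>G\<^esub> g \<otimes>\<^bsub>G\<^esub> x) \<otimes>\<^bsub>K\<^esub> lam g (inv\<^bsub>G\<^esub> g \<otimes>\<^bsub>G\<^esub> x)) F"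
proof -
  let ?P = "{(g, h) \<in> supp a \<times> supp b. g \<otimes>\<^bsub>G\<^esub> h = x}"
  let ?f = "\<lambda>g. a g \<otimes>\<^bsub>K\<^esub> b (inv\<^bsub>G\<^esub> g \<otimes>\<^bsub>G\<^esub> x) \<otimes>\<^bsub>K\<^esub> lam g (inv\<^bsub>G\<^esub> g \<otimes>\<^bsub>G\<^esub> x)"
  have fc: "?f g \<in> carrier K" if "g \<in> carrier G" for g using that a b x lam by simp
  have h: "h = inv\<^bsub>G\<^esub> g \<otimes>\<^bsub>G\<^esub> x" if "(g, h) \<in> ?P" for g h
    using that supp_subset by (auto simp: subset_iff)
  have PC: "fst p \<in> carrier G" "snd p \<in> carrier G" if "p \<in> ?P" for p
    using that supp_subset[of a] supp_subset[of b] by auto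
  have "(a \<otimes>\<^bsub>A\<^esub> b) x = finsum K (\<lambda>p. ?f (fst p)) ?P"
    unfolding mult_apply[OF x]
  proof (rule K.finsum_cong')
    show "(\<lambda>p. ?f (fst p)) \<in> ?P \<rightarrow> carrier K" by (intro funcsetI fc PC)
    fix p assume "p \<in> ?P"
    then show "(case p of (g, h) \<Rightarrow> a g \<otimes>\<^bsub>K\<^esub> b h \<otimes>\<^bsub>K\<^esub> lam g h) = ?f (fst p)"
      using h[of "fst p" "snd p"] by (cases p) simp
  qed simp
  also have "\<dots> = finsum K ?f (fst ` ?P)"
  proof (rule K.finsum_reindex[symmetric])
    show "?f \<in> fst ` ?P \<rightarrow> carrier K"
    proof (rule funcsetI)
      fix g assume "g \<in> fst ` ?P"
      then have "g \<in> carrier G" using PC by blast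
      then show "?f g \<in> carrier K" by (rule fc)
    qed
    show "inj_on fst ?P"
    proof (rule inj_onI)
      fix p q assume pq: "p \<in> ?P" "q \<in> ?P" "fst p = fst q"
      then show "p = q" using h[of "fst p" "snd p", unfolded prod.collapse, OF pq(1)]
          h[of "fst q" "snd q", unfolded prod.collapse, OF pq(2)] by (simp only: prod_eq_iff)
    qed
  qed
  also have "\<dots> = finsum K ?f F"
  proof (rule K.add.finprod_mono_neutral_cong_left)
    show "fst ` ?P \<subseteq> F" using F(2) by auto
    show "?f \<in> F \<rightarrow> carrier K" using fc F(3) by blast
    fix g assume g: "g \<in> F - fst ` ?P"
    then have gc: "g \<in> carrier G" "inv\<^bsub>G\<^esub> g \<otimes>\<^bsub>G\<^esub> x \<in> carrier G" using F x by auto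
    have "g \<otimes>\<^bsub>G\<^esub> (inv\<^bsub>G\<^esub> g \<otimes>\<^bsub>G\<^esub> x) = x" using gc(1) x by simp
    then have "g \<notin> supp a \<or> inv\<^bsub>G\<^esub> g \<otimes>\<^bsub>G\<^esub> x \<notin> supp b" using g by force
    then have "a g = \<zero>\<^bsub>K\<^esub> \<or> b (inv\<^bsub>G\<^esub> g \<otimes>\<^bsub>G\<^esub> x) = \<zero>\<^bsub>K\<^esub>" using gc by (auto simp: coeff_support_def)
    then show "?f g = \<zero>\<^bsub>K\<^esub>" using gc a b lam[OF gc] by auto
  qed (use F in auto)
  finally show ?thesis .
qed

lemma mult_right:
  assumes a: "a \<in> carrier A" and b: "b \<in> carrier A" and x: "x \<in> carrier G"
    and F: "finite F" "supp b \<subseteq> F" "F \<subseteq> carrier G"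
  shows "(a \<otimes>\<^bsub>A\<^esub> b) x =
    finsum K (\<lambda>h. a (x \<otimes>\<^bsub>G\<^esub> inv\<^bsub>G\<^esub> h) \<otimes>\<^bsub>K\<^esub> b h \<otimes>\<^bsub>K\<^esub> lam (x \<otimes>\<^bsub>G\<^esub> inv\<^bsub>G\<^esub> h) h) F"
proof -
  let ?P = "{(g, h) \<in> supp a \<times> supp b. g \<otimes>\<^bsub>G\<^esub> h = x}"
  let ?f = "\<lambda>h. a (x \<otimes>\<^bsub>G\<^esub> inv\<^bsub>G\<^esub> h) \<otimes>\<^bsub>K\<^esub> b h \<otimes>\<^bsub>K\<^esub> lam (x \<otimes>\<^bsub>G\<^esub> inv\<^bsub>G\<^esub> h) h"
  have fc: "?f g \<in> carrier K" if "g \<in> carrier G" for g using that a b x lam by simp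
  have g: "g = x \<otimes>\<^bsub>G\<^esub> inv\<^bsub>G\<^esub> h" if "(g, h) \<in> ?P" for g h
    using that supp_subset by (auto simp: subset_iff G.m_assoc)
  have PC: "fst p \<in> carrier G" "snd p \<in> carrier G" if "p \<in> ?P" for p
    using that supp_subset[of a] supp_subset[of b] by auto
  have "(a \<otimes>\<^bsub>A\<^esub> b) x = finsum K (\<lambda>p. ?f (snd p)) ?P"
    unfolding mult_apply[OF x]
  proof (rule K.finsum_cong')
    show "(\<lambda>p. ?f (snd p)) \<in> ?P \<rightarrow> carrier K" by (intro funcsetI fc PC)
    fix p assume "p \<in> ?P"
    then show "(case p of (g, h) \<Rightarrow> a g \<otimes>\<^bsub>K\<^esub> b h \<otimes>\<^bsub>K\<^esub> lam g h) = ?f (snd p)"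
      using g[of "fst p" "snd p"] by (cases p) simp
  qed simp
  also have "\<dots> = finsum K ?f (snd ` ?P)"
  proof (rule K.finsum_reindex[symmetric])
    show "?f \<in> snd ` ?P \<rightarrow> carrier K"
    proof (rule funcsetI)
      fix g assume "g \<in> snd ` ?P"
      then have "g \<in> carrier G" using PC by blast
      then show "?f g \<in> carrier K" by (rule fc)
    qed
    show "inj_on snd ?P"
    proof (rule inj_onI)
      fix p q assume pq: "p \<in> ?P" "q \<in> ?P" "snd p = snd q"
      then show "p = q" using g[of "fst p" "snd p", unfolded prod.collapse, OF pq(1)]
          g[of "fst q" "snd q", unfolded prod.collapse, OF pq(2)] by (simp only: prod_eq_iff)
    qed
  qed
  also have "\<dots> = finsum K ?f F"
  proof (rule K.add.finprod_mono_neutral_cong_left)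
    show "snd ` ?P \<subseteq> F" using F(2) by auto
    show "?f \<in> F \<rightarrow> carrier K" using fc F(3) by blast
    fix h assume h: "h \<in> F - snd ` ?P"
    then have hc: "x \<otimes>\<^bsub>G\<^esub> inv\<^bsub>G\<^esub> h \<in> carrier G" "h \<in> carrier G" using F x by auto
    have "(x \<otimes>\<^bsub>G\<^esub> inv\<^bsub>G\<^esub> h) \<otimes>\<^bsub>G\<^esub> h = x" using hc(2) x by (simp add: G.m_assoc)
    then have "h \<notin> supp b \<or> x \<otimes>\<^bsub>G\<^esub> inv\<^bsub>G\<^esub> h \<notin> supp a" using h by force
    then have "b h = \<zero>\<^bsub>K\<^esub> \<or> a (x \<otimes>\<^bsub>G\<^esub> inv\<^bsub>G\<^esub> h) = \<zero>\<^bsub>K\<^esub>" using hc by (auto simp: coeff_support_def)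
    then show "?f h = \<zero>\<^bsub>K\<^esub>" using hc a b lam[OF hc] by auto
  qed (use F in auto)
  finally show ?thesis .
qed

lemma mult_closed_A:
  assumes a: "a \<in> carrier A" and b: "b \<in> carrier A" shows "a \<otimes>\<^bsub>A\<^esub> b \<in> carrier A"
proof -
  let ?F = "(\<lambda>(g, h). g \<otimes>\<^bsub>G\<^esub> h) ` (supp a \<times> supp b)"
  have "(\<lambda>x\<in>carrier G. (a \<otimes>\<^bsub>A\<^esub> b) x) \<in> carrier A"
  proof (rule restrict_in_A)
    show "finite ?F" using a b finite_supp by simp
    show "(a \<otimes>\<^bsub>A\<^esub> b) x \<in> carrier K" if "x \<in> carrier G" for x
      unfolding mult_apply[OF that] using a b lam supp_subset
      by (intro K.finsum_closed) (auto simp: subset_iff)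
    show "(a \<otimes>\<^bsub>A\<^esub> b) x = \<zero>\<^bsub>K\<^esub>" if "x \<in> carrier G" "x \<notin> ?F" for x
    proof -
      have empty: "{(g, h) \<in> supp a \<times> supp b. g \<otimes>\<^bsub>G\<^esub> h = x} = {}" using that(2) by force
      show ?thesis unfolding mult_apply[OF that(1)] empty by simp
    qed
  qed
  moreover have "(\<lambda>x\<in>carrier G. (a \<otimes>\<^bsub>A\<^esub> b) x) = a \<otimes>\<^bsub>A\<^esub> b"
    by (auto simp: twisted_group_algebra_def restrict_def)
  ultimately show ?thesis by simp
qed

lemma scalar_mult_apply:
  assumes t: "t \<in> carrier K" and a: "a \<in> carrier A" and x: "x \<in> carrier G"
  shows "(scalar t \<otimes>\<^bsub>A\<^esub> a) x = t \<otimes>\<^bsub>K\<^esub> a x" "(a \<otimes>\<^bsub>A\<^esub> scalar t) x = t \<otimes>\<^bsub>K\<^esub> a x"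
proof -
  note [simp] = lam11 lam_one[OF x] lam[OF G.one_closed G.one_closed]
  have "(scalar t \<otimes>\<^bsub>A\<^esub> a) x = scalar t \<one>\<^bsub>G\<^esub> \<otimes>\<^bsub>K\<^esub> a x \<otimes>\<^bsub>K\<^esub> lam \<one>\<^bsub>G\<^esub> x"
    using mult_left[OF scalar_closed[OF t] a x _ supp_scalar] scalar_closed[OF t] a x by simp
  also have "\<dots> = t \<otimes>\<^bsub>K\<^esub> (inv\<^bsub>K\<^esub> (lam \<one>\<^bsub>G\<^esub> \<one>\<^bsub>G\<^esub>) \<otimes>\<^bsub>K\<^esub> lam \<one>\<^bsub>G\<^esub> \<one>\<^bsub>G\<^esub>) \<otimes>\<^bsub>K\<^esub> a x"
    using t a x by (simp add: scalar_def K.m_ac del: lam11(3))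
  finally show "(scalar t \<otimes>\<^bsub>A\<^esub> a) x = t \<otimes>\<^bsub>K\<^esub> a x" using t by simp
  have "(a \<otimes>\<^bsub>A\<^esub> scalar t) x = a x \<otimes>\<^bsub>K\<^esub> scalar t \<one>\<^bsub>G\<^esub> \<otimes>\<^bsub>K\<^esub> lam x \<one>\<^bsub>G\<^esub>"
    using mult_right[OF a scalar_closed[OF t] x _ supp_scalar] scalar_closed[OF t] a x by simp
  also have "\<dots> = t \<otimes>\<^bsub>K\<^esub> (inv\<^bsub>K\<^esub> (lam \<one>\<^bsub>G\<^esub> \<one>\<^bsub>G\<^esub>) \<otimes>\<^bsub>K\<^esub> lam \<one>\<^bsub>G\<^esub> \<one>\<^bsub>G\<^esub>) \<otimes>\<^bsub>K\<^esub> a x"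
    using t a x by (simp add: scalar_def K.m_ac del: lam11(3))
  finally show "(a \<otimes>\<^bsub>A\<^esub> scalar t) x = t \<otimes>\<^bsub>K\<^esub> a x" using t by simp
qed

lemma mult_assoc_A:
  assumes a: "a \<in> carrier A" and b: "b \<in> carrier A" and c: "c \<in> carrier A"
  shows "(a \<otimes>\<^bsub>A\<^esub> b) \<otimes>\<^bsub>A\<^esub> c = a \<otimes>\<^bsub>A\<^esub> (b \<otimes>\<^bsub>A\<^esub> c)"
proof (rule A_ext)
  note ab = mult_closed_A[OF a b] and bc = mult_closed_A[OF b c]
  show "(a \<otimes>\<^bsub>A\<^esub> b) \<otimes>\<^bsub>A\<^esub> c \<in> carrier A" "a \<otimes>\<^bsub>A\<^esub> (b \<otimes>\<^bsub>A\<^esub> c) \<in> carrier A"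
    using mult_closed_A a b c by auto
  fix x assume x: "x \<in> carrier G"
  \<comment> \<open>Expanding \<open>a\<close> from the left and \<open>c\<close> from the right
    leaves \<open>m g k\<close> as the only possible middle index. Both bracketings become double
    sums over the same index set.\<close>
  define m where "m g k = inv\<^bsub>G\<^esub> g \<otimes>\<^bsub>G\<^esub> x \<otimes>\<^bsub>G\<^esub> inv\<^bsub>G\<^esub> k" for g k
  define s where "s g k = a g \<otimes>\<^bsub>K\<^esub> b (m g k) \<otimes>\<^bsub>K\<^esub> c k \<otimes>\<^bsub>K\<^esub> (lam g (m g k) \<otimes>\<^bsub>K\<^esub> lam (x \<otimes>\<^bsub>G\<^esub> inv\<^bsub>G\<^esub> k) k)" for g k
  have mc: "m g k \<in> carrier G" if "g \<in> carrier G" "k \<in> carrier G" for g k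
    using that x by (simp add: m_def)
  have sc: "s g k \<in> carrier K" if "g \<in> carrier G" "k \<in> carrier G" for g k
    using that a b c x mc lam by (simp add: s_def)
  have sA: "g \<in> carrier G" if "g \<in> supp f" for g f using that supp_subset by blast
  have "((a \<otimes>\<^bsub>A\<^esub> b) \<otimes>\<^bsub>A\<^esub> c) x = finsum K (\<lambda>k. finsum K (\<lambda>g. s g k) (supp a)) (supp c)"
    unfolding mult_right[OF ab c x finite_supp[OF c] subset_refl supp_subset]
  proof (rule K.finsum_cong')
    fix k assume k: "k \<in> supp c"
    have kc: "k \<in> carrier G" "x \<otimes>\<^bsub>G\<^esub> inv\<^bsub>G\<^esub> k \<in> carrier G" using sA[OF k] x by auto
    define f where "f g = a g \<otimes>\<^bsub>K\<^esub> b (m g k) \<otimes>\<^bsub>K\<^esub> lam g (m g k)" for g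
    define e where "e = c k \<otimes>\<^bsub>K\<^esub> lam (x \<otimes>\<^bsub>G\<^esub> inv\<^bsub>G\<^esub> k) k"
    have ec: "c k \<in> carrier K" "lam (x \<otimes>\<^bsub>G\<^esub> inv\<^bsub>G\<^esub> k) k \<in> carrier K" "e \<in> carrier K"
      using c kc lam(1)[OF kc(2,1)] by (simp_all add: e_def)
    have gd: "a g \<in> carrier K" "b (m g k) \<in> carrier K" "lam g (m g k) \<in> carrier K" "f g \<in> carrier K"
      if "g \<in> supp a" for g
      using a b sA[OF that] mc[OF sA[OF that] kc(1)] lam(1)[OF sA[OF that] mc[OF sA[OF that] kc(1)]]
      by (simp_all add: f_def)
    have "(a \<otimes>\<^bsub>A\<^esub> b) (x \<otimes>\<^bsub>G\<^esub> inv\<^bsub>G\<^esub> k) = finsum K f (supp a)"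
      unfolding mult_left[OF a b kc(2) finite_supp[OF a] subset_refl supp_subset]
    proof (rule K.finsum_cong')
      fix g assume g: "g \<in> supp a"
      have "inv\<^bsub>G\<^esub> g \<otimes>\<^bsub>G\<^esub> (x \<otimes>\<^bsub>G\<^esub> inv\<^bsub>G\<^esub> k) = m g k" using sA[OF g] x kc by (simp add: m_def G.m_assoc)
      then show "a g \<otimes>\<^bsub>K\<^esub> b (inv\<^bsub>G\<^esub> g \<otimes>\<^bsub>G\<^esub> (x \<otimes>\<^bsub>G\<^esub> inv\<^bsub>G\<^esub> k)) \<otimes>\<^bsub>K\<^esub>
          lam g (inv\<^bsub>G\<^esub> g \<otimes>\<^bsub>G\<^esub> (x \<otimes>\<^bsub>G\<^esub> inv\<^bsub>G\<^esub> k)) = f g" by (simp only: f_def)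
    qed (use gd(4) in auto)
    then have "(a \<otimes>\<^bsub>A\<^esub> b) (x \<otimes>\<^bsub>G\<^esub> inv\<^bsub>G\<^esub> k) \<otimes>\<^bsub>K\<^esub> c k \<otimes>\<^bsub>K\<^esub> lam (x \<otimes>\<^bsub>G\<^esub> inv\<^bsub>G\<^esub> k) k =
        finsum K f (supp a) \<otimes>\<^bsub>K\<^esub> e"
      using ec gd(4) by (simp add: e_def K.m_assoc Pi_def)
    also have "\<dots> = finsum K (\<lambda>g. f g \<otimes>\<^bsub>K\<^esub> e) (supp a)"
      using gd(4) ec(3) finite_supp[OF a] by (intro K.finsum_ldistr) auto
    also have "\<dots> = finsum K (\<lambda>g. s g k) (supp a)"
    proof (rule K.finsum_cong')
      fix g assume g: "g \<in> supp a"
      show "f g \<otimes>\<^bsub>K\<^esub> e = s g k" using gd(1-3)[OF g] ec by (simp add: f_def e_def s_def K.m_ac)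
    qed (use sA sc kc in auto)
    finally show "(a \<otimes>\<^bsub>A\<^esub> b) (x \<otimes>\<^bsub>G\<^esub> inv\<^bsub>G\<^esub> k) \<otimes>\<^bsub>K\<^esub> c k \<otimes>\<^bsub>K\<^esub> lam (x \<otimes>\<^bsub>G\<^esub> inv\<^bsub>G\<^esub> k) k =
        finsum K (\<lambda>g. s g k) (supp a)" .
  next
    show "(\<lambda>k. finsum K (\<lambda>g. s g k) (supp a)) \<in> supp c \<rightarrow> carrier K"
      using sA sc by (intro funcsetI K.finsum_closed) blast
  qed simp
  also have "\<dots> = finsum K (\<lambda>g. finsum K (\<lambda>k. s g k) (supp c)) (supp a)"
    using sA sc a c by (intro K.finsum_swap) (auto simp: finite_supp)
  also have "\<dots> = (a \<otimes>\<^bsub>A\<^esub> (b \<otimes>\<^bsub>A\<^esub> c)) x"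
    unfolding mult_left[OF a bc x finite_supp[OF a] subset_refl supp_subset]
  proof (rule K.finsum_cong')
    fix g assume g: "g \<in> supp a"
    have gc: "g \<in> carrier G" "inv\<^bsub>G\<^esub> g \<otimes>\<^bsub>G\<^esub> x \<in> carrier G" using sA[OF g] x by auto
    define f where "f k = b (m g k) \<otimes>\<^bsub>K\<^esub> c k \<otimes>\<^bsub>K\<^esub> lam (m g k) k" for k
    define e where "e = lam g (inv\<^bsub>G\<^esub> g \<otimes>\<^bsub>G\<^esub> x)"
    have ec: "a g \<in> carrier K" "e \<in> carrier K" using a gc lam(1)[OF gc] by (simp_all add: e_def)
    have kd: "b (m g k) \<in> carrier K" "c k \<in> carrier K" "lam (m g k) k \<in> carrier K" "lam g (m g k) \<in> carrier K"
      "lam (x \<otimes>\<^bsub>G\<^esub> inv\<^bsub>G\<^esub> k) k \<in> carrier K" "f k \<in> carrier K" if "k \<in> supp c" for k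
      using b c x gc(1) sA[OF that] mc[OF gc(1) sA[OF that]] lam(1) by (simp_all add: f_def)
    have "(b \<otimes>\<^bsub>A\<^esub> c) (inv\<^bsub>G\<^esub> g \<otimes>\<^bsub>G\<^esub> x) = finsum K f (supp c)"
      unfolding mult_right[OF b c gc(2) finite_supp[OF c] subset_refl supp_subset]
      by (rule K.finsum_cong') (use kd(6) in \<open>auto simp: f_def m_def\<close>)
    moreover have "a g \<otimes>\<^bsub>K\<^esub> finsum K f (supp c) \<otimes>\<^bsub>K\<^esub> e = finsum K (\<lambda>k. a g \<otimes>\<^bsub>K\<^esub> f k \<otimes>\<^bsub>K\<^esub> e) (supp c)"
      using kd(6) ec finite_supp[OF c] by (simp add: K.finsum_rdistr K.finsum_ldistr Pi_def)
    moreover have "finsum K (\<lambda>k. s g k) (supp c) = finsum K (\<lambda>k. a g \<otimes>\<^bsub>K\<^esub> f k \<otimes>\<^bsub>K\<^esub> e) (supp c)"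
    proof (rule K.finsum_cong')
      fix k assume k: "k \<in> supp c"
      have kc: "k \<in> carrier G" "m g k \<in> carrier G" using sA[OF k] gc mc by auto
      have "g \<otimes>\<^bsub>G\<^esub> m g k = x \<otimes>\<^bsub>G\<^esub> inv\<^bsub>G\<^esub> k" "m g k \<otimes>\<^bsub>G\<^esub> k = inv\<^bsub>G\<^esub> g \<otimes>\<^bsub>G\<^esub> x"
        using gc(1) kc(1) x by (simp_all add: m_def G.m_assoc)
      \<comment> \<open>The only use of the cocycle identity: it matches the weights of the two
        bracketings.\<close>
      then have l: "lam g (m g k) \<otimes>\<^bsub>K\<^esub> lam (x \<otimes>\<^bsub>G\<^esub> inv\<^bsub>G\<^esub> k) k = lam (m g k) k \<otimes>\<^bsub>K\<^esub> e"
        using lam_assoc[OF gc(1) kc(2,1)] by (simp add: e_def)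
      show "s g k = a g \<otimes>\<^bsub>K\<^esub> f k \<otimes>\<^bsub>K\<^esub> e"
        unfolding s_def l f_def using ec kd(1-3)[OF k] by (simp add: K.m_ac)
    qed (use kd(6) ec in auto)
    ultimately show "finsum K (\<lambda>k. s g k) (supp c) =
        a g \<otimes>\<^bsub>K\<^esub> (b \<otimes>\<^bsub>A\<^esub> c) (inv\<^bsub>G\<^esub> g \<otimes>\<^bsub>G\<^esub> x) \<otimes>\<^bsub>K\<^esub> lam g (inv\<^bsub>G\<^esub> g \<otimes>\<^bsub>G\<^esub> x)"
      by (simp add: e_def)
  next
    show "(\<lambda>g. a g \<otimes>\<^bsub>K\<^esub> (b \<otimes>\<^bsub>A\<^esub> c) (inv\<^bsub>G\<^esub> g \<otimes>\<^bsub>G\<^esub> x) \<otimes>\<^bsub>K\<^esub> lam g (inv\<^bsub>G\<^esub> g \<otimes>\<^bsub>G\<^esub> x)) \<in> supp a \<rightarrow> carrier K"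
      using sA a bc x lam(1) by (intro funcsetI) simp
  qed simp
  finally show "((a \<otimes>\<^bsub>A\<^esub> b) \<otimes>\<^bsub>A\<^esub> c) x = (a \<otimes>\<^bsub>A\<^esub> (b \<otimes>\<^bsub>A\<^esub> c)) x" .
qed

end

lemma (in field) finite_roots_of_unity:
  assumes "n > 0" shows "finite {t \<in> carrier R. t [^] (n::nat) = \<one>}"
proof -
  \<comment> \<open>With leading coefficient 1 in front, this is the coefficient list of
    \<open>X^n - 1\<close>, highest degree first.\<close>
  define q where "q = replicate (n - 1) \<zero> @ [\<ominus> \<one>]"
  have q: "set q \<subseteq> carrier R" "length q = n" using assms by (auto simp: q_def)
  have "polynomial (carrier R) (\<one> # q)" using q by (simp add: polynomial_def)
  then have "finite {t. is_root (\<one> # q) t}" by (intro finite_number_of_roots) (simp add: univ_poly_carrier)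
  moreover have "is_root (\<one> # q) t" if "t \<in> carrier R" "t [^] n = \<one>" for t
  proof -
    have "eval q t = \<ominus> \<one>" unfolding q_def using that(1) by (subst eval_replicate) auto
    then show ?thesis using that q by (simp add: is_root_def r_neg)
  qed
  then have "{t \<in> carrier R. t [^] n = \<one>} \<subseteq> {t. is_root (\<one> # q) t}" by blast
  ultimately show ?thesis by (rule finite_subset[rotated])
qed

context twisted_algebra
begin

lemma ring_A: "ring A"
proof (rule ringI)
  show "abelian_group A"
  proof (rule abelian_groupI)
    fix a assume a: "a \<in> carrier A"
    let ?b = "\<lambda>x\<in>carrier G. \<ominus>\<^bsub>K\<^esub> a x"
    have b: "?b \<in> carrier A"
      using a by (intro restrict_in_A[of _ "supp a"]) (auto simp: finite_supp, auto simp: coeff_support_def)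
    have "?b \<oplus>\<^bsub>A\<^esub> a = \<zero>\<^bsub>A\<^esub>"
      using a b by (intro A_ext add_closed_A zero_closed_A) (simp_all add: add_apply zero_apply K.l_neg)
    then show "\<exists>b\<in>carrier A. b \<oplus>\<^bsub>A\<^esub> a = \<zero>\<^bsub>A\<^esub>" using b by blast
  next
    fix a b c assume "a \<in> carrier A" "b \<in> carrier A" "c \<in> carrier A"
    then show "a \<oplus>\<^bsub>A\<^esub> b \<oplus>\<^bsub>A\<^esub> c = a \<oplus>\<^bsub>A\<^esub> (b \<oplus>\<^bsub>A\<^esub> c)"
      by (intro A_ext add_closed_A) (simp_all add: add_apply K.a_assoc)
  next
    fix a b assume "a \<in> carrier A" "b \<in> carrier A"
    then show "a \<oplus>\<^bsub>A\<^esub> b = b \<oplus>\<^bsub>A\<^esub> a"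
      by (intro A_ext add_closed_A) (simp_all add: add_apply K.a_comm)
  next
    fix a assume "a \<in> carrier A"
    then show "\<zero>\<^bsub>A\<^esub> \<oplus>\<^bsub>A\<^esub> a = a"
      by (intro A_ext add_closed_A zero_closed_A) (simp_all add: add_apply zero_apply)
  qed (rule add_closed_A zero_closed_A; assumption?)+
  show "monoid A"
  proof (rule monoidI)
    show "\<one>\<^bsub>A\<^esub> \<in> carrier A" unfolding one_A by (rule scalar_closed) simp
  next
    fix a assume a: "a \<in> carrier A"
    show "\<one>\<^bsub>A\<^esub> \<otimes>\<^bsub>A\<^esub> a = a" "a \<otimes>\<^bsub>A\<^esub> \<one>\<^bsub>A\<^esub> = a"
      unfolding one_A using a
      by (auto intro!: A_ext mult_closed_A scalar_closed simp: scalar_mult_apply)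
  qed (auto intro: mult_closed_A mult_assoc_A)
  fix a b c assume a: "a \<in> carrier A" and b: "b \<in> carrier A" and c: "c \<in> carrier A"
  show "(a \<oplus>\<^bsub>A\<^esub> b) \<otimes>\<^bsub>A\<^esub> c = a \<otimes>\<^bsub>A\<^esub> c \<oplus>\<^bsub>A\<^esub> b \<otimes>\<^bsub>A\<^esub> c"
  proof (rule A_ext)
    fix x assume x: "x \<in> carrier G"
    have d: "x \<otimes>\<^bsub>G\<^esub> inv\<^bsub>G\<^esub> h \<in> carrier G" "c h \<in> carrier K" "lam (x \<otimes>\<^bsub>G\<^esub> inv\<^bsub>G\<^esub> h) h \<in> carrier K"
      if "h \<in> supp c" for h
    proof -
      have "h \<in> carrier G" using that supp_subset by blast
      then show "x \<otimes>\<^bsub>G\<^esub> inv\<^bsub>G\<^esub> h \<in> carrier G" "c h \<in> carrier K" "lam (x \<otimes>\<^bsub>G\<^esub> inv\<^bsub>G\<^esub> h) h \<in> carrier K"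
        using x c lam(1) by simp_all
    qed
    note r = mult_right[OF _ c x finite_supp[OF c] subset_refl supp_subset]
    show "((a \<oplus>\<^bsub>A\<^esub> b) \<otimes>\<^bsub>A\<^esub> c) x = (a \<otimes>\<^bsub>A\<^esub> c \<oplus>\<^bsub>A\<^esub> b \<otimes>\<^bsub>A\<^esub> c) x"
    proof -
      define f where "f a h = a (x \<otimes>\<^bsub>G\<^esub> inv\<^bsub>G\<^esub> h) \<otimes>\<^bsub>K\<^esub> c h \<otimes>\<^bsub>K\<^esub> lam (x \<otimes>\<^bsub>G\<^esub> inv\<^bsub>G\<^esub> h) h" for a h
      have fc: "f a h \<in> carrier K" "f b h \<in> carrier K" if "h \<in> supp c" for h
        using d[OF that] a b by (simp_all add: f_def)
      have "finsum K (f (a \<oplus>\<^bsub>A\<^esub> b)) (supp c) = finsum K (\<lambda>h. f a h \<oplus>\<^bsub>K\<^esub> f b h) (supp c)"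
      proof (rule K.finsum_cong')
        fix h assume h: "h \<in> supp c"
        show "f (a \<oplus>\<^bsub>A\<^esub> b) h = f a h \<oplus>\<^bsub>K\<^esub> f b h"
          using d[OF h] a b by (simp add: f_def add_apply K.l_distr)
      qed (use fc in auto)
      also have "\<dots> = finsum K (f a) (supp c) \<oplus>\<^bsub>K\<^esub> finsum K (f b) (supp c)"
        using fc by (intro K.finsum_addf) auto
      finally show ?thesis
        unfolding add_apply[OF x] r[OF a] r[OF b] r[OF add_closed_A[OF a b]] f_def .
    qed
  qed (auto intro: a b c mult_closed_A add_closed_A)
  show "c \<otimes>\<^bsub>A\<^esub> (a \<oplus>\<^bsub>A\<^esub> b) = c \<otimes>\<^bsub>A\<^esub> a \<oplus>\<^bsub>A\<^esub> c \<otimes>\<^bsub>A\<^esub> b"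
  proof (rule A_ext)
    fix x assume x: "x \<in> carrier G"
    have d: "inv\<^bsub>G\<^esub> h \<otimes>\<^bsub>G\<^esub> x \<in> carrier G" "c h \<in> carrier K" "lam h (inv\<^bsub>G\<^esub> h \<otimes>\<^bsub>G\<^esub> x) \<in> carrier K"
      if "h \<in> supp c" for h
    proof -
      have "h \<in> carrier G" using that supp_subset by blast
      then show "inv\<^bsub>G\<^esub> h \<otimes>\<^bsub>G\<^esub> x \<in> carrier G" "c h \<in> carrier K" "lam h (inv\<^bsub>G\<^esub> h \<otimes>\<^bsub>G\<^esub> x) \<in> carrier K"
        using x c lam(1) by simp_all
    qed
    note l = mult_left[OF c _ x finite_supp[OF c] subset_refl supp_subset]
    show "(c \<otimes>\<^bsub>A\<^esub> (a \<oplus>\<^bsub>A\<^esub> b)) x = (c \<otimes>\<^bsub>A\<^esub> a \<oplus>\<^bsub>A\<^esub> c \<otimes>\<^bsub>A\<^esub> b) x"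
    proof -
      define f where "f a h = c h \<otimes>\<^bsub>K\<^esub> a (inv\<^bsub>G\<^esub> h \<otimes>\<^bsub>G\<^esub> x) \<otimes>\<^bsub>K\<^esub> lam h (inv\<^bsub>G\<^esub> h \<otimes>\<^bsub>G\<^esub> x)" for a h
      have fc: "f a h \<in> carrier K" "f b h \<in> carrier K" if "h \<in> supp c" for h
        using d[OF that] a b by (simp_all add: f_def)
      have "finsum K (f (a \<oplus>\<^bsub>A\<^esub> b)) (supp c) = finsum K (\<lambda>h. f a h \<oplus>\<^bsub>K\<^esub> f b h) (supp c)"
      proof (rule K.finsum_cong')
        fix h assume h: "h \<in> supp c"
        show "f (a \<oplus>\<^bsub>A\<^esub> b) h = f a h \<oplus>\<^bsub>K\<^esub> f b h"
          using d[OF h] a b by (simp add: f_def add_apply K.l_distr K.r_distr)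
      qed (use fc in auto)
      also have "\<dots> = finsum K (f a) (supp c) \<oplus>\<^bsub>K\<^esub> finsum K (f b) (supp c)"
        using fc by (intro K.finsum_addf) auto
      finally show ?thesis
        unfolding add_apply[OF x] l[OF a] l[OF b] l[OF add_closed_A[OF a b]] f_def .
    qed
  qed (auto intro: a b c mult_closed_A add_closed_A)
qed

section \<open>Central scalars in the algebra\<close>

sublocale A: ring A by (rule ring_A)

lemma scalar_add:
  assumes "s \<in> carrier K" "t \<in> carrier K"
  shows "scalar s \<oplus>\<^bsub>A\<^esub> scalar t = scalar (s \<oplus>\<^bsub>K\<^esub> t)"
proof (rule A_ext)
  fix x assume "x \<in> carrier G"
  then show "(scalar s \<oplus>\<^bsub>A\<^esub> scalar t) x = scalar (s \<oplus>\<^bsub>K\<^esub> t) x"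
    using assms lam11(1) unfolding add_apply[OF \<open>x \<in> carrier G\<close>] by (simp add: scalar_def K.l_distr)
qed (use assms scalar_closed in auto)

lemma scalar_mult:
  assumes "s \<in> carrier K" "t \<in> carrier K"
  shows "scalar s \<otimes>\<^bsub>A\<^esub> scalar t = scalar (s \<otimes>\<^bsub>K\<^esub> t)"
proof (rule A_ext)
  fix x assume x: "x \<in> carrier G"
  show "(scalar s \<otimes>\<^bsub>A\<^esub> scalar t) x = scalar (s \<otimes>\<^bsub>K\<^esub> t) x"
    unfolding scalar_mult_apply(1)[OF assms(1) scalar_closed[OF assms(2)] x]
    using assms lam11(1) x by (simp add: scalar_def K.m_assoc)
qed (use assms scalar_closed in auto)

lemma scalar_central:
  assumes "t \<in> carrier K" "a \<in> carrier A"
  shows "scalar t \<otimes>\<^bsub>A\<^esub> a = a \<otimes>\<^bsub>A\<^esub> scalar t"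
  using assms scalar_closed by (intro A_ext) (auto simp: scalar_mult_apply)

lemma scalar_diff:
  assumes "s \<in> carrier K" "t \<in> carrier K"
  shows "scalar s \<ominus>\<^bsub>A\<^esub> scalar t = scalar (s \<ominus>\<^bsub>K\<^esub> t)"
proof -
  have "scalar s = scalar (s \<ominus>\<^bsub>K\<^esub> t) \<oplus>\<^bsub>A\<^esub> scalar t"
    using assms by (simp add: scalar_add a_minus_def K.a_assoc K.l_neg)
  then show ?thesis using assms scalar_closed
    by (simp add: a_minus_def A.a_assoc A.r_neg)
qed

lemma scalar_Units:
  assumes "t \<in> carrier K" "t \<noteq> \<zero>\<^bsub>K\<^esub>" shows "scalar t \<in> Units A"
proof -
  have "t \<in> Units K" using assms K.field_Units by simp
  then have "scalar t \<otimes>\<^bsub>A\<^esub> scalar (inv\<^bsub>K\<^esub> t) = \<one>\<^bsub>A\<^esub>" "scalar (inv\<^bsub>K\<^esub> t) \<otimes>\<^bsub>A\<^esub> scalar t = \<one>\<^bsub>A\<^esub>"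
    "scalar (inv\<^bsub>K\<^esub> t) \<in> carrier A"
    using assms scalar_closed by (simp_all add: scalar_mult one_A)
  then show ?thesis using assms scalar_closed unfolding Units_def by blast
qed

lemma scalar_pow: "t \<in> carrier K \<Longrightarrow> scalar t [^]\<^bsub>A\<^esub> (n::nat) = scalar (t [^]\<^bsub>K\<^esub> n)"
  by (induction n) (simp_all add: one_A scalar_mult)

lemma scalar_add_pow: "t \<in> carrier K \<Longrightarrow> add_pow A (n::nat) (scalar t) = scalar (add_pow K n t)"
proof (induction n)
  case 0
  have "scalar \<zero>\<^bsub>K\<^esub> = \<zero>\<^bsub>A\<^esub>"
    using scalar_closed lam11(1) by (intro A_ext) (auto simp: zero_apply scalar_def)
  then show ?case by simp
qed (simp add: scalar_add)

lemma scalar_inj: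
  assumes "s \<in> carrier K" "t \<in> carrier K" "scalar s = scalar t" shows "s = t"
  using fun_cong[OF assms(3), of "\<one>\<^bsub>G\<^esub>"] assms(1,2) lam11 K.m_rcancel[of "inv\<^bsub>K\<^esub> (lam \<one>\<^bsub>G\<^esub> \<one>\<^bsub>G\<^esub>)" s t] by (simp add: scalar_def)

section \<open>The basis elements as units\<close>

lemma basis_closed: "basis g \<in> carrier A"
  unfolding twisted_basis_def by (intro restrict_in_A[of _ "{g}"]) auto

lemma basis_mult_apply:
  assumes g: "g \<in> carrier G" and z: "z \<in> carrier A" and x: "x \<in> carrier G"
  shows "(basis g \<otimes>\<^bsub>A\<^esub> z) x = z (inv\<^bsub>G\<^esub> g \<otimes>\<^bsub>G\<^esub> x) \<otimes>\<^bsub>K\<^esub> lam g (inv\<^bsub>G\<^esub> g \<otimes>\<^bsub>G\<^esub> x)"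
proof -
  have "supp (basis g) \<subseteq> {g}" by (auto simp: coeff_support_def twisted_basis_def)
  from mult_left[OF basis_closed z x _ this] show ?thesis
    using g z x lam(1) by (simp add: twisted_basis_def)
qed

text \<open>The products of the basis elements at \<open>g\<close> and its inverse, in either order,
  are nonzero scalars.\<close>

lemma basis_Units:
  assumes g: "g \<in> carrier G" shows "basis g \<in> Units A"
proof -
  have unit: "basis h \<otimes>\<^bsub>A\<^esub> basis k \<in> Units A"
    if h: "h \<in> carrier G" and k: "k \<in> carrier G" and hk: "h \<otimes>\<^bsub>G\<^esub> k = \<one>\<^bsub>G\<^esub>" for h k
  proof -
    let ?l = "lam \<one>\<^bsub>G\<^esub> \<one>\<^bsub>G\<^esub>"
    have l: "?l \<in> carrier K" "?l \<noteq> \<zero>\<^bsub>K\<^esub>" "?l \<otimes>\<^bsub>K\<^esub> inv\<^bsub>K\<^esub> ?l = \<one>\<^bsub>K\<^esub>"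
      using lam[of "\<one>\<^bsub>G\<^esub>" "\<one>\<^bsub>G\<^esub>"] lam11 K.m_comm[of ?l "inv\<^bsub>K\<^esub> ?l"] by simp_all
    note lhk = lam[OF h k]
    have "basis h \<otimes>\<^bsub>A\<^esub> basis k = (\<lambda>x\<in>carrier G. lam h k \<otimes>\<^bsub>K\<^esub> basis \<one>\<^bsub>G\<^esub> x)"
      unfolding twisted_basis_mult[OF G.group_axioms K.field_axioms cocycle h k] hk
      by (simp add: twisted_group_algebra_def)
    also have "\<dots> = scalar (lam h k \<otimes>\<^bsub>K\<^esub> ?l)"
      unfolding scalar_def
    proof (rule restrict_ext)
      fix x assume "x \<in> carrier G"
      moreover have "lam h k \<otimes>\<^bsub>K\<^esub> ?l \<otimes>\<^bsub>K\<^esub> inv\<^bsub>K\<^esub> ?l = lam h k"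
        unfolding K.m_assoc[OF lhk(1) l(1) lam11(1)] l(3) using lhk(1) by simp
      ultimately show "lam h k \<otimes>\<^bsub>K\<^esub> basis \<one>\<^bsub>G\<^esub> x =
          (if x = \<one>\<^bsub>G\<^esub> then lam h k \<otimes>\<^bsub>K\<^esub> ?l \<otimes>\<^bsub>K\<^esub> inv\<^bsub>K\<^esub> ?l else \<zero>\<^bsub>K\<^esub>)"
        using lhk(1) by (simp add: twisted_basis_def)
    qed
    finally have "basis h \<otimes>\<^bsub>A\<^esub> basis k = scalar (lam h k \<otimes>\<^bsub>K\<^esub> ?l)" .
    moreover have "lam h k \<otimes>\<^bsub>K\<^esub> ?l \<noteq> \<zero>\<^bsub>K\<^esub>" using lhk l by (simp add: K.integral_iff)
    ultimately show ?thesis using scalar_Units lhk l by simp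
  qed
  have i: "inv\<^bsub>G\<^esub> g \<in> carrier G" using g by simp
  show ?thesis
    by (rule A.Units_of_product_Units[OF basis_closed basis_closed
          unit[OF g i G.r_inv[OF g]] unit[OF i g G.l_inv[OF g]]])
qed

lemma basis_inj: "inj_on basis (carrier G)"
proof (rule inj_onI)
  fix g h assume g: "g \<in> carrier G" and "basis g = basis h"
  then have "basis g g = basis h g" by simp
  then show "g = h" using g by (auto simp: twisted_basis_def split: if_splits)
qed

text \<open>Fix \<open>s\<close> in the support of \<open>z\<close>. Comparing coefficients at
  \<open>h s\<close> shows that \<open>g^-1 h s\<close> also lies in this finite support, which
  leaves finitely many \<open>h\<close>.\<close>

lemma finite_basis_coincidence:
  assumes z: "z \<in> carrier A" "z \<noteq> \<zero>\<^bsub>A\<^esub>" and g: "g \<in> carrier G"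
  shows "finite {h \<in> carrier G. basis h \<otimes>\<^bsub>A\<^esub> z = basis g \<otimes>\<^bsub>A\<^esub> z}"
proof -
  obtain s where s: "s \<in> carrier G" "z s \<noteq> \<zero>\<^bsub>K\<^esub>"
    using A_ext[OF z(1) zero_closed_A] z(2) by (auto simp: zero_apply)
  have "h \<in> (\<lambda>k. g \<otimes>\<^bsub>G\<^esub> k \<otimes>\<^bsub>G\<^esub> inv\<^bsub>G\<^esub> s) ` supp z"
    if h: "h \<in> carrier G" and eq: "basis h \<otimes>\<^bsub>A\<^esub> z = basis g \<otimes>\<^bsub>A\<^esub> z" for h
  proof -
    let ?k = "inv\<^bsub>G\<^esub> g \<otimes>\<^bsub>G\<^esub> (h \<otimes>\<^bsub>G\<^esub> s)"
    have x: "h \<otimes>\<^bsub>G\<^esub> s \<in> carrier G" "?k \<in> carrier G" using h s g by auto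
    have "inv\<^bsub>G\<^esub> h \<otimes>\<^bsub>G\<^esub> (h \<otimes>\<^bsub>G\<^esub> s) = s" using h s by simp
    then have "(basis h \<otimes>\<^bsub>A\<^esub> z) (h \<otimes>\<^bsub>G\<^esub> s) = z s \<otimes>\<^bsub>K\<^esub> lam h s"
      using basis_mult_apply[OF h z(1) x(1)] by simp
    moreover have "z s \<otimes>\<^bsub>K\<^esub> lam h s \<noteq> \<zero>\<^bsub>K\<^esub>" using s lam[OF h s(1)] z(1) by (simp add: K.integral_iff)
    ultimately have "(basis g \<otimes>\<^bsub>A\<^esub> z) (h \<otimes>\<^bsub>G\<^esub> s) \<noteq> \<zero>\<^bsub>K\<^esub>" using eq by simp
    then have "z ?k \<noteq> \<zero>\<^bsub>K\<^esub>" using basis_mult_apply[OF g z(1) x(1)] lam(1)[OF g x(2)] by auto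
    then have "?k \<in> supp z" using x by (simp add: coeff_support_def)
    moreover have "h = g \<otimes>\<^bsub>G\<^esub> ?k \<otimes>\<^bsub>G\<^esub> inv\<^bsub>G\<^esub> s" using h s g by (simp add: G.m_assoc)
    ultimately show ?thesis by blast
  qed
  then have "{h \<in> carrier G. basis h \<otimes>\<^bsub>A\<^esub> z = basis g \<otimes>\<^bsub>A\<^esub> z} \<subseteq> (\<lambda>k. g \<otimes>\<^bsub>G\<^esub> k \<otimes>\<^bsub>G\<^esub> inv\<^bsub>G\<^esub> s) ` supp z"
    by blast
  then show ?thesis by (rule finite_subset[OF _ finite_imageI[OF finite_supp[OF z(1)]]])
qed

end

section \<open>From central commutators to the derived and lower central series\<close>

context group
begin

text \<open>Commutators of \<open>D\<close> fall into \<open>T\<close>, those of \<open>T\<close>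
  into \<open>Z\<close>, and those of \<open>Z\<close> with \<open>D\<close> are trivial. The three
  steps bound the derived length of \<open>D\<close>, the last two the class of
  \<open>T\<close>.\<close>

lemma fc_center_solvable_nilpotent:
  assumes key: "\<And>a b x. a \<in> torsion_elements G (fc_center G) \<Longrightarrow> b \<in> torsion_elements G (fc_center G) \<Longrightarrow>
    x \<in> fc_center G \<Longrightarrow> (a \<otimes> b \<otimes> inv a \<otimes> inv b) \<otimes> x = x \<otimes> (a \<otimes> b \<otimes> inv a \<otimes> inv b)"
  shows "solvable_of_length_le (G\<lparr>carrier := fc_center G\<rparr>) 3"
    and "nilpotent_of_class_le (G\<lparr>carrier := torsion_elements G (fc_center G)\<rparr>) 2"
proof -
  define D where "D = fc_center G"
  define T where "T = torsion_elements G D"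
  define Z where "Z = {z \<in> T. \<forall>x\<in>D. z \<otimes> x = x \<otimes> z}"
  let ?D = "G\<lparr>carrier := D\<rparr>" and ?T = "G\<lparr>carrier := T\<rparr>"
  have subD: "subgroup D G" unfolding D_def by (rule subgroup_fc_center)
  have subT: "subgroup T G" unfolding T_def D_def by (rule subgroup_torsion_fc_center)
  have TD: "T \<subseteq> D" by (auto simp: T_def torsion_elements_def)
  have DC: "D \<subseteq> carrier G" by (rule subgroup.subset[OF subD])
  note Dcl = subgroup.m_closed[OF subD] subgroup.m_inv_closed[OF subD]
  note Tcl = subgroup.one_closed[OF subT] subgroup.m_closed[OF subT] subgroup.m_inv_closed[OF subT]
  have subZ: "subgroup Z G"
  proof (rule subgroupI)
    show "Z \<subseteq> carrier G" using TD DC by (auto simp: Z_def)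
    have "\<one> \<in> Z" using Tcl(1) DC by (auto simp: Z_def)
    then show "Z \<noteq> {}" by blast
  next
    fix a assume a: "a \<in> Z"
    then have ac: "a \<in> T" "a \<in> carrier G" using TD DC by (auto simp: Z_def)
    have "inv a \<otimes> x = x \<otimes> inv a" if x: "x \<in> D" for x
    proof -
      have xc: "x \<in> carrier G" using x DC by blast
      have "inv a \<otimes> (a \<otimes> x) \<otimes> inv a = inv a \<otimes> (x \<otimes> a) \<otimes> inv a" using a x by (simp add: Z_def)
      then show ?thesis using ac xc by (simp add: m_assoc)
    qed
    then show "inv a \<in> Z" using Tcl(3) ac by (simp add: Z_def)
  next
    fix a b assume ab: "a \<in> Z" "b \<in> Z"
    then have c: "a \<in> carrier G" "b \<in> carrier G" using TD DC by (auto simp: Z_def)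
    have "(a \<otimes> b) \<otimes> x = x \<otimes> (a \<otimes> b)" if "x \<in> D" for x
      using ab c that DC by (intro commutes_mult) (auto simp: Z_def)
    then show "a \<otimes> b \<in> Z" using ab Tcl(2) by (simp add: Z_def)
  qed
  have comm_T: "x \<otimes> y \<otimes> inv x \<otimes> inv y \<in> T" if "x \<in> D" "y \<in> D" for x y
    using commutator_fc_center_torsion[of x y] that Dcl
    by (auto simp: T_def torsion_elements_def D_def)
  have comm_Z: "x \<otimes> y \<otimes> inv x \<otimes> inv y \<in> Z" if "x \<in> T" "y \<in> T" for x y
    using key[of x y] that Tcl by (auto simp: Z_def T_def D_def)
  have comm_1: "x \<otimes> y \<otimes> inv x \<otimes> inv y = \<one>" if "x \<in> Z" "y \<in> D" for x y
  proof -
    have c: "x \<in> carrier G" "y \<in> carrier G" using that TD DC by (auto simp: Z_def)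
    have "x \<otimes> y = y \<otimes> x" using that by (simp add: Z_def)
    then show ?thesis using c by (simp add: m_assoc)
  qed
  have gen_one: "generate G S = {\<one>}" if "S \<subseteq> {\<one>}" for S
    using generate_subgroup_incl[OF that triv_subgroup] generate.one[of G S] by blast
  have "derived G D \<subseteq> T"
    unfolding derived_def by (rule generate_subgroup_incl[OF _ subT]) (use comm_T in blast)
  moreover have "derived G T \<subseteq> Z"
    unfolding derived_def by (rule generate_subgroup_incl[OF _ subZ]) (use comm_Z in blast)
  ultimately have DD: "derived G (derived G D) \<subseteq> Z" using mono_derived by blast
  have "derived G Z = {\<one>}"
    unfolding derived_def using comm_1 TD by (intro gen_one) (auto simp: Z_def)
  then have "derived G (derived G (derived G D)) \<subseteq> {\<one>}" using mono_derived[OF DD] by simp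
  moreover have "\<one> \<in> derived G (derived G (derived G D))"
    unfolding derived_def[of G "derived G (derived G D)"] by (rule generate.one)
  moreover have sub1: "derived G D \<subseteq> D" "derived G (derived G D) \<subseteq> D"
    using derived_incl[OF _ subD] by blast+
  ultimately have D3: "(derived ?D ^^ 3) (carrier ?D) = {\<one>}"
    using derived_consistent[OF _ subD] by (simp add: numeral_3_eq_3 subset_antisym)
  have grpD: "group ?D" by (rule subgroup_imp_group[OF subD])
  have "solvable ?D" unfolding group.solvable_iff_trivial_derived_seq[OF grpD] using D3 by auto
  then show "solvable_of_length_le (G\<lparr>carrier := fc_center G\<rparr>) 3"
    using D3 grpD by (simp add: solvable_of_length_le_def D_def)
  have invT: "inv\<^bsub>?T\<^esub> x = inv x" if "x \<in> T" for x using m_inv_consistent[OF subT that] by simp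
  \<comment> \<open>The series is indexed from zero, so index 1 is the commutator subgroup of
    \<open>T\<close>, and class at most 2 is a statement about index 2.\<close>
  have L1: "lower_central_series ?T 1 \<subseteq> Z"
  proof -
    have "(\<Union>x\<in>T. \<Union>y\<in>T. {x \<otimes> y \<otimes> inv\<^bsub>?T\<^esub> x \<otimes> inv\<^bsub>?T\<^esub> y}) \<subseteq> Z" using comm_Z invT by auto
    moreover from this have "(\<Union>x\<in>T. \<Union>y\<in>T. {x \<otimes> y \<otimes> inv\<^bsub>?T\<^esub> x \<otimes> inv\<^bsub>?T\<^esub> y}) \<subseteq> T" by (auto simp: Z_def)
    ultimately show ?thesis
      using generate_subgroup_incl[OF _ subZ] generate_consistent[OF _ subT] by simp
  qed
  define S where "S = (\<Union>x\<in>lower_central_series ?T 1. \<Union>y\<in>T. {x \<otimes> y \<otimes> inv\<^bsub>?T\<^esub> x \<otimes> inv\<^bsub>?T\<^esub> y})"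
  have "S \<subseteq> {\<one>}"
  proof
    fix c assume "c \<in> S"
    then obtain x y where xy: "x \<in> Z" "y \<in> T" "c = x \<otimes> y \<otimes> inv\<^bsub>?T\<^esub> x \<otimes> inv\<^bsub>?T\<^esub> y"
      using L1 unfolding S_def by blast
    then have "x \<in> T" "y \<in> D" using TD by (auto simp: Z_def)
    then show "c \<in> {\<one>}" using xy comm_1 invT by simp
  qed
  moreover from this have "S \<subseteq> T" using Tcl(1) by auto
  ultimately have "generate ?T S = {\<one>}" using generate_consistent[OF _ subT] gen_one by simp
  then have "lower_central_series ?T 2 = {\<one>}" by (simp add: S_def numeral_2_eq_2)
  then show "nilpotent_of_class_le (G\<lparr>carrier := torsion_elements G (fc_center G)\<rparr>) 2"
    using subgroup_imp_group[OF subT] by (simp add: nilpotent_of_class_le_def T_def D_def)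
qed

end

lemma (in twisted_algebra) torsion_commutator_central:
  assumes inf: "infinite (carrier A)"
    and a: "a \<in> torsion_elements (units_of A) (fc_center (units_of A))"
    and b: "b \<in> torsion_elements (units_of A) (fc_center (units_of A))"
    and x: "x \<in> fc_center (units_of A)"
  shows "(a \<otimes>\<^bsub>A\<^esub> b \<otimes>\<^bsub>A\<^esub> inv\<^bsub>A\<^esub> a \<otimes>\<^bsub>A\<^esub> inv\<^bsub>A\<^esub> b) \<otimes>\<^bsub>A\<^esub> x =
    x \<otimes>\<^bsub>A\<^esub> (a \<otimes>\<^bsub>A\<^esub> b \<otimes>\<^bsub>A\<^esub> inv\<^bsub>A\<^esub> a \<otimes>\<^bsub>A\<^esub> inv\<^bsub>A\<^esub> b)"
proof (cases "finite (carrier K)")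
  case True
  have G: "infinite (carrier G)"
  proof
    assume "finite (carrier G)"
    then have "finite (carrier G \<rightarrow>\<^sub>E carrier K)" using True by (intro finite_PiE) auto
    moreover have "carrier A \<subseteq> carrier G \<rightarrow>\<^sub>E carrier K" by (auto simp: carrier_A_iff)
    ultimately show False using inf finite_subset by blast
  qed
  \<comment> \<open>By Lagrange's theorem in the additive group the order of the field annihilates
    1; a positive multiple of the characteristic is enough here.\<close>
  let ?k = "card (carrier K)"
  have k: "?k > 0" using True K.zero_closed by (auto simp: card_gt_0_iff)
  have "add_pow K ?k \<one>\<^bsub>K\<^esub> = \<zero>\<^bsub>K\<^esub>"
    using group.pow_order_eq_1[OF K.a_group, of "\<one>\<^bsub>K\<^esub>"] by (simp add: add_pow_def order_def)
  then have char: "add_pow A ?k \<one>\<^bsub>A\<^esub> = \<zero>\<^bsub>A\<^esub>"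
    using scalar_add_pow[of "\<one>\<^bsub>K\<^esub>" ?k] scalar_add_pow[of "\<zero>\<^bsub>K\<^esub>" 0] by (simp add: one_A)
  show ?thesis
  proof (rule A.torsion_commutator_commutes[OF k char _ _ _ a b x])
    show "infinite (basis ` carrier G)" using G basis_inj finite_imageD by blast
    show "basis ` carrier G \<subseteq> Units A" using basis_Units by blast
    fix z v assume z: "z \<in> carrier A" "z \<noteq> \<zero>\<^bsub>A\<^esub>" and "v \<in> basis ` carrier G"
    then obtain g where g: "g \<in> carrier G" "v = basis g" by blast
    have "{w \<in> basis ` carrier G. w \<otimes>\<^bsub>A\<^esub> z = v \<otimes>\<^bsub>A\<^esub> z} =
        basis ` {h \<in> carrier G. basis h \<otimes>\<^bsub>A\<^esub> z = basis g \<otimes>\<^bsub>A\<^esub> z}" using g by blast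
    then show "finite {w \<in> basis ` carrier G. w \<otimes>\<^bsub>A\<^esub> z = v \<otimes>\<^bsub>A\<^esub> z}"
      using finite_basis_coincidence[OF z g(1)] by simp
  qed
next
  case False
  have aU: "a \<in> Units A" "b \<in> Units A" "b \<in> fc_center (units_of A)"
    using a b by (auto simp: torsion_elements_def A.fc_center_units_iff)
  then have abc: "a \<in> carrier A" "b \<in> carrier A" by auto
  obtain n :: nat where n: "n > 0" "a [^]\<^bsub>A\<^esub> n = \<one>\<^bsub>A\<^esub>"
    using a A.units_of_pow[OF aU(1)] by (auto simp: torsion_elements_def units_of_one)
  \<comment> \<open>Removing the finitely many \<open>n\<close>-th roots of unity keeps
    \<open>t^n - 1\<close> invertible and leaves infinitely many scalars.\<close>
  define T where "T = carrier K - {t \<in> carrier K. t [^]\<^bsub>K\<^esub> n = \<one>\<^bsub>K\<^esub>}"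
  have inj: "inj_on scalar T" using scalar_inj by (intro inj_onI) (auto simp: T_def)
  have infT: "infinite (scalar ` T)"
    using False K.finite_roots_of_unity[OF n(1)] finite_imageD[OF _ inj] by (auto simp: T_def)
  have "a \<otimes>\<^bsub>A\<^esub> b = b \<otimes>\<^bsub>A\<^esub> a"
  proof (rule A.periodic_commutes_fc_center[OF aU(3) abc(1) n(2) infT])
    show "scalar ` T \<subseteq> carrier A" using scalar_closed by (auto simp: T_def)
  next
    fix t z assume "t \<in> scalar ` T" "z \<in> carrier A"
    then show "t \<otimes>\<^bsub>A\<^esub> z = z \<otimes>\<^bsub>A\<^esub> t" using scalar_central by (auto simp: T_def)
  next
    fix t t' assume "t \<in> scalar ` T" "t' \<in> scalar ` T" "t \<noteq> t'"
    then obtain r r' where r: "r \<in> carrier K" "r' \<in> carrier K" "r \<noteq> r'" "t = scalar r" "t' = scalar r'"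
      by (auto simp: T_def)
    then show "t \<ominus>\<^bsub>A\<^esub> t' \<in> Units A" using scalar_Units[of "r \<ominus>\<^bsub>K\<^esub> r'"] by (simp add: scalar_diff)
  next
    fix t assume "t \<in> scalar ` T"
    then obtain r where r: "r \<in> carrier K" "r [^]\<^bsub>K\<^esub> n \<noteq> \<one>\<^bsub>K\<^esub>" "t = scalar r" by (auto simp: T_def)
    then show "t [^]\<^bsub>A\<^esub> n \<ominus>\<^bsub>A\<^esub> \<one>\<^bsub>A\<^esub> \<in> Units A"
      using scalar_Units[of "r [^]\<^bsub>K\<^esub> n \<ominus>\<^bsub>K\<^esub> \<one>\<^bsub>K\<^esub>"] by (simp add: scalar_pow one_A scalar_diff)
  qed
  then have "a \<otimes>\<^bsub>A\<^esub> b \<otimes>\<^bsub>A\<^esub> inv\<^bsub>A\<^esub> a \<otimes>\<^bsub>A\<^esub> inv\<^bsub>A\<^esub> b = b \<otimes>\<^bsub>A\<^esub> (a \<otimes>\<^bsub>A\<^esub> inv\<^bsub>A\<^esub> a) \<otimes>\<^bsub>A\<^esub> inv\<^bsub>A\<^esub> b"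
    using aU(1,2) abc by (simp add: A.m_assoc del: A.Units_r_inv)
  also have "\<dots> = \<one>\<^bsub>A\<^esub>" using aU(1,2) abc by simp
  finally show ?thesis using A.fc_center_units_closed[OF x] by simp
qed

theorem mainTheorem3:
  fixes G :: "('g, 'm) monoid_scheme"
    and K :: "('k, 'r) ring_scheme"
    and lam :: "'g \<Rightarrow> 'g \<Rightarrow> 'k"
  assumes "group G"
    and "field K"
    and "two_cocycle G K lam"
    and "infinite (carrier (twisted_group_algebra G K lam))"
  shows "let U = units_of (twisted_group_algebra G K lam);
             DU = fc_center U;
             tDU = torsion_elements U DU
         in solvable_of_length_le (U\<lparr>carrier := DU\<rparr>) 3 \<and>
            nilpotent_of_class_le (U\<lparr>carrier := tDU\<rparr>) 2"
proof -
  interpret twisted_algebra G K lam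
    using assms(1-3) by (intro twisted_algebra.intro twisted_algebra_axioms.intro)
  let ?U = "units_of A"
  interpret U: group ?U by (rule A.units_group)
  have "(a \<otimes>\<^bsub>?U\<^esub> b \<otimes>\<^bsub>?U\<^esub> inv\<^bsub>?U\<^esub> a \<otimes>\<^bsub>?U\<^esub> inv\<^bsub>?U\<^esub> b) \<otimes>\<^bsub>?U\<^esub> x =
      x \<otimes>\<^bsub>?U\<^esub> (a \<otimes>\<^bsub>?U\<^esub> b \<otimes>\<^bsub>?U\<^esub> inv\<^bsub>?U\<^esub> a \<otimes>\<^bsub>?U\<^esub> inv\<^bsub>?U\<^esub> b)"
    if ab: "a \<in> torsion_elements ?U (fc_center ?U)" "b \<in> torsion_elements ?U (fc_center ?U)"
      and x: "x \<in> fc_center ?U" for a b x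
  proof -
    have "a \<in> Units A" "b \<in> Units A" using ab by (auto simp: torsion_elements_def A.fc_center_units_iff)
    then show ?thesis
      using torsion_commutator_central[OF assms(4) ab x] by (simp add: units_of_mult A.units_of_inv)
  qed
  from U.fc_center_solvable_nilpotent[OF this] show ?thesis by (simp add: Let_def)
qed

end
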